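(* For every pair $(\alpha,\beta)\in\mathbb{R}^2$ with $(\alpha,\beta)\neq(0,0)$, let $G(\alpha,\beta)$ be the connected, simply connected nilpotent Lie group with Lie algebra $\mathfrak{g}(\alpha,\beta)$ and let $Z$ be its center. Then the group $G(\alpha,\beta)/Z$ admits an irreducible, square-integrable projective unitary representation, but $G(\alpha,\beta)/Z$ does not admit a family of dilations.
   Context: For $\alpha,\beta\in\mathbb{R}$, $\mathfrak{g}(\alpha,\beta)$ is the $11$-dimensional real Lie algebra with basis $e_1,\dots,e_{11}$ whose nonzero brackets (up to skew-symmetry) are: $[e_1,e_i]=e_{i+1}$ for $2\le i\le 10$; $[e_2,e_3]=e_5+\alpha e_6$, $[e_2,e_4]=e_6+\alpha e_7$, $[e_2,e_5]=-e_7+(\alpha-\beta)e_8$, $[e_2,e_6]=-3e_8+(\alpha-2\beta)e_9$, $[e_2,e_7]=-2e_9-\tfrac14(5\alpha+7\beta)e_{10}+\tfrac1{16}(27\alpha^2+12\alpha\beta+\beta^2)e_{11}$, $[e_2,e_8]=2e_{10}-\tfrac14(23\alpha+\beta)e_{11}$, $[e_2,e_9]=-e_{11}$; $[e_3,e_4]=2e_7+\beta e_8$, $[e_3,e_5]=2e_8+\beta e_9$, $[e_3,e_6]=-e_9+\tfrac14(9\alpha-\beta)e_{10}-\tfrac1{16}(27\alpha^2+12\alpha\beta+\beta^2)e_{11}$, $[e_3,e_7]=-4e_{10}+\tfrac32(3\alpha-\beta)e_{11}$, $[e_3,e_8]=3e_{11}$; $[e_4,e_5]=3e_9-\tfrac14(9\alpha-5\beta)e_{10}+\tfrac1{16}(27\alpha^2+12\alpha\beta+\beta^2)e_{11}$,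 $[e_4,e_6]=3e_{10}-\tfrac14(9\alpha-5\beta)e_{11}$, $[e_4,e_7]=-7e_{11}$; $[e_5,e_6]=10e_{11}$; all other brackets $[e_i,e_j]$ with $i<j$ are zero. A projective unitary representation of a locally compact group $H$ on a Hilbert space $\mathcal{H}$ is a (Borel measurable) map $\rho\colon H\to\mathcal{U}(\mathcal{H})$ with $\rho(xy)=c(x,y)\rho(x)\rho(y)$ for some function $c$ with $|c|=1$; it is irreducible if no nontrivial closed subspace is invariant under all $\rho(x)$, and square-integrable if there is $\eta\neq0$ with $\int_H|\langle\eta,\rho(x)\eta\rangle|^2\,d\mu_H(x)<\infty$ for a Haar measure $\mu_H$. A connected, simply connected nilpotent Lie group with Lie algebra $\mathfrak{h}$ admits a family of dilations if there is a diagonalizable linear operator $A\colon\mathfrak{h}\to\mathfrak{h}$ with all eigenvalues positive such that $\exp(A\log t)$ is a Lie algebra automorphism of $\mathfrak{h}$ for every $t>0$. *)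

theory Defs
  imports "HOL-Analysis.Analysis" "HOL-Library.Numeral_Type"
begin

section \<open>The Lie algebra g(alpha,beta) via structure constants\<close>

(* finite linear combination of basis vectors e_k, given as (k, coefficient) list *)
definition lc :: "(nat \<times> real) list \<Rightarrow> nat \<Rightarrow> real" where
  "lc xs = (\<lambda>m. sum_list (map (\<lambda>(k,c). if k = m then c else 0) xs))"

(* coefficients of [e_i, e_j] for i < j, as a function of the output index k *)
definition brl :: "real \<Rightarrow> real \<Rightarrow> nat \<Rightarrow> nat \<Rightarrow> nat \<Rightarrow> real" where
  "brl a b i j =
    (if i = 1 \<and> 2 \<le> j \<and> j \<le> 10 then lc [(j+1, 1)]
     else if i = 2 \<and> j = 3 then lc [(5,1),(6,a)]
     else if i = 2 \<and> j = 4 then lc [(6,1),(7,a)]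
     else if i = 2 \<and> j = 5 then lc [(7,-1),(8,a-b)]
     else if i = 2 \<and> j = 6 then lc [(8,-3),(9,a-2*b)]
     else if i = 2 \<and> j = 7 then lc [(9,-2),(10,-(5*a+7*b)/4),(11,(27*a^2+12*a*b+b^2)/16)]
     else if i = 2 \<and> j = 8 then lc [(10,2),(11,-(23*a+b)/4)]
     else if i = 2 \<and> j = 9 then lc [(11,-1)]
     else if i = 3 \<and> j = 4 then lc [(7,2),(8,b)]
     else if i = 3 \<and> j = 5 then lc [(8,2),(9,b)]
     else if i = 3 \<and> j = 6 then lc [(9,-1),(10,(9*a-b)/4),(11,-(27*a^2+12*a*b+b^2)/16)]
     else if i = 3 \<and> j = 7 then lc [(10,-4),(11,3*(3*a-b)/2)]
     else if i = 3 \<and> j = 8 then lc [(11,3)]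
     else if i = 4 \<and> j = 5 then lc [(9,3),(10,-(9*a-5*b)/4),(11,(27*a^2+12*a*b+b^2)/16)]
     else if i = 4 \<and> j = 6 then lc [(10,3),(11,-(9*a-5*b)/4)]
     else if i = 4 \<and> j = 7 then lc [(11,-7)]
     else if i = 5 \<and> j = 6 then lc [(11,10)]
     else (\<lambda>_. 0))"

(* structure constants: [e_i, e_j] = sum_k bc a b i j k e_k  (skew-symmetric extension) *)
definition bc :: "real \<Rightarrow> real \<Rightarrow> nat \<Rightarrow> nat \<Rightarrow> nat \<Rightarrow> real" where
  "bc a b i j k = (if i < j then brl a b i j k else if j < i then - brl a b j i k else 0)"

(* label of a coordinate of real^11 as a basis index 1..11 *)
definition idx :: "11 \<Rightarrow> nat" where
  "idx i = nat (Rep_bit1 i) + 1"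

(* matrix of ad(X) for X = sum_i x_i e_i, in the basis e_1..e_11:
   column j is the coordinate vector of [X, e_j] *)
definition ad_mat :: "real \<Rightarrow> real \<Rightarrow> real^11 \<Rightarrow> real^11^11" where
  "ad_mat a b x = (\<chi> k j. \<Sum>i\<in>UNIV. x $ i * bc a b (idx i) (idx j) (idx k))"

section \<open>Matrix exponential and the group G/Z = Ad(G)\<close>

definition mexp :: "real^'n^'n \<Rightarrow> real^'n^'n" where
  "mexp M = (\<Sum>n. (1 / fact n) *\<^sub>R (((**) M) ^^ n) (mat 1))"

(* G(alpha,beta)/Z realized as Ad(G) = exp(ad g) inside GL(11,R), with matrix product *)
definition GZ :: "real \<Rightarrow> real \<Rightarrow> (real^11^11) set" where
  "GZ a b = {mexp (ad_mat a b x) | x. True}"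

(* Lie algebra of G/Z realized as ad(g), with the commutator bracket *)
definition adalg :: "real \<Rightarrow> real \<Rightarrow> (real^11^11) set" where
  "adalg a b = range (ad_mat a b)"

section \<open>Families of dilations\<close>

definition lin_exp :: "('v::real_normed_vector \<Rightarrow> 'v) \<Rightarrow> 'v \<Rightarrow> 'v" where
  "lin_exp B v = (\<Sum>n. (1 / fact n) *\<^sub>R (B ^^ n) v)"

definition mbr :: "real^'n^'n \<Rightarrow> real^'n^'n \<Rightarrow> real^'n^'n" where
  "mbr X Y = X ** Y - Y ** X"

(* h is a matrix Lie algebra (subspace closed under commutators) *)
definition admits_dilations :: "(real^'n^'n) set \<Rightarrow> bool" where
  "admits_dilations h \<longleftrightarrow>
    (\<exists>A. linear A \<and> A ` h \<subseteq> h \<and>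
      (\<exists>S. S \<subseteq> h \<and> independent S \<and> span S = span h \<and>
            (\<forall>v\<in>S. \<exists>c. A v = c *\<^sub>R v)) \<and>
      (\<forall>v\<in>h. \<forall>c. v \<noteq> 0 \<and> A v = c *\<^sub>R v \<longrightarrow> c > 0) \<and>
      (\<forall>t>0. let \<phi> = lin_exp (\<lambda>v. ln t *\<^sub>R A v) in
           bij_betw \<phi> h h \<and> (\<forall>X\<in>h. \<forall>Y\<in>h. \<phi> (mbr X Y) = mbr (\<phi> X) (\<phi> Y))))"

section \<open>The Hilbert space l2(N) and projective unitary representations\<close>

definition l2 :: "(nat \<Rightarrow> complex) set" where
  "l2 = {f. summable (\<lambda>n. (cmod (f n))\<^sup>2)}"

definition l2_inner :: "(nat \<Rightarrow> complex) \<Rightarrow> (nat \<Rightarrow> complex) \<Rightarrow> complex" where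
  "l2_inner f g = (\<Sum>n. f n * cnj (g n))"

definition l2_norm :: "(nat \<Rightarrow> complex) \<Rightarrow> real" where
  "l2_norm f = sqrt (\<Sum>n. (cmod (f n))\<^sup>2)"

(* unitary operator on l2: linear, bijective onto l2, inner-product preserving *)
definition unitary_l2 :: "((nat \<Rightarrow> complex) \<Rightarrow> (nat \<Rightarrow> complex)) \<Rightarrow> bool" where
  "unitary_l2 U \<longleftrightarrow> bij_betw U l2 l2 \<and>
     (\<forall>f\<in>l2. \<forall>g\<in>l2. \<forall>c. U (\<lambda>n. c * f n + g n) = (\<lambda>n. c * U f n + U g n)) \<and>
     (\<forall>f\<in>l2. \<forall>g\<in>l2. l2_inner (U f) (U g) = l2_inner f g)"

(* projective unitary representation of the topological group G (matrix product) on l2;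
   Borel measurability w.r.t. the weak(=strong) operator Borel structure on U(l2) *)
definition proj_unitary_rep ::
  "(real^'n^'n) set \<Rightarrow> (real^'n^'n \<Rightarrow> (nat \<Rightarrow> complex) \<Rightarrow> (nat \<Rightarrow> complex)) \<Rightarrow> bool" where
  "proj_unitary_rep G \<rho> \<longleftrightarrow>
     (\<forall>x\<in>G. unitary_l2 (\<rho> x)) \<and>
     (\<exists>c. \<forall>x\<in>G. \<forall>y\<in>G. cmod (c x y) = 1 \<and>
            (\<forall>f\<in>l2. \<rho> (x ** y) f = (\<lambda>n. c x y * \<rho> x (\<rho> y f) n))) \<and>
     (\<forall>f\<in>l2. \<forall>g\<in>l2. (\<lambda>x. l2_inner (\<rho> x f) g) \<in> borel_measurable (restrict_space borel G))"

definition closed_l2_subspace :: "(nat \<Rightarrow> complex) set \<Rightarrow> bool" where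
  "closed_l2_subspace V \<longleftrightarrow> V \<subseteq> l2 \<and> (\<lambda>_. 0) \<in> V \<and>
     (\<forall>f\<in>V. \<forall>g\<in>V. \<forall>c. (\<lambda>n. c * f n + g n) \<in> V) \<and>
     (\<forall>s g. (\<forall>k. s k \<in> V) \<and> g \<in> l2 \<and> (\<lambda>k. l2_norm (\<lambda>n. s k n - g n)) \<longlonglongrightarrow> 0 \<longrightarrow> g \<in> V)"

definition irreducible_rep ::
  "(real^'n^'n) set \<Rightarrow> (real^'n^'n \<Rightarrow> (nat \<Rightarrow> complex) \<Rightarrow> (nat \<Rightarrow> complex)) \<Rightarrow> bool" where
  "irreducible_rep G \<rho> \<longleftrightarrow>
     (\<forall>V. closed_l2_subspace V \<and> (\<forall>x\<in>G. \<rho> x ` V \<subseteq> V) \<longrightarrow> V = {\<lambda>_. 0} \<or> V = l2)"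

(* (left) Haar measure on a closed matrix group G: nonzero, finite on compacts,
   left-invariant Borel measure (automatically Radon, G being second countable) *)
definition haar_measure :: "(real^'n^'n) set \<Rightarrow> (real^'n^'n) measure \<Rightarrow> bool" where
  "haar_measure G \<mu> \<longleftrightarrow>
     space \<mu> = G \<and> sets \<mu> = sets (restrict_space borel G) \<and>
     emeasure \<mu> G \<noteq> 0 \<and>
     (\<forall>K. compact K \<and> K \<subseteq> G \<longrightarrow> emeasure \<mu> K < \<infinity>) \<and>
     (\<forall>g\<in>G. \<forall>A\<in>sets \<mu>. (\<lambda>x. g ** x) ` A \<in> sets \<mu> \<and>
                          emeasure \<mu> ((\<lambda>x. g ** x) ` A) = emeasure \<mu> A)"

definition square_integrable_rep ::
  "(real^'n^'n) set \<Rightarrow> (real^'n^'n \<Rightarrow> (nat \<Rightarrow> complex) \<Rightarrow> (nat \<Rightarrow> complex)) \<Rightarrow> bool" where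
  "square_integrable_rep G \<rho> \<longleftrightarrow>
     (\<exists>\<eta>\<in>l2. \<eta> \<noteq> (\<lambda>_. 0) \<and>
        (\<exists>\<mu>. haar_measure G \<mu> \<and>
              (\<integral>\<^sup>+ x. ennreal ((cmod (l2_inner \<eta> (\<rho> x \<eta>)))\<^sup>2) \<partial>\<mu>) < \<infinity>))"

end

theory Submission
  imports Defs
begin

text \<open>The group acts on row vectors by multiplication from the right. The last row of a group element
  determines it, so the orbit of the last unit row, the affine space of rows with last entry 1,
  is acted upon simply transitively. The entries 6 to 10 of a row form a quotient \<open>\<real>\<^sup>5\<close> of this orbit on which
  the abelian ideal spanned by \<open>e\<^sub>6, \<dots>, e\<^bsub>11\<^esub>\<close> acts trivially; the group acts on it by measure preserving
  maps, and twisting this action by a phase gives a projective representation on \<open>L\<^sup>2(\<real>\<^sup>5)\<close> in which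
  the ideal acts by all characters of \<open>\<real>\<^sup>5\<close>. If \<open>H\<close> is orthogonal to the invariant subspace
  generated by \<open>F\<close>, uniqueness of Fourier coefficients yields \<open>F(g u) H(u) = 0\<close> almost everywhere for
  every \<open>g\<close>, hence \<open>F = 0\<close> or \<open>H = 0\<close> by transitivity. In the coordinates given by the last row, Lebesgue
  measure is a Haar measure. The matrix coefficient of the indicator of a cube is, in five of the
  coordinates, a Fourier transform, which is controlled by Bessel's inequality, and it has compact
  support in the other five.

  A dilation group is generated by a derivation of the Lie algebra which is diagonalizable. The
  images of \<open>e\<^sub>1\<close> and \<open>e\<^sub>2\<close> determine the derivation. Comparing coefficients in the brackets
  \<open>[e\<^sub>2, e\<^sub>3]\<close> and \<open>[e\<^sub>3, e\<^sub>4]\<close> shows that, for \<open>(\<alpha>, \<beta>) \<noteq> (0, 0)\<close>, its diagonal part vanishes, so \<open>e\<^bsub>10\<^esub>\<close> is an eigenvector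
  with eigenvalue 0.\<close>

section \<open>Structure constants and the Jacobi identity\<close>

text \<open>Two facts carry everything: giving e_i weight i, brackets at least add weights
  (\<open>bc_weight\<close>), and the e_11-coefficient of [e_i, e_(11-i)] never vanishes
  (\<open>bc_top\<close>). Together they make the form sending x, y to the e_11-coefficient of
  [x, y] triangular and non-degenerate modulo the centre, which is the line of e_11. The ideal of
  the overview is maximal isotropic for this form, so the representation is the one that the orbit
  method induces from it. Inducing would require explicit group multiplication, hence a long
  Baker-Campbell-Hausdorff formula in \<alpha> and \<beta>. Avoiding it shapes the proof: identities
  between exponentials come from differentiating along paths, group elements are found by a
  triangular iteration with a fixed number of steps, so that they depend continuously on the data,
  and the phase is the integral of an explicit cocycle. The cocycle is needed because the vector
  fields of e_1, ..., e_5 know nothing of the ideal, whereas a bracket such as [e_1, e_5] = e_6 has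
  to act by multiplication with a coordinate.\<close>

lemma idx_le_iff: "idx i \<le> idx j \<longleftrightarrow> i \<le> j"
proof -
  have r: "Rep_bit1 i \<in> {0..<11}" for i :: 11
    using Rep_bit1[of i] by simp
  show ?thesis using r[of i] r[of j] by (auto simp: idx_def less_eq_bit1_def nat_le_eq_zle)
qed

lemma inj_idx: "inj idx"
  by (metis idx_le_iff injI order_antisym order_refl)

lemma idx_less_iff: "idx i < idx j \<longleftrightarrow> i < j"
  by (metis idx_le_iff linorder_not_le)

lemma idx_eq_iff: "idx i = idx j \<longleftrightarrow> i = j"
  using inj_idx by (simp add: inj_eq)

lemma range_idx: "range idx = {1..11}"
proof -
  have "1 \<le> idx i \<and> idx i \<le> 11" for i :: 11
    using Rep_bit1[of i] by (auto simp: idx_def nat_le_iff)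
  then have "range idx \<subseteq> {1..11}"
    by auto
  moreover have "card (range idx) = 11"
    using card_image[OF inj_idx] by simp
  ultimately show ?thesis
    by (intro card_subset_eq) auto
qed

lemma idx_ge_1: "1 \<le> idx i" and idx_le_11: "idx i \<le> 11"
  using range_idx by auto

lemma sum_idx: "(\<Sum>i\<in>UNIV. f (idx i)) = (\<Sum>i=1..11. f i)" for f :: "nat \<Rightarrow> 'a::comm_monoid_add"
  using sum.reindex[OF inj_idx, of f] by (simp add: range_idx)

definition ix :: "nat \<Rightarrow> 11" where "ix = inv idx"

lemma ix_idx [simp]: "ix (idx i) = i"
  by (simp add: ix_def inj_idx)

lemma idx_ix [simp]: "1 \<le> k \<Longrightarrow> k \<le> 11 \<Longrightarrow> idx (ix k) = k"
  unfolding ix_def by (rule f_inv_into_f) (simp add: range_idx)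

lemma sum_ix: "(\<Sum>i\<in>UNIV. f i) = (\<Sum>k=1..11. f (ix k))" for f :: "11 \<Rightarrow> 'a::comm_monoid_add"
  using sum_idx[of "\<lambda>k. f (ix k)"] by simp

lemma ix_eq_iff [simp]: "1 \<le> k \<Longrightarrow> k \<le> 11 \<Longrightarrow> 1 \<le> l \<Longrightarrow> l \<le> 11 \<Longrightarrow> ix k = ix l \<longleftrightarrow> k = l"
  by (metis idx_ix)

lemma sum11: "(\<Sum>i=1..(11::nat). f i) = f 1 + f 2 + f 3 + f 4 + f 5 + f 6 + f 7 + f 8 + f 9 + f 10 + f 11"
  for f :: "nat \<Rightarrow> 'a::comm_monoid_add"
proof -
  have "{1..11::nat} = {1,2,3,4,5,6,7,8,9,10,11}" by (rule set_eqI) (simp, arith)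
  then show ?thesis by (simp add: add.assoc)
qed

lemma lc_Nil [simp]: "lc [] m = 0" and lc_Cons: "lc ((k, c) # xs) m = (if k = m then c else 0) + lc xs m"
  by (simp_all add: lc_def)

lemma sum_lc:
  assumes "\<forall>p\<in>set xs. 1 \<le> fst p \<and> fst p \<le> 11"
  shows "(\<Sum>l=1..11. lc xs l * g l) = sum_list (map (\<lambda>p. snd p * g (fst p)) xs)"
  using assms
proof (induction xs)
  case (Cons p xs)
  obtain k c where p: "p = (k, c)" by fastforce
  have "(\<Sum>l=1..11. (if k = l then c else 0) * g l) = c * g k"
    using Cons.prems p by (simp add: if_distrib[of "\<lambda>x. x * _"] cong: if_cong)
  then show ?case using Cons
    by (simp add: p lc_Cons distrib_right sum.distrib)
qed simp

lemma lc_nonzero: "lc xs k \<noteq> 0 \<Longrightarrow> k \<in> fst ` set xs"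
  by (induction xs) (auto simp: lc_Cons split: if_split_asm)

text \<open>The terms of degree d in \<alpha>, \<beta> sit exactly at weight i + j + d, so the
  parameters only push brackets further down the filtration. Nilpotency, triangularity and most
  vanishing arguments below use nothing else about the table.\<close>

lemma brl_weight: "brl a b i j k \<noteq> 0 \<Longrightarrow> i + j \<le> k \<and> k \<le> 11"
proof -
  assume nz: "brl a b i j k \<noteq> 0"
  define P where "P xs \<longleftrightarrow> lc xs k \<noteq> 0 \<longrightarrow> i + j \<le> k \<and> k \<le> 11" for xs
  have P: "P xs" if "\<forall>p\<in>set xs. i + j \<le> fst p \<and> fst p \<le> 11" for xs
    using that lc_nonzero[of xs k] by (auto simp: P_def)
  define Q where "Q f \<longleftrightarrow> f k \<noteq> 0 \<longrightarrow> i + j \<le> k \<and> k \<le> 11" for f :: "nat \<Rightarrow> real"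
  have Q0: "Q (\<lambda>_. 0)" by (simp add: Q_def)
  have Q1: "Q (lc xs)" if "\<forall>p\<in>set xs. i + j \<le> fst p \<and> fst p \<le> 11" for xs
    using P[OF that] by (simp add: P_def Q_def)
  \<comment> \<open>The predicate is carried through the cascade of conditionals one rule at a time,
    so every leaf is a check of the indices in a single list.\<close>
  have Qif: "(c \<Longrightarrow> Q f) \<Longrightarrow> Q g \<Longrightarrow> Q (if c then f else g)" for c f g
    by simp
  have "Q (brl a b i j)"
    unfolding brl_def
    by (intro Qif Q0 Q1) simp_all
  then show ?thesis using nz by (simp add: Q_def)
qed

lemma bc_weight: "bc a b i j k \<noteq> 0 \<Longrightarrow> i + j \<le> k \<and> k \<le> 11"
  unfolding bc_def using brl_weight[of a b i j k] brl_weight[of a b j i k] by (simp split: if_split_asm)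

lemma bc_skew: "bc a b i j k = - bc a b j i k"
  by (simp add: bc_def)

lemma bc_self [simp]: "bc a b i i k = 0"
  by (simp add: bc_def)

text \<open>The antidiagonal of the form sending x, y to the e_11-coefficient of [x, y]. By weights
  its entries with i + j > 11 vanish, so these ten numbers make the form non-degenerate modulo e_11;
  they are the pivots of every triangular system below.\<close>

lemma bc_top: assumes "1 \<le> i" "i \<le> 10" shows "bc a b i (11 - i) 11 \<noteq> 0"
proof -
  have "i = 1 \<or> i = 2 \<or> i = 3 \<or> i = 4 \<or> i = 5 \<or> i = 6 \<or> i = 7 \<or> i = 8 \<or> i = 9 \<or> i = 10"
    using assms by arith
  then show ?thesis by (elim disjE) (simp_all add: bc_def brl_def lc_Cons)
qed

section \<open>The Jacobi identity\<close>

definition jc :: "real \<Rightarrow> real \<Rightarrow> nat \<Rightarrow> nat \<Rightarrow> nat \<Rightarrow> nat \<Rightarrow> real" where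
  "jc a b i j m k = (\<Sum>l=1..11. bc a b i j l * bc a b l m k + bc a b j m l * bc a b l i k + bc a b m i l * bc a b l j k)"

text \<open>Each term of the Jacobi sum has weight at least i + j + m, so among increasing triples
  only these sixteen, with i + j + m \<le> 11, can have a non-zero component. This is the one place
  where the Jacobi identity looks at the actual coefficients.\<close>

lemma jc_table:
  assumes k: "k = 6 \<or> k = 7 \<or> k = 8 \<or> k = 9 \<or> k = 10 \<or> k = 11"
    and t: "(i, j, m) \<in> {(1,2,3), (1,2,4), (1,2,5), (1,2,6), (1,2,7), (1,2,8), (1,3,4), (1,3,5), (1,3,6),
      (1,3,7), (1,4,5), (1,4,6), (2,3,4), (2,3,5), (2,3,6), (2,4,5)}"
  shows "jc a b i j m k = 0"
  using t k unfolding jc_def sum.distrib insert_iff empty_iff prod.inject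
  by (elim disjE conjE FalseE; simp add: bc_def brl_def sum_lc[simplified] sum_negf;
      simp add: lc_Cons power2_eq_square field_simps)

lemma jc_ordered:
  assumes "1 \<le> i" "i < j" "j < m"
  shows "jc a b i j m k = 0"
proof (cases "i + j + m \<le> k \<and> k \<le> 11")
  case False
  have "bc a b i j l * bc a b l m k = 0" "bc a b j m l * bc a b l i k = 0" "bc a b m i l * bc a b l j k = 0" for l
    using False bc_weight[of a b i j l] bc_weight[of a b l m k] bc_weight[of a b j m l] bc_weight[of a b l i k]
      bc_weight[of a b m i l] bc_weight[of a b l j k] by (auto; linarith)+
  then show ?thesis by (simp only: jc_def add_0_right sum.neutral_const)
next
  case True
  then have s: "i + j + m \<le> 11" "6 \<le> k" "k \<le> 11" using assms by linarith+
  have k: "k = 6 \<or> k = 7 \<or> k = 8 \<or> k = 9 \<or> k = 10 \<or> k = 11" using s(2,3) by arith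
  have b: "i \<le> 2" "j \<le> 4" "2 \<le> j" "m \<le> 8" "3 \<le> m" using assms s(1) by linarith+
  have "i = 1 \<or> i = 2" using b(1) assms(1) by arith
  moreover have "j = 2 \<or> j = 3 \<or> j = 4" using b(2,3) by arith
  moreover have "m = 3 \<or> m = 4 \<or> m = 5 \<or> m = 6 \<or> m = 7 \<or> m = 8" using b(4,5) by arith
  ultimately show ?thesis
    using s(1) assms(2,3) by (intro jc_table k) (elim disjE; simp)
qed

lemma jc_rot: "jc a b i j m k = jc a b j m i k"
  unfolding jc_def by (rule sum.cong) (simp_all add: algebra_simps)

lemma jc_swap: "jc a b i j m k = - jc a b j i m k"
proof -
  have "bc a b i j l * bc a b l m k + bc a b j m l * bc a b l i k + bc a b m i l * bc a b l j k
    = - (bc a b j i l * bc a b l m k + bc a b i m l * bc a b l j k + bc a b m j l * bc a b l i k)" for l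
    using bc_skew[of a b i j l] bc_skew[of a b j m l] bc_skew[of a b m i l] by (simp add: algebra_simps)
  then show ?thesis by (simp add: jc_def flip: sum_negf)
qed

lemma jc_zero: assumes "1 \<le> i" "1 \<le> j" "1 \<le> m" shows "jc a b i j m k = 0"
proof -
  have eq: "jc a b p p q k = 0" for p q
    using jc_swap[of a b p p q k] by simp
  consider "i = j" | "j = m" | "i = m" | "i < j" "j < m" | "j < i" "i < m" | "i < m" "m < j" | "m < i" "i < j"
    | "j < m" "m < i" | "m < j" "j < i"
    by linarith
  then show ?thesis
  proof cases
    case 1 then show ?thesis by (simp add: eq)
  next
    case 2 then show ?thesis by (subst jc_rot) (simp add: eq)
  next
    case 3 then show ?thesis by (subst jc_rot, subst jc_rot) (simp add: eq)
  next
    case 4 then show ?thesis using assms by (simp add: jc_ordered)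
  next
    case 5 then show ?thesis using assms by (subst jc_swap) (simp add: jc_ordered)
  next
    case 6 then show ?thesis using assms by (subst jc_swap, subst jc_rot) (simp add: jc_ordered)
  next
    case 7 then show ?thesis using assms by (subst jc_rot, subst jc_rot) (simp add: jc_ordered)
  next
    case 8 then show ?thesis using assms by (subst jc_rot) (simp add: jc_ordered)
  next
    case 9 then show ?thesis using assms by (subst jc_swap, subst jc_rot, subst jc_rot) (simp add: jc_ordered)
  qed
qed

section \<open>Adjoint matrices\<close>

lemma ad_nth: "ad_mat a b x $ k $ j = (\<Sum>i\<in>UNIV. x $ i * bc a b (idx i) (idx j) (idx k))"
  by (simp add: ad_mat_def)

lemma ad_add: "ad_mat a b (x + y) = ad_mat a b x + ad_mat a b y"
  and ad_diff: "ad_mat a b (x - y) = ad_mat a b x - ad_mat a b y"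
  and ad_scaleR: "ad_mat a b (c *\<^sub>R x) = c *\<^sub>R ad_mat a b x"
  by (simp_all add: vec_eq_iff ad_nth algebra_simps sum.distrib sum_subtractf sum_distrib_left)

lemma linear_ad: "linear (ad_mat a b)"
  by (rule linearI) (simp_all add: ad_add ad_scaleR)

lemma ad_zero [simp]: "ad_mat a b 0 = 0"
  using linear_ad linear_0 by blast

lemma ad_skew: "ad_mat a b x *v y = - (ad_mat a b y *v x)"
proof -
  have "(\<Sum>j\<in>UNIV. (\<Sum>i\<in>UNIV. x $ i * bc a b (idx i) (idx j) (idx k)) * y $ j) =
    - (\<Sum>j\<in>UNIV. (\<Sum>i\<in>UNIV. y $ i * bc a b (idx i) (idx j) (idx k)) * x $ j)" for k
  proof -
    have "(\<Sum>j\<in>UNIV. (\<Sum>i\<in>UNIV. x $ i * bc a b (idx i) (idx j) (idx k)) * y $ j) =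
      (\<Sum>i\<in>UNIV. \<Sum>j\<in>UNIV. x $ i * bc a b (idx i) (idx j) (idx k) * y $ j)"
      by (subst sum.swap) (simp add: sum_distrib_right)
    also have "\<dots> = (\<Sum>i\<in>UNIV. \<Sum>j\<in>UNIV. - (y $ j * bc a b (idx j) (idx i) (idx k) * x $ i))"
      by (intro sum.cong refl) (subst bc_skew, simp add: mult_ac)
    also have "\<dots> = - (\<Sum>j\<in>UNIV. (\<Sum>i\<in>UNIV. y $ i * bc a b (idx i) (idx j) (idx k)) * x $ j)"
      by (simp add: sum_negf sum_distrib_right)
    finally show ?thesis .
  qed
  then show ?thesis by (simp add: vec_eq_iff matrix_vector_mult_def ad_nth)
qed

text \<open>The Jacobi identity contracted with the coordinates of x and y: solved for the term
  containing [e_i, e_j], it is a difference of two matrix products. It also shows that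
  \<open>adalg\<close> is closed under commutators.\<close>

lemma ad_commutator:
  "ad_mat a b (ad_mat a b x *v y) = ad_mat a b x ** ad_mat a b y - ad_mat a b y ** ad_mat a b x"
proof -
  have "ad_mat a b (ad_mat a b x *v y) $ k $ m = (ad_mat a b x ** ad_mat a b y - ad_mat a b y ** ad_mat a b x) $ k $ m" for k m
  proof -
    let ?b = "\<lambda>i j k. bc a b (idx i) (idx j) (idx k)"
    have j: "(\<Sum>l\<in>UNIV. ?b i j l * ?b l m k) = (\<Sum>l\<in>UNIV. ?b i l k * ?b j m l) - (\<Sum>l\<in>UNIV. ?b j l k * ?b i m l)" for i j
    proof -
      have "(\<Sum>l\<in>UNIV. ?b i j l * ?b l m k + ?b j m l * ?b l i k + ?b m i l * ?b l j k) = 0"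
        using jc_zero[of "idx i" "idx j" "idx m" a b "idx k"] idx_ge_1
          sum_idx[of "\<lambda>l. bc a b (idx i) (idx j) l * bc a b l (idx m) (idx k) +
            bc a b (idx j) (idx m) l * bc a b l (idx i) (idx k) + bc a b (idx m) (idx i) l * bc a b l (idx j) (idx k)"]
        by (simp add: jc_def)
      moreover have "?b j m l * ?b l i k = - (?b i l k * ?b j m l)" "?b m i l * ?b l j k = ?b j l k * ?b i m l" for l
        using bc_skew[of a b "idx l" "idx i" "idx k"] bc_skew[of a b "idx m" "idx i" "idx l"] bc_skew[of a b "idx l" "idx j" "idx k"]
        by (simp_all add: mult_ac)
      ultimately show ?thesis by (simp add: sum.distrib sum_negf sum_subtractf)
    qed
    define X where "X l m = (\<Sum>i\<in>UNIV. x $ i * ?b i m l)" for l m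
    define Y where "Y l m = (\<Sum>j\<in>UNIV. y $ j * ?b j m l)" for l m
    have "ad_mat a b (ad_mat a b x *v y) $ k $ m = (\<Sum>l\<in>UNIV. (\<Sum>j\<in>UNIV. \<Sum>i\<in>UNIV. x $ i * ?b i j l * y $ j) * ?b l m k)"
      by (simp add: ad_nth matrix_vector_mult_def sum_distrib_right)
    also have "\<dots> = (\<Sum>l\<in>UNIV. \<Sum>j\<in>UNIV. \<Sum>i\<in>UNIV. x $ i * y $ j * (?b i j l * ?b l m k))"
      by (simp only: sum_distrib_right) (intro sum.cong refl, simp only: mult_ac)
    also have "\<dots> = (\<Sum>j\<in>UNIV. \<Sum>i\<in>UNIV. \<Sum>l\<in>UNIV. x $ i * y $ j * (?b i j l * ?b l m k))"
      by (rule trans[OF sum.swap], rule sum.cong[OF refl], rule sum.swap)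
    also have "\<dots> = (\<Sum>j\<in>UNIV. \<Sum>i\<in>UNIV. x $ i * y $ j * (\<Sum>l\<in>UNIV. ?b i l k * ?b j m l)) -
       (\<Sum>j\<in>UNIV. \<Sum>i\<in>UNIV. x $ i * y $ j * (\<Sum>l\<in>UNIV. ?b j l k * ?b i m l))"
      by (simp only: sum_distrib_left[symmetric] j right_diff_distrib sum_subtractf)
    also have "(\<Sum>j\<in>UNIV. \<Sum>i\<in>UNIV. x $ i * y $ j * (\<Sum>l\<in>UNIV. ?b i l k * ?b j m l)) = (\<Sum>l\<in>UNIV. X k l * Y l m)"
    proof -
      have "(\<Sum>j\<in>UNIV. \<Sum>i\<in>UNIV. x $ i * y $ j * (\<Sum>l\<in>UNIV. ?b i l k * ?b j m l))
         = (\<Sum>j\<in>UNIV. \<Sum>l\<in>UNIV. \<Sum>i\<in>UNIV. x $ i * y $ j * (?b i l k * ?b j m l))"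
        by (simp only: sum_distrib_left) (rule sum.cong[OF refl], rule sum.swap)
      also have "\<dots> = (\<Sum>l\<in>UNIV. \<Sum>j\<in>UNIV. \<Sum>i\<in>UNIV. x $ i * y $ j * (?b i l k * ?b j m l))"
        by (rule sum.swap)
      also have "\<dots> = (\<Sum>l\<in>UNIV. \<Sum>i\<in>UNIV. \<Sum>j\<in>UNIV. x $ i * y $ j * (?b i l k * ?b j m l))"
        by (rule sum.cong[OF refl], rule sum.swap)
      also have "\<dots> = (\<Sum>l\<in>UNIV. X k l * Y l m)"
        unfolding X_def Y_def sum_product by (intro sum.cong refl) (simp only: mult_ac)
      finally show ?thesis .
    qed
    also have "(\<Sum>j\<in>UNIV. \<Sum>i\<in>UNIV. x $ i * y $ j * (\<Sum>l\<in>UNIV. ?b j l k * ?b i m l)) = (\<Sum>l\<in>UNIV. Y k l * X l m)"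
    proof -
      have "(\<Sum>j\<in>UNIV. \<Sum>i\<in>UNIV. x $ i * y $ j * (\<Sum>l\<in>UNIV. ?b j l k * ?b i m l))
         = (\<Sum>j\<in>UNIV. \<Sum>l\<in>UNIV. \<Sum>i\<in>UNIV. x $ i * y $ j * (?b j l k * ?b i m l))"
        by (simp only: sum_distrib_left) (rule sum.cong[OF refl], rule sum.swap)
      also have "\<dots> = (\<Sum>l\<in>UNIV. \<Sum>j\<in>UNIV. \<Sum>i\<in>UNIV. x $ i * y $ j * (?b j l k * ?b i m l))"
        by (rule sum.swap)
      also have "\<dots> = (\<Sum>l\<in>UNIV. Y k l * X l m)"
        unfolding X_def Y_def sum_product by (intro sum.cong refl) (simp only: mult_ac)
      finally show ?thesis .
    qed
    also have "(\<Sum>l\<in>UNIV. X k l * Y l m) - (\<Sum>l\<in>UNIV. Y k l * X l m) =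
        (ad_mat a b x ** ad_mat a b y - ad_mat a b y ** ad_mat a b x) $ k $ m"
      by (simp add: matrix_matrix_mult_def ad_nth X_def Y_def)
    finally show ?thesis .
  qed
  then show ?thesis by (simp add: vec_eq_iff)
qed

lemma ad_lower: "ad_mat a b x $ k $ j \<noteq> 0 \<Longrightarrow> j < k"
proof -
  assume "ad_mat a b x $ k $ j \<noteq> 0"
  then obtain i where "bc a b (idx i) (idx j) (idx k) \<noteq> 0"
    unfolding ad_nth by (metis (lifting) mult_zero_right sum.neutral)
  then show ?thesis using bc_weight[of a b "idx i" "idx j" "idx k"] idx_ge_1[of i] by (simp flip: idx_less_iff)
qed

section \<open>Exponentials of the adjoint representation\<close>

lemma bounded_bilinear_matrix_mult: "bounded_bilinear ((**) :: real^'n^'m \<Rightarrow> real^'p^'n \<Rightarrow> real^'p^'m)"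
  by (subst bilinear_conv_bounded_bilinear[symmetric])
    (auto simp: bilinear_def matrix_matrix_mult_def vec_eq_iff algebra_simps sum.distrib sum_distrib_left intro!: linearI)

lemma bounded_bilinear_vector_matrix: "bounded_bilinear ((v*) :: real^'m \<Rightarrow> real^'n^'m \<Rightarrow> real^'n)"
  by (subst bilinear_conv_bounded_bilinear[symmetric])
    (auto simp: bilinear_def vector_matrix_mult_def vec_eq_iff algebra_simps sum.distrib sum_distrib_left intro!: linearI)

lemma bounded_bilinear_matrix_vector: "bounded_bilinear ((*v) :: real^'n^'m \<Rightarrow> real^'n \<Rightarrow> real^'m)"
  by (subst bilinear_conv_bounded_bilinear[symmetric])
    (auto simp: bilinear_def matrix_vector_mult_def vec_eq_iff algebra_simps sum.distrib sum_distrib_left intro!: linearI)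

interpretation mm: bounded_bilinear "(**) :: real^'n^'m \<Rightarrow> real^'p^'n \<Rightarrow> real^'p^'m"
  by (rule bounded_bilinear_matrix_mult)
interpretation vm: bounded_bilinear "(v*) :: real^'m \<Rightarrow> real^'n^'m \<Rightarrow> real^'n"
  by (rule bounded_bilinear_vector_matrix)
interpretation mv: bounded_bilinear "(*v) :: real^'n^'m \<Rightarrow> real^'n \<Rightarrow> real^'m"
  by (rule bounded_bilinear_matrix_vector)

lemma sum_nonzero_D: "sum f A \<noteq> 0 \<Longrightarrow> \<exists>l\<in>A. f l \<noteq> 0"
  using sum.neutral by metis

text \<open>Iterated left multiplication, because \<open>mexp\<close> writes its powers in this
  way.\<close>

definition mpw :: "real^'n^'n \<Rightarrow> nat \<Rightarrow> real^'n^'n" where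
  "mpw M n = (((**) M) ^^ n) (mat 1)"

lemma mpw_0 [simp]: "mpw M 0 = mat 1" and mpw_Suc: "mpw M (Suc n) = M ** mpw M n"
  by (simp_all add: mpw_def)

lemma mpw_commute: "mpw M n ** M = M ** mpw M n"
  by (induction n) (simp_all add: mpw_Suc flip: matrix_mul_assoc)

lemma mpw_scaleR: "mpw (t *\<^sub>R M) n = t ^ n *\<^sub>R mpw M n"
  by (induction n) (simp_all add: mpw_Suc mm.scaleR_left mm.scaleR_right)

text \<open>Raising the weight by at least m. Degrees add under products, so a matrix of degree 1
  has vanishing eleventh power and its exponential is a polynomial.\<close>

definition graded :: "nat \<Rightarrow> real^11^11 \<Rightarrow> bool" where
  "graded m M \<longleftrightarrow> (\<forall>k j. M $ k $ j \<noteq> 0 \<longrightarrow> idx j + m \<le> idx k)"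

lemma gradedD: "graded m M \<Longrightarrow> idx k < idx j + m \<Longrightarrow> M $ k $ j = 0"
  unfolding graded_def by (metis linorder_not_le)

lemma graded_mat1: "graded 0 (mat 1)"
  by (simp add: graded_def mat_def)

lemma graded_mult: "graded m A \<Longrightarrow> graded n B \<Longrightarrow> graded (m + n) (A ** B)"
  unfolding graded_def
proof safe
  fix k j assume A: "\<forall>k j. A $ k $ j \<noteq> 0 \<longrightarrow> idx j + m \<le> idx k" and B: "\<forall>k j. B $ k $ j \<noteq> 0 \<longrightarrow> idx j + n \<le> idx k"
    and "(A ** B) $ k $ j \<noteq> 0"
  then obtain l where "A $ k $ l * B $ l $ j \<noteq> 0"
    using sum_nonzero_D[of "\<lambda>l. A $ k $ l * B $ l $ j" UNIV] by (auto simp: matrix_matrix_mult_def)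
  then have "idx l + m \<le> idx k" "idx j + n \<le> idx l" using A B by auto
  then show "idx j + (m + n) \<le> idx k" by simp
qed

lemma graded_mpw: "graded m M \<Longrightarrow> graded (n * m) (mpw M n)"
  by (induction n) (auto simp: graded_mat1 mpw_Suc intro: graded_mult)

lemma graded_0: "12 \<le> m + 1 \<Longrightarrow> graded m M \<Longrightarrow> M = 0"
proof -
  assume "12 \<le> m + 1" "graded m M"
  then have "M $ k $ j = 0" for k j
    using gradedD[of m M k j] idx_ge_1[of j] idx_le_11[of k] by simp
  then show "M = 0" by (simp add: vec_eq_iff)
qed

lemma mpw_eq_0: "graded 1 M \<Longrightarrow> 11 \<le> n \<Longrightarrow> mpw M n = 0"
  using graded_0[of n "mpw M n"] graded_mpw[of 1 M n] by simp

lemma mexp_eq: assumes "graded 1 M" shows "mexp M = (\<Sum>n<11. (1 / fact n) *\<^sub>R mpw M n)"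
proof -
  have "mexp M = (\<Sum>n. (1 / fact n) *\<^sub>R mpw M n)"
    by (simp add: mexp_def mpw_def)
  also have "\<dots> = (\<Sum>n<11. (1 / fact n) *\<^sub>R mpw M n)"
    by (rule suminf_finite) (use assms mpw_eq_0 in auto)
  finally show ?thesis .
qed

lemma graded_scaleR: "graded m M \<Longrightarrow> graded m (t *\<^sub>R M)"
  by (simp add: graded_def)

lemma graded_mono: "graded m M \<Longrightarrow> n \<le> m \<Longrightarrow> graded n M"
  unfolding graded_def by (meson add_left_mono le_trans)

lemma mexp_line: assumes "graded 1 M"
  shows "mexp (t *\<^sub>R M) = (\<Sum>n<11. (t ^ n / fact n) *\<^sub>R mpw M n)"
  using mexp_eq[OF graded_scaleR[OF assms, of t]] by (simp add: mpw_scaleR)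

lemma mexp_commute: assumes "graded 1 M" shows "M ** mexp (t *\<^sub>R M) = mexp (t *\<^sub>R M) ** M"
  by (simp add: mexp_line[OF assms] mm.sum_left mm.sum_right mm.scaleR_left mm.scaleR_right mpw_commute)

lemma mexp_line_deriv: assumes "graded 1 M"
  shows "((\<lambda>t. mexp (t *\<^sub>R M)) has_vector_derivative M ** mexp (t *\<^sub>R M)) (at t within S)"
proof -
  have "((\<lambda>t. \<Sum>n<11. (t ^ n / fact n) *\<^sub>R mpw M n) has_vector_derivative
      (\<Sum>n<11. (real n * t ^ (n - 1) / fact n) *\<^sub>R mpw M n)) (at t within S)"
    by (intro has_vector_derivative_sum) (auto intro!: derivative_eq_intros simp: has_vector_derivative_def scaleR_left.diff)
  also have "(\<Sum>n<11. (real n * t ^ (n - 1) / fact n) *\<^sub>R mpw M n) = (\<Sum>n<10. (t ^ n / fact n) *\<^sub>R mpw M (Suc n))"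
    using sum.lessThan_Suc_shift[of "\<lambda>n. (real n * t ^ (n - 1) / fact n) *\<^sub>R mpw M n" 10]
    by (simp del: sum.lessThan_Suc)
  \<comment> \<open>Differentiation shortens the sum by one term; the missing one may be added
    because it carries the eleventh power, which is zero.\<close>
  also have "\<dots> = (\<Sum>n<11. (t ^ n / fact n) *\<^sub>R mpw M (Suc n))"
  proof -
    have "(11::nat) = Suc 10" by simp
    then show ?thesis using mpw_eq_0[OF assms, of "Suc 10"] by (simp only: sum.lessThan_Suc) simp
  qed
  also have "\<dots> = M ** mexp (t *\<^sub>R M)"
    by (simp add: mexp_line[OF assms] mm.sum_right mm.scaleR_right mpw_Suc)
  finally show ?thesis by (simp add: mexp_line[OF assms])
qed

text \<open>The work horse for identities between exponentials: the identity is deformed along t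
  into a trivial one at t = 0, and the deformation is seen to have derivative zero. This replaces
  any rearrangement of power series.\<close>

lemma const_on_unit:
  fixes F :: "real \<Rightarrow> 'v::euclidean_space"
  assumes "\<And>t. t \<in> {0..1} \<Longrightarrow> (F has_vector_derivative 0) (at t within {0..1})" "t \<in> {0..1}"
  shows "F t = F 0"
  using has_vector_derivative_zero_constant[of "{0..1}" F] assms
  by (metis atLeastAtMost_iff convex_real_interval(5) order_refl zero_le_one)

definition E :: "real \<Rightarrow> real \<Rightarrow> real^11 \<Rightarrow> real^11^11" where
  "E a b x = mexp (ad_mat a b x)"

text \<open>Membership in the ideal spanned by e_m, ..., e_11. The descending chain of these ideals
  is what the inductions below run along.\<close>

definition supp_ge :: "nat \<Rightarrow> real^11 \<Rightarrow> bool" where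
  "supp_ge m x \<longleftrightarrow> (\<forall>i. idx i < m \<longrightarrow> x $ i = 0)"

lemma graded_ad: "supp_ge m x \<Longrightarrow> graded m (ad_mat a b x)"
  unfolding graded_def
proof safe
  fix k j assume s: "supp_ge m x" and "ad_mat a b x $ k $ j \<noteq> 0"
  then obtain i where "x $ i * bc a b (idx i) (idx j) (idx k) \<noteq> 0"
    unfolding ad_nth using sum_nonzero_D by blast
  then show "idx j + m \<le> idx k"
    using s bc_weight[of a b "idx i" "idx j" "idx k"] unfolding supp_ge_def
    by (metis (no_types, opaque_lifting) add.commute add_le_cancel_left le_trans linorder_not_le mult_eq_0_iff)
qed

lemma supp_ge_1 [simp]: "supp_ge 1 x" "supp_ge (Suc 0) x" "supp_ge 0 x"
  using idx_ge_1 by (auto simp: supp_ge_def Suc_le_eq not_less_eq_eq[symmetric] dest: order.strict_trans2)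

lemma graded_ad1 [simp]: "graded 1 (ad_mat a b x)" "graded (Suc 0) (ad_mat a b x)"
  using graded_ad[of 1 x a b] by simp_all

lemma E_eq: "E a b x = (\<Sum>n<11. (1 / fact n) *\<^sub>R mpw (ad_mat a b x) n)"
  by (simp add: E_def mexp_eq)

lemma E_0 [simp]: "E a b 0 = mat 1"
proof -
  have "mpw (0::real^11^11) n = 0" if "n > 0" for n using that by (cases n) (simp_all add: mpw_Suc)
  then have "E a b 0 = (\<Sum>n<(11::nat). if n = 0 then mat 1 else 0)"
    unfolding E_eq by (intro sum.cong) auto
  then show ?thesis by simp
qed

lemma E_deriv:
  "((\<lambda>t. E a b (t *\<^sub>R x)) has_vector_derivative ad_mat a b x ** E a b (t *\<^sub>R x)) (at t within S)"
  using mexp_line_deriv[of "ad_mat a b x" t S] by (simp add: E_def ad_scaleR)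

lemma E_commute: "ad_mat a b x ** E a b (t *\<^sub>R x) = E a b (t *\<^sub>R x) ** ad_mat a b x"
  using mexp_commute[of "ad_mat a b x" t] by (simp add: E_def ad_scaleR)

lemma E_deriv_chain:
  assumes "(s has_real_derivative s') (at t within S)"
  shows "((\<lambda>t. E a b (s t *\<^sub>R x)) has_vector_derivative s' *\<^sub>R (ad_mat a b x ** E a b (s t *\<^sub>R x))) (at t within S)"
  using vector_diff_chain_within[OF assms[unfolded has_real_derivative_iff_has_vector_derivative] E_deriv]
  by (simp add: o_def)

lemma E_deriv_minus:
  "((\<lambda>t. E a b (- (t *\<^sub>R x))) has_vector_derivative - (ad_mat a b x ** E a b (- (t *\<^sub>R x)))) (at t within S)"
proof -
  have "(uminus has_real_derivative - 1) (at t within S)" by (auto intro!: derivative_eq_intros)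
  from E_deriv_chain[OF this, of a b x] show ?thesis by simp
qed

lemma E_minus_left: "E a b (- x) ** E a b x = mat 1"
proof -
  define F where "F t = E a b (- (t *\<^sub>R x)) ** E a b (t *\<^sub>R x)" for t
  have "(F has_vector_derivative 0) (at t within {0..1})" for t
    unfolding F_def
    using mm.has_vector_derivative[OF E_deriv_minus[of a b x t "{0..1}"] E_deriv[of a b x t "{0..1}"]]
      E_commute[of a b x "- t"]
    by (simp add: matrix_mul_assoc mm.minus_left)
  then have "F 1 = F 0" by (intro const_on_unit) auto
  then show ?thesis by (simp add: F_def)
qed

lemma E_minus_right: "E a b x ** E a b (- x) = mat 1"
  using E_minus_left[of a b "- x"] by simp

lemma E_cancel: "A ** E a b x ** E a b (- x) = A" "A ** E a b (- x) ** E a b x = A"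
  by (simp_all add: E_minus_left E_minus_right flip: matrix_mul_assoc)

lemma E_cancel_left: "E a b x ** (E a b (- x) ** A) = A" "E a b (- x) ** (E a b x ** A) = A"
  by (simp_all add: E_minus_left E_minus_right matrix_mul_assoc)

text \<open>Group elements are automorphisms of the algebra. Undoing the conjugation along
  \<open>t *\<^sub>R x\<close> gives a path with derivative zero: by \<open>ad_commutator\<close>
  the commutator of the generator with the middle factor is exactly the derivative of that
  factor.\<close>

lemma E_conj: "E a b x ** ad_mat a b y ** E a b (- x) = ad_mat a b (E a b x *v y)"
proof -
  define F where "F t = E a b (- (t *\<^sub>R x)) ** ad_mat a b (E a b (t *\<^sub>R x) *v y) ** E a b (t *\<^sub>R x)" for t
  have "(F has_vector_derivative 0) (at t within {0..1})" for t
  proof -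
    have 1: "((\<lambda>t. E a b (t *\<^sub>R x) *v y) has_vector_derivative (ad_mat a b x ** E a b (t *\<^sub>R x)) *v y) (at t within {0..1})"
      using mv.has_vector_derivative[OF E_deriv[of a b x t "{0..1}"] has_vector_derivative_const[of y]] by simp
    have bl: "bounded_linear (ad_mat a b)" using linear_ad by (simp add: linear_conv_bounded_linear)
    note 2 = bounded_linear.has_vector_derivative[OF bl 1]
    note 3 = mm.has_vector_derivative[OF mm.has_vector_derivative[OF E_deriv_minus[of a b x t "{0..1}"] 2] E_deriv[of a b x t "{0..1}"]]
    have c: "ad_mat a b x ** E a b (- (t *\<^sub>R x)) = E a b (- (t *\<^sub>R x)) ** ad_mat a b x"
      using E_commute[of a b x "- t"] by simp
    show ?thesis unfolding F_def
      by (rule has_vector_derivative_eq_rhs[OF 3])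
        (simp add: ad_commutator c matrix_vector_mul_assoc[symmetric] mm.diff_left mm.diff_right mm.minus_left mm.add_left matrix_mul_assoc)
  qed
  then have "F 1 = F 0" by (intro const_on_unit) auto
  then have "E a b (- x) ** ad_mat a b (E a b x *v y) ** E a b x = ad_mat a b y" by (simp add: F_def)
  then have "E a b x ** (E a b (- x) ** ad_mat a b (E a b x *v y) ** E a b x) ** E a b (- x) = E a b x ** ad_mat a b y ** E a b (- x)"
    by simp
  then show ?thesis by (simp add: E_cancel E_cancel_left flip: matrix_mul_assoc) (simp add: E_minus_right)
qed

lemma E_conj': "E a b x ** ad_mat a b y = ad_mat a b (E a b x *v y) ** E a b x"
  using E_conj[of a b x y] E_cancel(2)[of "E a b x ** ad_mat a b y" a b x] by simp

lemma continuous_mpw_ad: "continuous_on UNIV (\<lambda>x. mpw (ad_mat a b x) n)"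
proof (induction n)
  case (Suc n)
  have "continuous_on UNIV (ad_mat a b)"
    using linear_ad by (simp add: linear_continuous_on linear_conv_bounded_linear)
  then show ?case unfolding mpw_Suc by (intro mm.continuous_on Suc)
qed simp

lemma continuous_E: "continuous_on S (E a b)"
proof -
  have "continuous_on UNIV (E a b)"
    unfolding E_eq by (intro continuous_intros continuous_mpw_ad)
  then show ?thesis by (rule continuous_on_subset) simp
qed

lemmas continuous_E_comp = continuous_on_compose2[OF continuous_E[of UNIV] _ subset_UNIV]

lemma differentiable_E: "E a b differentiable (at x)"
proof -
  have "(\<lambda>x. mpw (ad_mat a b x) n) differentiable (at x)" for n
  proof (induction n)
    case (Suc n)
    have "ad_mat a b differentiable (at x)"
      using linear_ad by (simp add: linear_imp_differentiable)
    then show ?case unfolding mpw_Suc using Suc mm.FDERIV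
      unfolding differentiable_def by blast
  qed simp
  then show ?thesis unfolding E_eq by (intro derivative_intros) auto
qed

section \<open>Coordinates on the group: the last row\<close>

text \<open>Induction on the row: the derivative of entry (l, j) involves only entries (r, j) with
  idx r + m \<le> idx l, which forces r < j, so these are zeros found before. For m = 0 it is the
  strict triangularity of \<open>ad_mat\<close> that keeps r below l.\<close>

lemma path_entries:
  assumes P: "\<And>t. t \<in> {0..1} \<Longrightarrow> (P has_vector_derivative ad_mat a b (c t) ** P t) (at t within {0..1})"
    and P0: "P 0 = mat 1" and c: "\<And>t. t \<in> {0..1} \<Longrightarrow> supp_ge m (c t)"
  shows "t \<in> {0..1} \<Longrightarrow> idx l < idx j + m \<Longrightarrow> P t $ l $ j = (if l = j then 1 else 0)"
proof (induction "idx l" arbitrary: l t rule: less_induct)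
  case less
  have "((\<lambda>t. P t $ l $ j) has_vector_derivative 0) (at s within {0..1})" if s: "s \<in> {0..1}" for s
  proof -
    have "((\<lambda>t. P t $ l $ j) has_vector_derivative (ad_mat a b (c s) ** P s) $ l $ j) (at s within {0..1})"
      by (intro bounded_linear.has_vector_derivative[OF bounded_linear_vec_nth] P s)
    moreover have "ad_mat a b (c s) $ l $ r * P s $ r $ j = 0" for r
    proof (cases "idx r + m \<le> idx l")
      case True
      have "idx r < idx l \<or> m = 0" "idx r < idx j" using True less.prems(2) by auto
      show ?thesis
      proof (cases "m = 0")
        case True
        show ?thesis
        proof (cases "r < l")
          case False
          then show ?thesis using ad_lower[of a b "c s" l r] by auto
        next
          case True
          then have "P s $ r $ j = (if r = j then 1 else 0)"
            using \<open>idx r < idx j\<close> True by (intro less.hyps s) (simp only: idx_less_iff, linarith)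
          then show ?thesis using \<open>idx r < idx j\<close> by auto
        qed
      next
        case False
        then have "P s $ r $ j = (if r = j then 1 else 0)"
          using True \<open>idx r < idx j\<close> by (intro less.hyps s) auto
        then show ?thesis using \<open>idx r < idx j\<close> by auto
      qed
    next
      case False
      then show ?thesis using graded_ad[OF c[OF s], of a b] gradedD by (metis linorder_not_le mult_zero_left)
    qed
    ultimately show ?thesis by (simp add: matrix_matrix_mult_def)
  qed
  then have "P t $ l $ j = P 0 $ l $ j"
    using less.prems(1) by (intro const_on_unit) auto
  then show ?case by (simp add: P0 mat_def)
qed

lemma idx_eq_ix: "1 \<le> m \<Longrightarrow> m \<le> 11 \<Longrightarrow> idx i = m \<longleftrightarrow> i = ix m"
  by auto

lemma idx_less_11: "i \<noteq> ix 11 \<Longrightarrow> idx i < 11"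
  using idx_le_11[of i] idx_eq_ix[of 11 i] by fastforce

text \<open>Rows are linear functionals on the algebra, and multiplication from the right is the
  coadjoint action; this row is the coordinate functional of the central e_11.\<close>

abbreviation lrow :: "real^11" where "lrow \<equiv> axis (ix 11) 1"

lemma lrow_mult: "(lrow v* A) $ j = A $ ix 11 $ j"
  by (simp add: vector_matrix_mult_def axis_def if_distrib[of "\<lambda>x. x * _"] cong: if_cong)

lemma supp_ge_Suc: "supp_ge m x \<Longrightarrow> x $ ix m = 0 \<Longrightarrow> supp_ge (Suc m) x"
  unfolding supp_ge_def by (metis ix_idx less_SucE)

lemma E_lower: "idx k < idx j \<Longrightarrow> E a b x $ k $ j = 0"
proof -
  have "graded 0 (E a b x)"
    unfolding graded_def
  proof safe
    fix k j assume "E a b x $ k $ j \<noteq> 0"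
    then have "\<exists>n\<in>{..<11}. ((1 / fact n) *\<^sub>R mpw (ad_mat a b x) n) $ k $ j \<noteq> 0"
      unfolding E_eq by (intro sum_nonzero_D) simp
    then obtain n where "mpw (ad_mat a b x) n $ k $ j \<noteq> 0" by auto
    then show "idx j + 0 \<le> idx k"
      using gradedD[OF graded_mpw[OF graded_ad1(1), of n a b x], of k j] by force
  qed
  then show "idx k < idx j \<Longrightarrow> E a b x $ k $ j = 0" by (simp add: gradedD)
qed

lemma E_diag: "E a b x $ k $ k = 1"
proof -
  have "mpw (ad_mat a b x) n $ k $ k = 0" if "n > 0" for n
    using gradedD[OF graded_mpw[OF graded_ad1(1), of n a b x], of k k] that by simp
  then have "E a b x $ k $ k = (\<Sum>n<(11::nat). if n = 0 then 1 else 0)"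
    unfolding E_eq sum_component by (intro sum.cong) (auto simp: mat_def)
  then show ?thesis by simp
qed

lemma supp_ge_E: "supp_ge m x \<Longrightarrow> supp_ge m (E a b y *v x)"
  unfolding supp_ge_def
proof safe
  fix i assume s: "\<forall>i. idx i < m \<longrightarrow> x $ i = 0" and i: "idx i < m"
  have "E a b y $ i $ j * x $ j = 0" for j
    using E_lower[of i j a b y] s i by (cases "idx i < idx j") auto
  then have "(\<Sum>j\<in>UNIV. E a b y $ i $ j * x $ j) = 0" by (intro sum.neutral) blast
  then show "(E a b y *v x) $ i = 0" by (simp add: matrix_vector_mult_def)
qed

text \<open>From the second power on, the exponential series has degree at least 2 * m and misses
  this entry. For m = 6 no entry is reached at all: on the abelian ideal the exponential is 1 plus
  \<open>ad_mat\<close>.\<close>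

lemma E_first_order:
  assumes "supp_ge m x" "idx k < idx j + 2 * m" "k \<noteq> j"
  shows "E a b x $ k $ j = ad_mat a b x $ k $ j"
proof -
  have "mpw (ad_mat a b x) n $ k $ j = 0" if "n \<noteq> 1" for n
  proof (cases "n = 0")
    case True then show ?thesis using assms(3) by (simp add: mat_def)
  next
    case False
    with that have "2 * m \<le> n * m" by simp
    then have "graded (2 * m) (mpw (ad_mat a b x) n)"
      using graded_mpw[OF graded_ad[OF assms(1)], of n a b] graded_mono by blast
    then show ?thesis using assms(2) by (rule gradedD)
  qed
  then have "E a b x $ k $ j = (\<Sum>n<(11::nat). if n = 1 then ad_mat a b x $ k $ j else 0)"
    unfolding E_eq sum_component by (intro sum.cong) (auto simp: mpw_Suc)
  then show ?thesis by simp
qed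

lemma ad_axis: "1 \<le> m \<Longrightarrow> m \<le> 11 \<Longrightarrow> ad_mat a b (axis (ix m) s) $ k $ j = s * bc a b m (idx j) (idx k)"
  unfolding ad_nth axis_def by (simp add: if_distrib[of "\<lambda>x. x * _"] cong: if_cong)

lemma supp_ge_axis: "1 \<le> m \<Longrightarrow> m \<le> 11 \<Longrightarrow> supp_ge m (axis (ix m) s)"
  unfolding supp_ge_def axis_def by auto

text \<open>A path in the group, driven by a velocity in the Lie algebra, that returns to the point \<open>lrow\<close>
  of the coadjoint orbit is closed: one strips off the one-parameter subgroups of \<open>e\<^sub>m\<close>
  one after the other, the entry \<open>11 - m\<close> of the last row showing that the parameter is zero.\<close>

lemma path_trivial:
  assumes "\<And>t. t \<in> {0..1} \<Longrightarrow> (P has_vector_derivative ad_mat a b (c t) ** P t) (at t within {0..1})"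
    and "P 0 = mat 1" and "\<And>t. t \<in> {0..1} \<Longrightarrow> supp_ge m (c t)" and "continuous_on {0..1} c"
    and "lrow v* P 1 = lrow" and "1 \<le> m"
  shows "P 1 = mat 1"
  using assms
proof (induction "12 - m" arbitrary: m P c rule: less_induct)
  case less
  note P = less.prems(1) and P0 = less.prems(2) and supp = less.prems(3) and cont = less.prems(4)
    and l = less.prems(5) and m1 = less.prems(6)
  show ?case
  proof (cases "m \<ge> 11")
    case True
    \<comment> \<open>Only a central velocity is left, and it does not move P.\<close>
    have "ad_mat a b (c t) = 0" if "t \<in> {0..1}" for t
    proof (rule vec_eq_iff[THEN iffD2], rule allI, rule vec_eq_iff[THEN iffD2], rule allI)
      fix k j show "ad_mat a b (c t) $ k $ j = 0 $ k $ j"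
        using gradedD[OF graded_ad[OF supp[OF that], of a b], of k j] idx_ge_1[of j] idx_le_11[of k] True by simp
    qed
    then have "P 1 = P 0" using P by (intro const_on_unit) auto
    then show ?thesis using P0 by simp
  next
    case False
    define e where "e = (axis (ix m) 1 :: real^11)"
    define f where "f t = c t $ ix m" for t
    have fc: "continuous_on {0..1} f" unfolding f_def using cont by (intro continuous_intros)
    define S where "S t = integral {0..t} f" for t
    have S': "(S has_real_derivative f t) (at t within {0..1})" if "t \<in> {0..1}" for t
      unfolding S_def has_real_derivative_iff_has_vector_derivative
      using integral_has_vector_derivative[OF fc that] .
    have S0: "S 0 = 0" by (simp add: S_def)
    define Q where "Q t = E a b (- S t *\<^sub>R e) ** P t" for t
    \<comment> \<open>The logarithmic derivative of Q. Differentiating the left factor cancels the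
      e_m-part of c; the rest is conjugated, which preserves the ideals, so d lies one ideal further
      down.\<close>
    define d where "d t = E a b (- S t *\<^sub>R e) *v (c t - f t *\<^sub>R e)" for t
    have e: "supp_ge m e" unfolding e_def using m1 False by (intro supp_ge_axis) auto
    have eQ: "(Q has_vector_derivative ad_mat a b (d t) ** Q t) (at t within {0..1})" if t: "t \<in> {0..1}" for t
    proof -
      have "((\<lambda>t. - S t) has_real_derivative - f t) (at t within {0..1})"
        using S'[OF t] by (auto intro!: derivative_eq_intros)
      note 1 = mm.has_vector_derivative[OF E_deriv_chain[OF this, of a b e] P[OF t]]
      have "ad_mat a b (d t) ** Q t = E a b (- S t *\<^sub>R e) ** ad_mat a b (c t - f t *\<^sub>R e) ** P t"
        by (simp add: d_def Q_def E_conj' matrix_mul_assoc)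
      also have "\<dots> = E a b (- S t *\<^sub>R e) ** (ad_mat a b (c t) ** P t) + (- f t *\<^sub>R (ad_mat a b e ** E a b (- S t *\<^sub>R e))) ** P t"
        by (simp add: ad_diff ad_scaleR mm.diff_left mm.diff_right mm.scaleR_left mm.scaleR_right mm.minus_left matrix_mul_assoc
            E_commute[of a b e "- S t", simplified])
      finally show ?thesis unfolding Q_def
        using 1 by simp
    qed
    have dsupp: "supp_ge (Suc m) (d t)" if t: "t \<in> {0..1}" for t
      unfolding d_def
    proof (intro supp_ge_E supp_ge_Suc)
      show "supp_ge m (c t - f t *\<^sub>R e)" using supp[OF t] e by (simp add: supp_ge_def)
      show "(c t - f t *\<^sub>R e) $ ix m = 0" by (simp add: f_def e_def axis_def)
    qed
    have Sc: "continuous_on {0..1} S"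
      using S' by (meson DERIV_atLeastAtMost_imp_continuous_on DERIV_continuous continuous_on_eq_continuous_within)
    have dcont: "continuous_on {0..1} d"
      unfolding d_def by (intro mv.continuous_on continuous_E_comp continuous_intros Sc cont fc)
    have Q0: "Q 0 = mat 1" by (simp add: Q_def S0 P0)
    have PQ: "P t = E a b (S t *\<^sub>R e) ** Q t" for t
      using E_cancel_left(1)[of a b "S t *\<^sub>R e" "P t"] by (simp add: Q_def)
    let ?j = "ix (11 - m)"
    have idj: "idx ?j = 11 - m" using False m1 by simp
    have "(lrow v* P 1) $ ?j = (\<Sum>l\<in>UNIV. E a b (S 1 *\<^sub>R e) $ ix 11 $ l * Q 1 $ l $ ?j)"
      by (simp add: lrow_mult PQ matrix_matrix_mult_def)
    \<comment> \<open>By \<open>path_entries\<close> with Suc m, the column 11 - m of Q is a unit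
      column: it would take row 12 to leave the range of that lemma.\<close>
    also have "\<dots> = (\<Sum>l\<in>UNIV. E a b (S 1 *\<^sub>R e) $ ix 11 $ l * (if l = ?j then 1 else 0))"
    proof (intro sum.cong refl arg_cong2[where f = times])
      fix l show "Q 1 $ l $ ?j = (if l = ?j then 1 else 0)"
        using path_entries[OF eQ Q0 dsupp, of 1 l ?j] idx_le_11[of l] False m1 by (simp add: idj)
    qed
    also have "\<dots> = E a b (S 1 *\<^sub>R e) $ ix 11 $ ?j" by (simp add: if_distrib cong: if_cong)
    also have "\<dots> = ad_mat a b (S 1 *\<^sub>R e) $ ix 11 $ ?j"
      using e m1 False by (intro E_first_order[of m]) (auto simp: supp_ge_def)
    also have "\<dots> = S 1 * bc a b m (11 - m) 11"
      using m1 False by (simp add: ad_scaleR e_def ad_axis)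
    finally have *: "(lrow v* P 1) $ ?j = S 1 * bc a b m (11 - m) 11" .
    have "S 1 * bc a b m (11 - m) 11 = 0"
    proof -
      have "11 - m \<noteq> 11" using m1 by simp
      then have "lrow $ ?j = 0" using m1 False by (simp add: axis_def)
      then have "(lrow v* P 1) $ ?j = 0" by (simp only: l)
      then show ?thesis using * by simp
    qed
    then have S1: "S 1 = 0" using bc_top[of m a b] m1 False by simp
    then have PQ1: "P 1 = Q 1" using PQ[of 1] by simp
    have "Q 1 = mat 1"
      by (rule less.hyps[OF _ eQ Q0 dsupp dcont]) (use False l PQ1 in auto)
    then show ?thesis using PQ1 by simp
  qed
qed

section \<open>Triangular dependence of image rows on the exponential coordinates\<close>

definition agree :: "nat \<Rightarrow> real^11^11 \<Rightarrow> real^11^11 \<Rightarrow> bool" where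
  "agree m A B \<longleftrightarrow> (\<forall>k j. idx k < idx j + m \<longrightarrow> A $ k $ j = B $ k $ j)"

text \<open>\<open>agree m A B\<close> says that A - B has degree m. Splitting the difference of the
  products into two terms, each has one factor of degree m and one of degree 1.\<close>

lemma agree_mult:
  assumes A: "agree m A A'" and B: "agree m B B'" and g: "graded 1 A" "graded 1 A'" "graded 1 B" "graded 1 B'"
  shows "agree (Suc m) (A ** B) (A' ** B')"
  unfolding agree_def
proof safe
  fix k j assume kj: "idx k < idx j + Suc m"
  have "A $ k $ l * B $ l $ j = A' $ k $ l * B' $ l $ j" for l
  proof (cases "idx l < idx k \<and> idx j < idx l")
    case True
    then show ?thesis using A B kj unfolding agree_def by auto
  next
    case False
    then have "(A $ k $ l = 0 \<and> A' $ k $ l = 0) \<or> (B $ l $ j = 0 \<and> B' $ l $ j = 0)"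
      using g gradedD[of 1] by (metis Suc_eq_plus1 less_Suc_eq linorder_neqE_nat)
    then show ?thesis by auto
  qed
  then show "(A ** B) $ k $ j = (A' ** B') $ k $ j" by (simp add: matrix_matrix_mult_def)
qed

lemma agree_mono: "agree m A B \<Longrightarrow> n \<le> m \<Longrightarrow> agree n A B"
  unfolding agree_def by (meson add_left_mono order_less_le_trans)

text \<open>From the second power on, \<open>agree_mult\<close> gains a degree, so at distance at
  most m from the diagonal only the linear term of the series notices the difference of the
  parameters.\<close>

lemma agree_E:
  assumes "supp_ge m (x - y)" "idx k \<le> idx j + m"
  shows "E a b x $ k $ j - E a b y $ k $ j = ad_mat a b (x - y) $ k $ j"
proof -
  let ?X = "ad_mat a b x" and ?Y = "ad_mat a b y"
  have a: "agree m ?X ?Y"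
    using gradedD[OF graded_ad[OF assms(1), of a b]] unfolding agree_def ad_diff by simp
  have 1: "agree m (mpw ?X (Suc n)) (mpw ?Y (Suc n)) \<and> (n \<ge> 1 \<longrightarrow> agree (Suc m) (mpw ?X (Suc n)) (mpw ?Y (Suc n)))" for n
  proof (induction n)
    case 0 then show ?case using a by (simp add: mpw_Suc)
  next
    case (Suc n)
    have g: "graded 1 (mpw (ad_mat a b z) (Suc n))" for z
      by (rule graded_mono[OF graded_mpw[OF graded_ad1(1)]]) simp
    have "agree (Suc m) (mpw ?X (Suc (Suc n))) (mpw ?Y (Suc (Suc n)))"
      unfolding mpw_Suc[of _ "Suc n"] using Suc a g by (intro agree_mult) auto
    then show ?case using agree_mono by auto
  qed
  have "mpw ?X n $ k $ j - mpw ?Y n $ k $ j = (if n = 1 then ad_mat a b (x - y) $ k $ j else 0)" for n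
  proof -
    consider "n = 0" | "n = 1" | l where "n = Suc l" "l \<ge> 1"
      by (metis One_nat_def Suc_le_eq not0_implies_Suc zero_less_iff_neq_zero)
    then show ?thesis
    proof cases
      case 3
      then show ?thesis using 1[of l] assms(2) by (auto simp: agree_def)
    qed (simp_all add: mpw_Suc ad_diff)
  qed
  then have "(1 / fact n) * mpw ?X n $ k $ j - (1 / fact n) * mpw ?Y n $ k $ j = (if n = 1 then ad_mat a b (x - y) $ k $ j else 0)" for n
  proof (cases "n = 1")
    case False
    then have "mpw ?X n $ k $ j = mpw ?Y n $ k $ j" using \<open>\<And>n. mpw ?X n $ k $ j - mpw ?Y n $ k $ j = _\<close>[of n] by simp
    then show ?thesis using False by simp
  qed (simp add: mpw_Suc ad_diff)
  then show ?thesis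
    unfolding E_eq sum_component by (simp flip: sum_subtractf)
qed

text \<open>By \<open>agree_E\<close> the change of entry 11 - m is linear in x - y. A matrix of
  degree m leads from column 11 - m only to row 11, and there weights leave only the coordinate m of
  x - y, with the pivot of \<open>bc_top\<close> as coefficient.\<close>

lemma row_diff:
  assumes "supp_ge m (x - y)" "1 \<le> m" "m \<le> 10"
  shows "(\<xi> v* E a b x) $ ix (11 - m) - (\<xi> v* E a b y) $ ix (11 - m) =
    \<xi> $ ix 11 * (x $ ix m - y $ ix m) * bc a b m (11 - m) 11"
proof -
  let ?j = "ix (11 - m)"
  have idj: "idx ?j = 11 - m" using assms by simp
  have "(\<xi> v* E a b x) $ ?j - (\<xi> v* E a b y) $ ?j = (\<Sum>k\<in>UNIV. \<xi> $ k * (E a b x $ k $ ?j - E a b y $ k $ ?j))"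
    by (simp add: vector_matrix_mult_def right_diff_distrib sum_subtractf)
  also have "\<dots> = (\<Sum>k\<in>UNIV. \<xi> $ k * ad_mat a b (x - y) $ k $ ?j)"
  proof (intro sum.cong refl arg_cong2[where f = times])
    fix k show "E a b x $ k $ ?j - E a b y $ k $ ?j = ad_mat a b (x - y) $ k $ ?j"
      using idx_le_11[of k] assms by (intro agree_E) (auto simp: idj)
  qed
  also have "\<dots> = (\<Sum>k\<in>UNIV. if k = ix 11 then \<xi> $ ix 11 * ad_mat a b (x - y) $ ix 11 $ ?j else 0)"
  proof (intro sum.cong refl)
    fix k
    have "idx k < 11" if "k \<noteq> ix 11" using that by (rule idx_less_11)
    then show "\<xi> $ k * ad_mat a b (x - y) $ k $ ?j = (if k = ix 11 then \<xi> $ ix 11 * ad_mat a b (x - y) $ ix 11 $ ?j else 0)"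
      using gradedD[OF graded_ad[OF assms(1), of a b], of k ?j] assms idj by auto
  qed
  also have "\<dots> = \<xi> $ ix 11 * ad_mat a b (x - y) $ ix 11 $ ?j" by simp
  also have "ad_mat a b (x - y) $ ix 11 $ ?j = (\<Sum>i\<in>UNIV. if i = ix m then (x $ ix m - y $ ix m) * bc a b m (11 - m) 11 else 0)"
    unfolding ad_nth
  proof (intro sum.cong refl)
    fix i
    have *: "idx i = m \<longleftrightarrow> i = ix m" using assms by (intro idx_eq_ix) auto
    show "(x - y) $ i * bc a b (idx i) (idx ?j) (idx (ix 11)) = (if i = ix m then (x $ ix m - y $ ix m) * bc a b m (11 - m) 11 else 0)"
    proof (cases "i = ix m")
      case True then show ?thesis using assms idj by simp
    next
      case False
      then have "idx i < m \<or> m < idx i" using * by linarith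
      then show ?thesis using False assms bc_weight[of a b "idx i" "11 - m" 11] idj unfolding supp_ge_def by force
    qed
  qed
  also have "\<dots> = (x $ ix m - y $ ix m) * bc a b m (11 - m) 11" by simp
  finally show ?thesis by (simp add: mult_ac)
qed

text \<open>Entries 10, 9, ... of the image row determine the coordinates 1, 2, ... in this order.
  Stopping at r = 5 gives the version for the quotient, which sees only entries 10 to 6.\<close>

lemma row_unique:
  assumes "\<xi> $ ix 11 = 1" and eq: "\<And>m. 1 \<le> m \<Longrightarrow> m \<le> r \<Longrightarrow> (\<xi> v* E a b x) $ ix (11 - m) = (\<xi> v* E a b y) $ ix (11 - m)" and "r \<le> 10"
  shows "supp_ge (Suc r) (x - y)"
  using eq \<open>r \<le> 10\<close>
proof (induction r)
  case (Suc r)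
  then have s: "supp_ge (Suc r) (x - y)" by auto
  have "x $ ix (Suc r) - y $ ix (Suc r) = 0"
    using row_diff[OF s, of \<xi> a b] Suc.prems(1)[of "Suc r"] Suc.prems(2) bc_top[of "Suc r" a b] assms(1) by simp
  then show ?case using supp_ge_Suc[OF s] by simp
qed simp

text \<open>Each step of the iteration makes one more coordinate correct, because the entry \<open>11 - m\<close>
  depends on the coordinate \<open>m\<close> to first order and otherwise only on coordinates below \<open>m\<close>.\<close>

definition newt :: "real \<Rightarrow> real \<Rightarrow> real^11 \<Rightarrow> real^11 \<Rightarrow> real^11 \<Rightarrow> real^11" where
  "newt a b \<xi> \<eta> x = (\<chi> i. if idx i = 11 then 0 else
     x $ i + (\<eta> $ ix (11 - idx i) - (\<xi> v* E a b x) $ ix (11 - idx i)) / bc a b (idx i) (11 - idx i) 11)"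

text \<open>Exponential coordinates of an element carrying the row \<xi> to the row \<eta>, with the
  central coordinate normalised to 0; one iteration for each of the other ten.\<close>

definition solve :: "real \<Rightarrow> real \<Rightarrow> real^11 \<Rightarrow> real^11 \<Rightarrow> real^11" where
  "solve a b \<xi> \<eta> = (newt a b \<xi> \<eta> ^^ 10) 0"

lemma newt_contract:
  assumes "\<xi> $ ix 11 = 1" "supp_ge m (x - y)" "m \<le> 10" "1 \<le> m"
  shows "supp_ge (Suc m) (newt a b \<xi> \<eta> x - newt a b \<xi> \<eta> y)"
  unfolding supp_ge_def
proof safe
  fix i assume i: "idx i < Suc m"
  then have s: "supp_ge (idx i) (x - y)" using assms(2) by (simp add: supp_ge_def)
  have i10: "idx i \<le> 10" using i assms by simp
  have aux: "p + (e - A) / c - (q + (e - B) / c) = 0" if "c \<noteq> 0" "A - B = (p - q) * c" for p q A B c e :: real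
  proof -
    have "A = B + (p - q) * c" using that(2) by simp
    then show ?thesis using that(1) by (simp add: diff_divide_distrib add_divide_distrib)
  qed
  have "bc a b (idx i) (11 - idx i) 11 \<noteq> 0" using bc_top idx_ge_1 i10 by blast
  then show "(newt a b \<xi> \<eta> x - newt a b \<xi> \<eta> y) $ i = 0"
    using row_diff[OF s idx_ge_1 i10, of \<xi> a b] i10 assms(1)
    by (simp add: newt_def aux)
qed

lemma newt_11: "newt a b \<xi> \<eta> x $ ix 11 = 0" by (simp add: newt_def)

lemma solve_11: "solve a b \<xi> \<eta> $ ix 11 = 0"
proof -
  have "(10::nat) = Suc 9" by simp
  then show ?thesis by (simp only: solve_def funpow.simps o_apply newt_11)
qed

lemma supp_ge_12: "supp_ge 11 x \<Longrightarrow> x $ ix 11 = 0 \<Longrightarrow> x = 0"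
  unfolding supp_ge_def vec_eq_iff using idx_less_11 by (metis zero_index)

text \<open>One application of \<open>newt\<close> moves the difference of two iterates into the
  next ideal. After ten applications consecutive iterates can differ only in coordinate 11, which is
  0 in both.\<close>

lemma solve_fixed: assumes "\<xi> $ ix 11 = 1" shows "newt a b \<xi> \<eta> (solve a b \<xi> \<eta>) = solve a b \<xi> \<eta>"
proof -
  let ?T = "newt a b \<xi> \<eta>"
  have "supp_ge (Suc n) ((?T ^^ Suc n) 0 - (?T ^^ n) 0)" if "n \<le> 10" for n
    using that
  proof (induction n)
    case (Suc n)
    then show ?case using newt_contract[OF assms, of "Suc n" "(?T ^^ Suc n) 0" "(?T ^^ n) 0"] by simp
  qed simp
  from this[of 10] have "supp_ge (Suc 10) (?T (solve a b \<xi> \<eta>) - solve a b \<xi> \<eta>)"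
    by (simp only: solve_def funpow.simps o_apply order_refl)
  then have "supp_ge 11 (?T (solve a b \<xi> \<eta>) - solve a b \<xi> \<eta>)" by simp
  then have "?T (solve a b \<xi> \<eta>) - solve a b \<xi> \<eta> = 0"
    by (rule supp_ge_12) (simp add: newt_11 solve_11)
  then show ?thesis by simp
qed

lemma row_E_11: "(\<xi> v* E a b x) $ ix 11 = \<xi> $ ix 11"
proof -
  have "E a b x $ k $ ix 11 = (if k = ix 11 then 1 else 0)" for k
    using E_lower[of k "ix 11" a b x] E_diag[of a b x "ix 11"] idx_le_11[of k]
    using idx_less_11[of k] by auto
  then have "\<xi> $ k * E a b x $ k $ ix 11 = (if k = ix 11 then \<xi> $ ix 11 else 0)" for k by simp
  then show ?thesis by (simp add: vector_matrix_mult_def)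
qed

lemma row_solve:
  assumes "\<xi> $ ix 11 = 1" "\<eta> $ ix 11 = 1"
  shows "\<xi> v* E a b (solve a b \<xi> \<eta>) = \<eta>"
proof (rule vec_eq_iff[THEN iffD2], rule allI)
  fix j :: 11
  show "(\<xi> v* E a b (solve a b \<xi> \<eta>)) $ j = \<eta> $ j"
  proof (cases "idx j = 11")
    case True
    then have "j = ix 11" by (metis ix_idx)
    then show ?thesis using assms by (simp add: row_E_11)
  next
    case False
    define i where "i = ix (11 - idx j)"
    have r: "1 \<le> 11 - idx j" "11 - idx j \<le> 10" using False idx_le_11[of j] idx_ge_1[of j] by auto
    then have idi: "idx i = 11 - idx j" by (simp add: i_def)
    then have j: "ix (11 - idx i) = j" using idx_le_11[of j] by simp
    define v where "v = solve a b \<xi> \<eta>"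
    define w where "w = \<xi> v* E a b v"
    have "newt a b \<xi> \<eta> v $ i = v $ i" unfolding v_def solve_fixed[OF assms(1)] ..
    moreover have "newt a b \<xi> \<eta> v $ i = v $ i + (\<eta> $ j - w $ j) / bc a b (idx i) (11 - idx i) 11"
      unfolding newt_def w_def[symmetric] j vec_lambda_beta using r idi by (subst if_not_P) auto
    moreover have "bc a b (idx i) (11 - idx i) 11 \<noteq> 0"
      using r unfolding idi by (rule bc_top)
    ultimately have "w $ j = \<eta> $ j" by simp
    then show ?thesis by (simp only: w_def v_def)
  qed
qed

text \<open>This is what the fixed number of iterations buys: the solution is a composition of
  continuous maps, which a mere choice of a preimage would not give. Measurability of the
  representation and compactness arguments rest on it.\<close>

lemma continuous_solve:
  assumes "continuous_on S f" "continuous_on S g"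
  shows "continuous_on S (\<lambda>p. solve a b (f p) (g p))"
proof -
  have "continuous_on S (\<lambda>p. (newt a b (f p) (g p) ^^ n) 0)" for n
  proof (induction n)
    case (Suc n)
    define F where "F p = (newt a b (f p) (g p) ^^ n) 0" for p
    have F: "continuous_on S F" using Suc by (simp add: F_def)
    have "continuous_on S (\<lambda>p. if idx i = 11 then 0 else F p $ i +
       (g p $ ix (11 - idx i) - (f p v* E a b (F p)) $ ix (11 - idx i)) * inverse (bc a b (idx i) (11 - idx i) 11))" for i
    proof (cases "idx i = 11")
      case False
      have "continuous_on S (\<lambda>p. f p v* E a b (F p))"
        by (intro vm.continuous_on assms continuous_E_comp F)
      then show ?thesis using False F assms by (simp, intro continuous_intros)
    qed simp
    then have "continuous_on S (\<lambda>p. newt a b (f p) (g p) (F p))"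
      unfolding newt_def divide_inverse by (rule continuous_on_vec_lambda)
    then show ?case by (simp add: F_def)
  qed simp
  from this[of 10] show ?thesis by (simp only: solve_def)
qed

text \<open>Closure under products without a Baker-Campbell-Hausdorff formula: z is chosen to match
  the last row of the product, and the path from 1 to exp(x) exp(y) exp(-z) returns to
  \<open>lrow\<close>, so \<open>path_trivial\<close> closes it.\<close>

lemma E_mult: "E a b x ** E a b y = E a b (solve a b lrow (lrow v* (E a b x ** E a b y)))"
proof -
  define z where "z = solve a b lrow (lrow v* (E a b x ** E a b y))"
  have l11: "lrow $ ix 11 = 1" by (simp add: axis_def)
  have r: "lrow v* E a b z = lrow v* (E a b x ** E a b y)"
    unfolding z_def by (rule row_solve) (simp_all add: l11 row_E_11 flip: vector_matrix_mul_assoc)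
  define P where "P t = E a b (t *\<^sub>R x) ** E a b (t *\<^sub>R y) ** E a b (- (t *\<^sub>R z))" for t
  \<comment> \<open>The logarithmic derivative of P: each factor contributes its generator
    conjugated by the factors to its left.\<close>
  define c where "c t = x + E a b (t *\<^sub>R x) *v y - E a b (t *\<^sub>R x) *v (E a b (t *\<^sub>R y) *v z)" for t
  have "P 1 = mat 1"
  proof (rule path_trivial)
    show "(P has_vector_derivative ad_mat a b (c t) ** P t) (at t within {0..1})" for t
    proof -
      note 1 = mm.has_vector_derivative[OF mm.has_vector_derivative[OF E_deriv[of a b x t "{0..1}"] E_deriv[of a b y t "{0..1}"]] E_deriv_minus[of a b z t "{0..1}"]]
      show ?thesis unfolding P_def
      proof (rule has_vector_derivative_eq_rhs[OF 1])
        let ?X = "E a b (t *\<^sub>R x)" and ?Y = "E a b (t *\<^sub>R y)"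
        have h1: "ad_mat a b (?X *v y) ** ?X = ?X ** ad_mat a b y" by (simp only: E_conj')
        have h2: "ad_mat a b (?X *v (?Y *v z)) ** ?X ** ?Y = ?X ** ?Y ** ad_mat a b z"
          by (simp only: E_conj'[symmetric] matrix_mul_assoc[symmetric])
        show "?X ** ?Y ** - (ad_mat a b z ** E a b (- (t *\<^sub>R z))) + (?X ** (ad_mat a b y ** ?Y) + ad_mat a b x ** ?X ** ?Y) ** E a b (- (t *\<^sub>R z))
          = ad_mat a b (c t) ** (?X ** ?Y ** E a b (- (t *\<^sub>R z)))"
          by (simp only: c_def ad_add ad_diff mm.add_left mm.diff_left mm.minus_right matrix_mul_assoc h1 h2) simp
      qed
    qed
    show "P 0 = mat 1" by (simp add: P_def)
    show "continuous_on {0..1} c" unfolding c_def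
      by (intro continuous_intros mv.continuous_on continuous_E_comp)
    show "lrow v* P 1 = lrow"
    proof -
      have "lrow v* P 1 = (lrow v* E a b z) v* E a b (- z)"
        unfolding r by (simp add: P_def vector_matrix_mul_assoc)
      then show ?thesis by (simp add: vector_matrix_mul_assoc E_minus_right)
    qed
    show "supp_ge 1 (c t)" for t by simp
  qed simp
  then have "P 1 ** E a b z = E a b z" by simp
  then show ?thesis unfolding z_def[symmetric] by (simp add: P_def E_cancel)
qed

text \<open>The stabiliser of \<open>lrow\<close> is trivial: by \<open>E_mult\<close> with the
  second factor 1, every element is recovered from its last row.\<close>

lemma E_eqI: assumes "lrow v* E a b x = lrow v* E a b y" shows "E a b x = E a b y"
  using E_mult[of a b x 0] E_mult[of a b y 0] assms by (simp only: E_0 matrix_mul_rid)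

section \<open>A cocycle on the coadjoint orbit\<close>

text \<open>On the rows with last entry 1, the coordinates 6 to 11 are Hamiltonians of the abelian ideal
  spanned by \<open>e\<^sub>6, \<dots>, e\<^bsub>11\<^esub>\<close>. The functions \<open>f1\<close> to \<open>f4\<close>, in the entries \<open>s1 = \<xi>\<^bsub>10\<^esub>, \<dots>, s5 = \<xi>\<^sub>6\<close>, extend
  them, together with 0 for \<open>e\<^sub>5\<close>, to a 1-cocycle of the whole Lie algebra; they were found by solving
  the linear equations \<open>cocycle_12\<close> to \<open>cocycle_45\<close> for polynomials of the appropriate weight.
  In terms of \<open>G = (\<beta> + 3\<alpha>)/6\<close> and \<open>D = (\<beta> + 9\<alpha>)/6\<close> the structure constants factor.\<close>

definition f1 :: "real \<Rightarrow> real \<Rightarrow> real \<Rightarrow> real \<Rightarrow> real \<Rightarrow> real \<Rightarrow> real \<Rightarrow> real" where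
  "f1 G D s1 s2 s3 s4 s5 =
      ((-6720) * s5^2 + (2160 * G * D) * s4^2 + (-1620 * G^2 * D^2) * s3^2 + (-3840 * D + 13440 * G) * s3^3 + 2880
      * s2 * s4^2 + (-5760 * D^2 + 27360 * G * D - 38880 * G^2) * s2 * s3^2 + (3645 * G^3 * D^3) * s2^2 + (-960) *
      s2^2 * s3^2 + (38880 * G * D^3 - 185760 * G^2 * D^2 + 222480 * G^3 * D) * s2^3 + (960 * D^2 + 20280 * G * D -
      66240 * G^2) * s2^4 + (-768) * s2^5 + (-5760 * D + 12960 * G) * s1 * s4^2 + (6480 * G * D^2 - 12960 * G^2 * D)
      * s1 * s3^2 + (-1280) * s1 * s3^3 + (7680 * D - 17280 * G) * s1 * s2 * s3^2 + (-8100 * G^2 * D^3 + 5670 * G^3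
      * D^2) * s1 * s2^2 + (-65280 * D^3 + 416640 * G * D^2 - 879840 * G^2 * D + 609120 * G^3) * s1 * s2^3 + (-3840
      * D + 12240 * G) * s1 * s2^4 + (-5760 * D^2 + 21600 * G * D - 19440 * G^2) * s1^2 * s3^2 + (-12960 * G * D^3 +
      97200 * G^2 * D^2 - 144180 * G^3 * D) * s1^2 * s2^2 + (7680 * D^2 - 28800 * G * D + 25920 * G^2) * s1^2 * s2^3
      + (23040 * D^3 - 169920 * G * D^2 + 390960 * G^2 * D - 281880 * G^3) * s1^3 * s2^2)/134400"

text \<open>The derivative of \<open>f1\<close> in direction v, expanded term by term, so that the
  cocycle equations become polynomial identities.\<close>

definition df1 :: "real \<Rightarrow> real \<Rightarrow> real \<Rightarrow> real \<Rightarrow> real \<Rightarrow> real \<Rightarrow> real \<Rightarrow> real \<Rightarrow> real \<Rightarrow> real \<Rightarrow> real \<Rightarrow> real \<Rightarrow> real" where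
  "df1 G D s1 s2 s3 s4 s5 v1 v2 v3 v4 v5 =
      ((-6720) * (2 * s5 * v5) + (2160 * G * D) * (2 * s4 * v4) + (-1620 * G^2 * D^2) * (2 * s3 * v3) + (-3840 * D +
      13440 * G) * (3 * s3^2 * v3) + 2880 * (s4^2 * v2 + 2 * s2 * s4 * v4) + (-5760 * D^2 + 27360 * G * D - 38880
      * G^2) * (s3^2 * v2 + 2 * s2 * s3 * v3) + (3645 * G^3 * D^3) * (2 * s2 * v2) + (-960) * (2 * s2 * s3^2 * v2 +
      2 * s2^2 * s3 * v3) + (38880 * G * D^3 - 185760 * G^2 * D^2 + 222480 * G^3 * D) * (3 * s2^2 * v2) + (960 * D^2
      + 20280 * G * D - 66240 * G^2) * (4 * s2^3 * v2) + (-768) * (5 * s2^4 * v2) + (-5760 * D + 12960 * G) * (s4^2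
      * v1 + 2 * s1 * s4 * v4) + (6480 * G * D^2 - 12960 * G^2 * D) * (s3^2 * v1 + 2 * s1 * s3 * v3) + (-1280) *
      (s3^3 * v1 + 3 * s1 * s3^2 * v3) + (7680 * D - 17280 * G) * (s2 * s3^2 * v1 + s1 * s3^2 * v2 + 2 * s1 * s2 *
      s3 * v3) + (-8100 * G^2 * D^3 + 5670 * G^3 * D^2) * (s2^2 * v1 + 2 * s1 * s2 * v2) + (-65280 * D^3 + 416640 *
      G * D^2 - 879840 * G^2 * D + 609120 * G^3) * (s2^3 * v1 + 3 * s1 * s2^2 * v2) + (-3840 * D + 12240 * G) *
      (s2^4 * v1 + 4 * s1 * s2^3 * v2) + (-5760 * D^2 + 21600 * G * D - 19440 * G^2) * (2 * s1 * s3^2 * v1 + 2 *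
      s1^2 * s3 * v3) + (-12960 * G * D^3 + 97200 * G^2 * D^2 - 144180 * G^3 * D) * (2 * s1 * s2^2 * v1 + 2 * s1^2 *
      s2 * v2) + (7680 * D^2 - 28800 * G * D + 25920 * G^2) * (2 * s1 * s2^3 * v1 + 3 * s1^2 * s2^2 * v2) + (23040 *
      D^3 - 169920 * G * D^2 + 390960 * G^2 * D - 281880 * G^3) * (3 * s1^2 * s2^2 * v1 + 2 * s1^3 * s2 *
      v2))/134400"

definition f2 :: "real \<Rightarrow> real \<Rightarrow> real \<Rightarrow> real \<Rightarrow> real \<Rightarrow> real \<Rightarrow> real \<Rightarrow> real" where
  "f2 G D s1 s2 s3 s4 s5 =
      (1344 * s4 * s5 + (384 * D + 336 * G) * s4^2 + (-729 * G^3 * D^3) * s3 + (-5376 * D + 13440 * G) * s3 * s5 +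
      (4608 * D^2 - 23184 * G * D + 25920 * G^2) * s3 * s4 + (-6912 * D^3 + 45288 * G * D^2 - 98856 * G^2 * D +
      77760 * G^3) * s3^2 + 896 * s3^3 + (3024 * G * D^2 - 8208 * G^2 * D) * s2 * s4 + (-11664 * G * D^3 + 55728 *
      G^2 * D^2 - 66744 * G^3 * D) * s2 * s3 + (-1728) * s2 * s3 * s4 + (-2304 * D + 7584 * G) * s2 * s3^2 + (4032 *
      D - 10944 * G) * s2^2 * s4 + (-384 * D^2 - 8112 * G * D + 26496 * G^2) * s2^2 * s3 + 384 * s2^3 * s3 + 288
      * s1 * s4^2 + (1620 * G^2 * D^3 - 1134 * G^3 * D^2) * s1 * s3 + (1152 * D - 2016 * G) * s1 * s3 * s4 + (1728 *
      D^2 - 3744 * G * D - 7920 * G^2) * s1 * s3^2 + (-8064 * D^2 + 40032 * G * D - 49248 * G^2) * s1 * s2 * s4 +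
      (19584 * D^3 - 124992 * G * D^2 + 263952 * G^2 * D - 182736 * G^3) * s1 * s2 * s3 + (-768) * s1 * s2 * s3^2 +
      (1536 * D - 4896 * G) * s1 * s2^2 * s3 + (2592 * G * D^3 - 19440 * G^2 * D^2 + 28836 * G^3 * D) * s1^2 * s3 +
      (1440 * G) * s1^2 * s3^2 + (-2304 * D^2 + 8640 * G * D - 7776 * G^2) * s1^2 * s2 * s3 + (-4608 * D^3 + 33984 *
      G * D^2 - 78192 * G^2 * D + 56376 * G^3) * s1^3 * s3)/13440"

definition df2 :: "real \<Rightarrow> real \<Rightarrow> real \<Rightarrow> real \<Rightarrow> real \<Rightarrow> real \<Rightarrow> real \<Rightarrow> real \<Rightarrow> real \<Rightarrow> real \<Rightarrow> real \<Rightarrow> real \<Rightarrow> real" where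
  "df2 G D s1 s2 s3 s4 s5 v1 v2 v3 v4 v5 =
      (1344 * (s5 * v4 + s4 * v5) + (384 * D + 336 * G) * (2 * s4 * v4) + (-729 * G^3 * D^3) * v3 + (-5376 * D +
      13440 * G) * (s5 * v3 + s3 * v5) + (4608 * D^2 - 23184 * G * D + 25920 * G^2) * (s4 * v3 + s3 * v4) + (-6912 *
      D^3 + 45288 * G * D^2 - 98856 * G^2 * D + 77760 * G^3) * (2 * s3 * v3) + 896 * (3 * s3^2 * v3) + (3024 * G *
      D^2 - 8208 * G^2 * D) * (s4 * v2 + s2 * v4) + (-11664 * G * D^3 + 55728 * G^2 * D^2 - 66744 * G^3 * D) * (s3 *
      v2 + s2 * v3) + (-1728) * (s3 * s4 * v2 + s2 * s4 * v3 + s2 * s3 * v4) + (-2304 * D + 7584 * G) * (s3^2 * v2 +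
      2 * s2 * s3 * v3) + (4032 * D - 10944 * G) * (2 * s2 * s4 * v2 + s2^2 * v4) + (-384 * D^2 - 8112 * G * D +
      26496 * G^2) * (2 * s2 * s3 * v2 + s2^2 * v3) + 384 * (3 * s2^2 * s3 * v2 + s2^3 * v3) + 288 * (s4^2 * v1
      + 2 * s1 * s4 * v4) + (1620 * G^2 * D^3 - 1134 * G^3 * D^2) * (s3 * v1 + s1 * v3) + (1152 * D - 2016 * G) *
      (s3 * s4 * v1 + s1 * s4 * v3 + s1 * s3 * v4) + (1728 * D^2 - 3744 * G * D - 7920 * G^2) * (s3^2 * v1 + 2 * s1
      * s3 * v3) + (-8064 * D^2 + 40032 * G * D - 49248 * G^2) * (s2 * s4 * v1 + s1 * s4 * v2 + s1 * s2 * v4) +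
      (19584 * D^3 - 124992 * G * D^2 + 263952 * G^2 * D - 182736 * G^3) * (s2 * s3 * v1 + s1 * s3 * v2 + s1 * s2 *
      v3) + (-768) * (s2 * s3^2 * v1 + s1 * s3^2 * v2 + 2 * s1 * s2 * s3 * v3) + (1536 * D - 4896 * G) * (s2^2 * s3
      * v1 + 2 * s1 * s2 * s3 * v2 + s1 * s2^2 * v3) + (2592 * G * D^3 - 19440 * G^2 * D^2 + 28836 * G^3 * D) * (2 *
      s1 * s3 * v1 + s1^2 * v3) + (1440 * G) * (2 * s1 * s3^2 * v1 + 2 * s1^2 * s3 * v3) + (-2304 * D^2 + 8640 * G *
      D - 7776 * G^2) * (2 * s1 * s2 * s3 * v1 + s1^2 * s3 * v2 + s1^2 * s2 * v3) + (-4608 * D^3 + 33984 * G * D^2 -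
      78192 * G^2 * D + 56376 * G^3) * (3 * s1^2 * s3 * v1 + s1^3 * v3))/13440"

definition f3 :: "real \<Rightarrow> real \<Rightarrow> real \<Rightarrow> real \<Rightarrow> real \<Rightarrow> real \<Rightarrow> real \<Rightarrow> real" where
  "f3 G D s1 s2 s3 s4 s5 =
      ((-81 * G^2 * D^2) * s4 + 160 * s4^2 + (-224) * s3 * s5 + (-288 * D + 1008 * G) * s3 * s4 + (336 * D - 1008
      * G) * s2 * s5 + (-288 * D^2 + 1368 * G * D - 1944 * G^2) * s2 * s4 + (-48) * s2^2 * s4 + (324 * G * D^2 - 648
      * G^2 * D) * s1 * s4 + (-96) * s1 * s3 * s4 + (384 * D - 864 * G) * s1 * s2 * s4 + (-288 * D^2 + 1080 * G * D
      - 972 * G^2) * s1^2 * s4)/1120"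

definition df3 :: "real \<Rightarrow> real \<Rightarrow> real \<Rightarrow> real \<Rightarrow> real \<Rightarrow> real \<Rightarrow> real \<Rightarrow> real \<Rightarrow> real \<Rightarrow> real \<Rightarrow> real \<Rightarrow> real \<Rightarrow> real" where
  "df3 G D s1 s2 s3 s4 s5 v1 v2 v3 v4 v5 =
      ((-81 * G^2 * D^2) * v4 + 160 * (2 * s4 * v4) + (-224) * (s5 * v3 + s3 * v5) + (-288 * D + 1008 * G) * (s4
      * v3 + s3 * v4) + (336 * D - 1008 * G) * (s5 * v2 + s2 * v5) + (-288 * D^2 + 1368 * G * D - 1944 * G^2) * (s4
      * v2 + s2 * v4) + (-48) * (2 * s2 * s4 * v2 + s2^2 * v4) + (324 * G * D^2 - 648 * G^2 * D) * (s4 * v1 + s1 *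
      v4) + (-96) * (s3 * s4 * v1 + s1 * s4 * v3 + s1 * s3 * v4) + (384 * D - 864 * G) * (s2 * s4 * v1 + s1 * s4 *
      v2 + s1 * s2 * v4) + (-288 * D^2 + 1080 * G * D - 972 * G^2) * (2 * s1 * s4 * v1 + s1^2 * v4))/1120"

definition f4 :: "real \<Rightarrow> real \<Rightarrow> real \<Rightarrow> real \<Rightarrow> real \<Rightarrow> real \<Rightarrow> real \<Rightarrow> real" where
  "f4 G D s1 s2 s3 s4 s5 =
      ((-9 * G * D) * s5 + (-12) * s2 * s5 + (24 * D - 54 * G) * s1 * s5)/40"

definition df4 :: "real \<Rightarrow> real \<Rightarrow> real \<Rightarrow> real \<Rightarrow> real \<Rightarrow> real \<Rightarrow> real \<Rightarrow> real \<Rightarrow> real \<Rightarrow> real \<Rightarrow> real \<Rightarrow> real \<Rightarrow> real" where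
  "df4 G D s1 s2 s3 s4 s5 v1 v2 v3 v4 v5 =
      ((-9 * G * D) * v5 + (-12) * (s5 * v2 + s2 * v5) + (24 * D - 54 * G) * (s5 * v1 + s1 * v5))/40"

lemmas f_defs = f1_def f2_def f3_def f4_def
lemmas df_defs = df1_def df2_def df3_def df4_def

lemma DERIV_powers:
  assumes "(f has_real_derivative d) (at t within S)"
  shows "((\<lambda>t. f t ^ 2) has_real_derivative (2 * f t * d)) (at t within S)"
    "((\<lambda>t. f t ^ 3) has_real_derivative (3 * f t ^ 2 * d)) (at t within S)"
    "((\<lambda>t. f t ^ 4) has_real_derivative (4 * f t ^ 3 * d)) (at t within S)"
    "((\<lambda>t. f t ^ 5) has_real_derivative (5 * f t ^ 4 * d)) (at t within S)"
  using DERIV_power[OF assms, of 2] DERIV_power[OF assms, of 3] DERIV_power[OF assms, of 4] DERIV_power[OF assms, of 5]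
  by (simp_all add: mult_ac)

lemma f_derivs:
  assumes "(s1 has_real_derivative v1) (at t within S)" "(s2 has_real_derivative v2) (at t within S)"
    "(s3 has_real_derivative v3) (at t within S)" "(s4 has_real_derivative v4) (at t within S)"
    "(s5 has_real_derivative v5) (at t within S)"
  shows "((\<lambda>t. f4 G D (s1 t) (s2 t) (s3 t) (s4 t) (s5 t)) has_real_derivative df4 G D (s1 t) (s2 t) (s3 t) (s4 t) (s5 t) v1 v2 v3 v4 v5) (at t within S)"
 "((\<lambda>t. f3 G D (s1 t) (s2 t) (s3 t) (s4 t) (s5 t)) has_real_derivative df3 G D (s1 t) (s2 t) (s3 t) (s4 t) (s5 t) v1 v2 v3 v4 v5) (at t within S)"
 "((\<lambda>t. f2 G D (s1 t) (s2 t) (s3 t) (s4 t) (s5 t)) has_real_derivative df2 G D (s1 t) (s2 t) (s3 t) (s4 t) (s5 t) v1 v2 v3 v4 v5) (at t within S)"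
 "((\<lambda>t. f1 G D (s1 t) (s2 t) (s3 t) (s4 t) (s5 t)) has_real_derivative df1 G D (s1 t) (s2 t) (s3 t) (s4 t) (s5 t) v1 v2 v3 v4 v5) (at t within S)"
  unfolding f_defs df_defs
  by (rule DERIV_cong, (rule DERIV_cdivide DERIV_add DERIV_diff DERIV_minus DERIV_cmult DERIV_mult DERIV_powers assms)+, algebra)+

lemma df_zero: "df1 G D s1 s2 s3 s4 s5 0 0 0 0 0 = 0" "df2 G D s1 s2 s3 s4 s5 0 0 0 0 0 = 0"
  "df3 G D s1 s2 s3 s4 s5 0 0 0 0 0 = 0" "df4 G D s1 s2 s3 s4 s5 0 0 0 0 0 = 0"
  by (simp_all add: df_defs)

text \<open>In these ten identities the last five arguments of a derivative are the components 10 to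
  6 of the vector fields of e_1, ..., e_5, rewritten in G and D; the right-hand side is the cocycle
  evaluated on the bracket. A leading 0 is the derivative of the zero function attached to
  e_5.\<close>

lemma cocycle_12: "df2 G D s1 s2 s3 s4 s5 1 s1 s2 s3 s4 - df1 G D s1 s2 s3 s4 s5 0 (-1) ((-5) * D + (7/2) * G + 2 *
      s1) ((9/4) * G * D + (-2) * s2 + 4 * s1 * D + (-29/2) * s1 * G) ((-3) * s3 + 7 * s2 * D + (-19) * s2 * G) =
      f3 G D s1 s2 s3 s4 s5"
  unfolding f_defs df_defs by algebra

lemma cocycle_13: "df3 G D s1 s2 s3 s4 s5 1 s1 s2 s3 s4 - df1 G D s1 s2 s3 s4 s5 0 0 3 (9 * D + (-18) * G + (-4)
      * s1) ((-9/4) * G * D + (-1) * s2 + 3 * s1 * D + (-9/2) * s1 * G) = f4 G D s1 s2 s3 s4 s5"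
  unfolding f_defs df_defs by algebra

lemma cocycle_14: "df4 G D s1 s2 s3 s4 s5 1 s1 s2 s3 s4 - df1 G D s1 s2 s3 s4 s5 0 0 0 (-7) ((-6) * D + (27/2)
      * G + 3 * s1) = 0"
  unfolding f_defs df_defs by algebra

lemma cocycle_15: "0 - df1 G D s1 s2 s3 s4 s5 0 0 0 0 10 = s5"
  by (simp add: df_defs)

lemma cocycle_23: "df3 G D s1 s2 s3 s4 s5 0 (-1) ((-5) * D + (7/2) * G + 2 * s1) ((9/4) * G * D + (-2) * s2 + 4 * s1 * D +
      (-29/2) * s1 * G) ((-3) * s3 + 7 * s2 * D + (-19) * s2 * G) - df2 G D s1 s2 s3 s4 s5 0 0 3 (9 * D +
      (-18) * G + (-4) * s1) ((-9/4) * G * D + (-1) * s2 + 3 * s1 * D + (-9/2) * s1 * G) = (D + (-1) * G) * s5"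
  unfolding f_defs df_defs by algebra

lemma cocycle_24: "df4 G D s1 s2 s3 s4 s5 0 (-1) ((-5) * D + (7/2) * G + 2 * s1) ((9/4) * G * D + (-2) * s2 + 4 * s1 * D +
      (-29/2) * s1 * G) ((-3) * s3 + 7 * s2 * D + (-19) * s2 * G) - df2 G D s1 s2 s3 s4 s5 0 0 0 (-7) ((-6)
      * D + (27/2) * G + 3 * s1) = s5 + (D + (-1) * G) * s4"
  unfolding f_defs df_defs by algebra

lemma cocycle_25: "0 - df2 G D s1 s2 s3 s4 s5 0 0 0 0 10 = (-1) * s4 + (4 * D + (-10) * G) * s3"
  unfolding f_defs df_defs by algebra

lemma cocycle_34: "df4 G D s1 s2 s3 s4 s5 0 0 3 (9 * D + (-18) * G + (-4) * s1) ((-9/4) * G * D + (-1) * s2 + 3 * s1 * D +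
      (-9/2) * s1 * G) - df3 G D s1 s2 s3 s4 s5 0 0 0 (-7) ((-6) * D + (27/2) * G + 3 * s1) = 2 * s4 +
      ((-3) * D + 9 * G) * s3"
  unfolding f_defs df_defs by algebra

lemma cocycle_35: "0 - df3 G D s1 s2 s3 s4 s5 0 0 0 0 10 = 2 * s3 + ((-3) * D + 9 * G) * s2"
  unfolding f_defs df_defs by algebra

lemma cocycle_45: "0 - df4 G D s1 s2 s3 s4 s5 0 0 0 0 10 = 3 * s2 + ((-6) * D + (27/2) * G) * s1 + ((9/4) * G * D) *
      1"
  unfolding f_defs df_defs by algebra

lemma f_continuous:
  assumes "continuous_on S s1" "continuous_on S s2" "continuous_on S s3" "continuous_on S s4" "continuous_on S s5"
  shows "continuous_on S (\<lambda>p. f1 G D (s1 p) (s2 p) (s3 p) (s4 p) (s5 p))"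
    "continuous_on S (\<lambda>p. f2 G D (s1 p) (s2 p) (s3 p) (s4 p) (s5 p))"
    "continuous_on S (\<lambda>p. f3 G D (s1 p) (s2 p) (s3 p) (s4 p) (s5 p))"
    "continuous_on S (\<lambda>p. f4 G D (s1 p) (s2 p) (s3 p) (s4 p) (s5 p))"
  unfolding f_defs by (intro continuous_intros assms; simp)+

lemma df_continuous:
  assumes "continuous_on S s1" "continuous_on S s2" "continuous_on S s3" "continuous_on S s4" "continuous_on S s5"
    "continuous_on S v1" "continuous_on S v2" "continuous_on S v3" "continuous_on S v4" "continuous_on S v5"
  shows "continuous_on S (\<lambda>p. df1 G D (s1 p) (s2 p) (s3 p) (s4 p) (s5 p) (v1 p) (v2 p) (v3 p) (v4 p) (v5 p))"
    "continuous_on S (\<lambda>p. df2 G D (s1 p) (s2 p) (s3 p) (s4 p) (s5 p) (v1 p) (v2 p) (v3 p) (v4 p) (v5 p))"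
    "continuous_on S (\<lambda>p. df3 G D (s1 p) (s2 p) (s3 p) (s4 p) (s5 p) (v1 p) (v2 p) (v3 p) (v4 p) (v5 p))"
    "continuous_on S (\<lambda>p. df4 G D (s1 p) (s2 p) (s3 p) (s4 p) (s5 p) (v1 p) (v2 p) (v3 p) (v4 p) (v5 p))"
  unfolding df_defs by (intro continuous_intros assms; simp)+

lemma df_linear:
  "df1 G D s1 s2 s3 s4 s5 (c * v1 + w1) (c * v2 + w2) (c * v3 + w3) (c * v4 + w4) (c * v5 + w5) = c * df1 G D s1 s2 s3 s4 s5 v1 v2 v3 v4 v5 + df1 G D s1 s2 s3 s4 s5 w1 w2 w3 w4 w5"
  "df2 G D s1 s2 s3 s4 s5 (c * v1 + w1) (c * v2 + w2) (c * v3 + w3) (c * v4 + w4) (c * v5 + w5) = c * df2 G D s1 s2 s3 s4 s5 v1 v2 v3 v4 v5 + df2 G D s1 s2 s3 s4 s5 w1 w2 w3 w4 w5"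
  "df3 G D s1 s2 s3 s4 s5 (c * v1 + w1) (c * v2 + w2) (c * v3 + w3) (c * v4 + w4) (c * v5 + w5) = c * df3 G D s1 s2 s3 s4 s5 v1 v2 v3 v4 v5 + df3 G D s1 s2 s3 s4 s5 w1 w2 w3 w4 w5"
  "df4 G D s1 s2 s3 s4 s5 (c * v1 + w1) (c * v2 + w2) (c * v3 + w3) (c * v4 + w4) (c * v5 + w5) = c * df4 G D s1 s2 s3 s4 s5 v1 v2 v3 v4 v5 + df4 G D s1 s2 s3 s4 s5 w1 w2 w3 w4 w5"
  unfolding df_defs by algebra+

text \<open>The value of the cocycle on e_m. G and D are one sixth of the linear factors in 27 a^2 +
  12 a b + b^2 = (b + 3 a) (b + 9 a). On e_11 the value is the last entry of the row, which is 1 on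
  the orbit: the centre acts by a non-trivial scalar phase, and this is why the quotient is
  represented only projectively.\<close>

definition Fn :: "real \<Rightarrow> real \<Rightarrow> nat \<Rightarrow> real^11 \<Rightarrow> real" where
  "Fn a b m \<xi> = (let G = (b + 3 * a) / 6; D = (b + 9 * a) / 6;
      s1 = \<xi> $ ix 10; s2 = \<xi> $ ix 9; s3 = \<xi> $ ix 8; s4 = \<xi> $ ix 7; s5 = \<xi> $ ix 6 in
    if m = 1 then f1 G D s1 s2 s3 s4 s5 else if m = 2 then f2 G D s1 s2 s3 s4 s5
    else if m = 3 then f3 G D s1 s2 s3 s4 s5 else if m = 4 then f4 G D s1 s2 s3 s4 s5
    else if m = 5 then 0 else \<xi> $ ix m)"

definition DFn :: "real \<Rightarrow> real \<Rightarrow> nat \<Rightarrow> real^11 \<Rightarrow> real^11 \<Rightarrow> real" where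
  "DFn a b m \<xi> v = (let G = (b + 3 * a) / 6; D = (b + 9 * a) / 6;
      s1 = \<xi> $ ix 10; s2 = \<xi> $ ix 9; s3 = \<xi> $ ix 8; s4 = \<xi> $ ix 7; s5 = \<xi> $ ix 6;
      v1 = v $ ix 10; v2 = v $ ix 9; v3 = v $ ix 8; v4 = v $ ix 7; v5 = v $ ix 6 in
    if m = 1 then df1 G D s1 s2 s3 s4 s5 v1 v2 v3 v4 v5 else if m = 2 then df2 G D s1 s2 s3 s4 s5 v1 v2 v3 v4 v5
    else if m = 3 then df3 G D s1 s2 s3 s4 s5 v1 v2 v3 v4 v5 else if m = 4 then df4 G D s1 s2 s3 s4 s5 v1 v2 v3 v4 v5
    else if m = 5 then 0 else v $ ix m)"

lemma Fn_top: "6 \<le> m \<Longrightarrow> Fn a b m \<xi> = \<xi> $ ix m" and DFn_top: "6 \<le> m \<Longrightarrow> DFn a b m \<xi> v = v $ ix m"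
  by (simp_all add: Fn_def DFn_def)

lemma DFn_zero: "1 \<le> m \<Longrightarrow> m \<le> 5 \<Longrightarrow> (\<And>l. 6 \<le> l \<Longrightarrow> l \<le> 10 \<Longrightarrow> v $ ix l = 0) \<Longrightarrow> DFn a b m \<xi> v = 0"
  by (simp add: DFn_def Let_def df_zero)

lemma DFn_linear: "DFn a b m \<xi> (c *\<^sub>R v + w) = c * DFn a b m \<xi> v + DFn a b m \<xi> w"
  by (simp add: DFn_def Let_def df_linear)

lemma Fn_continuous: "continuous_on S \<xi> \<Longrightarrow> continuous_on S (\<lambda>p. Fn a b m (\<xi> p))"
  unfolding Fn_def Let_def
  by (cases "m = 1"; cases "m = 2"; cases "m = 3"; cases "m = 4"; cases "m = 5"; simp)
    (intro f_continuous continuous_intros; assumption)+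

lemma DFn_continuous: "continuous_on S \<xi> \<Longrightarrow> continuous_on S v \<Longrightarrow> continuous_on S (\<lambda>p. DFn a b m (\<xi> p) (v p))"
  unfolding DFn_def Let_def
  by (cases "m = 1"; cases "m = 2"; cases "m = 3"; cases "m = 4"; cases "m = 5"; simp)
    (intro df_continuous continuous_intros; assumption)+

lemma Fn_deriv:
  assumes "(\<xi> has_vector_derivative v) (at t within S)"
  shows "((\<lambda>t. Fn a b m (\<xi> t)) has_real_derivative DFn a b m (\<xi> t) v) (at t within S)"
proof -
  have c: "((\<lambda>t. \<xi> t $ l) has_real_derivative v $ l) (at t within S)" for l
    using bounded_linear.has_vector_derivative[OF bounded_linear_vec_nth assms]
    by (simp add: has_real_derivative_iff_has_vector_derivative)
  show ?thesis
    unfolding Fn_def DFn_def Let_def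
    by (cases "m = 1"; cases "m = 2"; cases "m = 3"; cases "m = 4"; cases "m = 5"; simp)
      (intro f_derivs c)+
qed

text \<open>The velocity of the row \<xi> under the one-parameter group of e_i.\<close>

definition coad :: "real \<Rightarrow> real \<Rightarrow> nat \<Rightarrow> real^11 \<Rightarrow> real^11" where
  "coad a b i \<xi> = \<xi> v* ad_mat a b (axis (ix i) 1)"

lemma coad_nth: "1 \<le> i \<Longrightarrow> i \<le> 11 \<Longrightarrow> 1 \<le> l \<Longrightarrow> l \<le> 11 \<Longrightarrow>
    coad a b i \<xi> $ ix l = (\<Sum>m=1..11. bc a b i l m * \<xi> $ ix m)"
proof -
  assume i: "1 \<le> i" "i \<le> 11" and l: "1 \<le> l" "l \<le> 11"
  have "coad a b i \<xi> $ ix l = (\<Sum>k\<in>UNIV. bc a b i l (idx k) * \<xi> $ k)"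
    using i l by (simp add: coad_def vector_matrix_mult_def ad_axis mult.commute)
  also have "\<dots> = (\<Sum>m=1..11. bc a b i l m * \<xi> $ ix m)"
    unfolding sum_ix by (intro sum.cong) auto
  finally show ?thesis .
qed

text \<open>For j \<ge> 6 the vector field of e_j does not move the entries 6 to 11, so one term
  drops out and the other is the coadjoint action on a coordinate. The remaining ten pairs are the
  polynomial identities above.\<close>

lemma cocycle_basis:
  assumes top: "\<xi> $ ix 11 = 1" and ij: "1 \<le> i" "i < j" "j \<le> 11"
  shows "DFn a b j \<xi> (coad a b i \<xi>) - DFn a b i \<xi> (coad a b j \<xi>) = (\<Sum>m=1..11. bc a b i j m * Fn a b m \<xi>)"
proof (cases "6 \<le> j")
  case True
  have "DFn a b i \<xi> (coad a b j \<xi>) = 0"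
  proof -
    have z: "coad a b j \<xi> $ ix l = 0" if "6 \<le> l" "l \<le> 11" for l
    proof -
      have "bc a b j l m * \<xi> $ ix m = 0" for m
        using bc_weight[of a b j l m] that True by fastforce
      then show ?thesis using coad_nth[of j l a b \<xi>] ij that by (simp add: sum.neutral)
    qed
    show ?thesis
    proof (cases "6 \<le> i")
      case True then show ?thesis using z ij by (simp add: DFn_top)
    next
      case False then show ?thesis using z ij by (intro DFn_zero) auto
    qed
  qed
  moreover have "DFn a b j \<xi> (coad a b i \<xi>) = (\<Sum>m=1..11. bc a b i j m * \<xi> $ ix m)"
    using True ij by (simp add: DFn_top coad_nth)
  moreover have "bc a b i j m * \<xi> $ ix m = bc a b i j m * Fn a b m \<xi>" for m
    using bc_weight[of a b i j m] True ij by (cases "bc a b i j m = 0") (simp_all add: Fn_top)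
  ultimately show ?thesis by simp
next
  case False
  define G where "G = (b + 3 * a) / 6"
  define D where "D = (b + 9 * a) / 6"
  \<comment> \<open>The structure constants are rewritten in G and D, the variables of the
    polynomial identities.\<close>
  have a: "a = D - G" and b: "b = 9 * G - 3 * D" by (simp_all add: G_def D_def field_simps)
  have F: "Fn a b 1 \<xi> = f1 G D (\<xi> $ ix 10) (\<xi> $ ix 9) (\<xi> $ ix 8) (\<xi> $ ix 7) (\<xi> $ ix 6)"
    "Fn a b 2 \<xi> = f2 G D (\<xi> $ ix 10) (\<xi> $ ix 9) (\<xi> $ ix 8) (\<xi> $ ix 7) (\<xi> $ ix 6)"
    "Fn a b 3 \<xi> = f3 G D (\<xi> $ ix 10) (\<xi> $ ix 9) (\<xi> $ ix 8) (\<xi> $ ix 7) (\<xi> $ ix 6)"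
    "Fn a b 4 \<xi> = f4 G D (\<xi> $ ix 10) (\<xi> $ ix 9) (\<xi> $ ix 8) (\<xi> $ ix 7) (\<xi> $ ix 6)"
    "Fn a b 5 \<xi> = 0" "Fn a b 6 \<xi> = \<xi> $ ix 6" "Fn a b 7 \<xi> = \<xi> $ ix 7" "Fn a b 8 \<xi> = \<xi> $ ix 8"
    "Fn a b 9 \<xi> = \<xi> $ ix 9" "Fn a b 10 \<xi> = \<xi> $ ix 10" "Fn a b 11 \<xi> = 1"
    by (simp_all add: Fn_def G_def D_def Let_def top)
  have DF: "DFn a b 1 \<xi> v = df1 G D (\<xi> $ ix 10) (\<xi> $ ix 9) (\<xi> $ ix 8) (\<xi> $ ix 7) (\<xi> $ ix 6) (v $ ix 10) (v $ ix 9) (v $ ix 8) (v $ ix 7) (v $ ix 6)"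
    "DFn a b 2 \<xi> v = df2 G D (\<xi> $ ix 10) (\<xi> $ ix 9) (\<xi> $ ix 8) (\<xi> $ ix 7) (\<xi> $ ix 6) (v $ ix 10) (v $ ix 9) (v $ ix 8) (v $ ix 7) (v $ ix 6)"
    "DFn a b 3 \<xi> v = df3 G D (\<xi> $ ix 10) (\<xi> $ ix 9) (\<xi> $ ix 8) (\<xi> $ ix 7) (\<xi> $ ix 6) (v $ ix 10) (v $ ix 9) (v $ ix 8) (v $ ix 7) (v $ ix 6)"
    "DFn a b 4 \<xi> v = df4 G D (\<xi> $ ix 10) (\<xi> $ ix 9) (\<xi> $ ix 8) (\<xi> $ ix 7) (\<xi> $ ix 6) (v $ ix 10) (v $ ix 9) (v $ ix 8) (v $ ix 7) (v $ ix 6)"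
    "DFn a b 5 \<xi> v = 0" for v
    by (simp_all add: DFn_def G_def D_def Let_def)
  have c1: "coad a b 1 \<xi> $ ix 10 = (1)" "coad a b 1 \<xi> $ ix 9 = (\<xi> $ ix 10)" "coad a b 1 \<xi> $ ix 8 =
      (\<xi> $ ix 9)" "coad a b 1 \<xi> $ ix 7 = (\<xi> $ ix 8)" "coad a b 1 \<xi> $ ix 6 = (\<xi> $ ix 7)"
    by (simp_all add: coad_nth[simplified], simp_all add: bc_def brl_def sum_lc[simplified] sum_negf top)
      (simp_all add: a b power2_eq_square field_simps)?
  have c2: "coad a b 2 \<xi> $ ix 10 = (0)" "coad a b 2 \<xi> $ ix 9 = (-1)" "coad a b 2 \<xi> $ ix 8 = ((-5) * D +
      (7/2) * G + 2 * (\<xi> $ ix 10))" "coad a b 2 \<xi> $ ix 7 = ((9/4) * G * D + (-2) * (\<xi> $ ix 9) + 4 *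
      (\<xi> $ ix 10) * D + (-29/2) * (\<xi> $ ix 10) * G)" "coad a b 2 \<xi> $ ix 6 = ((-3) * (\<xi> $ ix 8) + 7 *
      (\<xi> $ ix 9) * D + (-19) * (\<xi> $ ix 9) * G)"
    by (simp_all add: coad_nth[simplified], simp_all add: bc_def brl_def sum_lc[simplified] sum_negf top)
      (simp_all add: a b power2_eq_square field_simps)?
  have c3: "coad a b 3 \<xi> $ ix 10 = (0)" "coad a b 3 \<xi> $ ix 9 = (0)" "coad a b 3 \<xi> $ ix 8 = (3)" "coad a b 3
      \<xi> $ ix 7 = (9 * D + (-18) * G + (-4) * (\<xi> $ ix 10))" "coad a b 3 \<xi> $ ix 6 = ((-9/4) * G * D + (-1)
      * (\<xi> $ ix 9) + 3 * (\<xi> $ ix 10) * D + (-9/2) * (\<xi> $ ix 10) * G)"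
    by (simp_all add: coad_nth[simplified], simp_all add: bc_def brl_def sum_lc[simplified] sum_negf top)
      (simp_all add: a b power2_eq_square field_simps)?
  have c4: "coad a b 4 \<xi> $ ix 10 = (0)" "coad a b 4 \<xi> $ ix 9 = (0)" "coad a b 4 \<xi> $ ix 8 = (0)" "coad a b 4
      \<xi> $ ix 7 = (-7)" "coad a b 4 \<xi> $ ix 6 = ((-6) * D + (27/2) * G + 3 * (\<xi> $ ix 10))"
    by (simp_all add: coad_nth[simplified], simp_all add: bc_def brl_def sum_lc[simplified] sum_negf top)
      (simp_all add: a b power2_eq_square field_simps)?
  have c5: "coad a b 5 \<xi> $ ix 10 = (0)" "coad a b 5 \<xi> $ ix 9 = (0)" "coad a b 5 \<xi> $ ix 8 = (0)" "coad a b 5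
      \<xi> $ ix 7 = (0)" "coad a b 5 \<xi> $ ix 6 = (10)"
    by (simp_all add: coad_nth[simplified], simp_all add: bc_def brl_def sum_lc[simplified] sum_negf top)
      (simp_all add: a b power2_eq_square field_simps)?
  have r12: "(\<Sum>m=1..11. bc a b 1 2 m * Fn a b m \<xi>) = f3 G D (\<xi> $ ix 10) (\<xi> $ ix 9) (\<xi> $ ix 8) (\<xi> $ ix 7) (\<xi> $ ix 6)"
    by (simp add: bc_def brl_def sum_lc[simplified] F[simplified]) (simp add: a b power2_eq_square field_simps)?
  have r13: "(\<Sum>m=1..11. bc a b 1 3 m * Fn a b m \<xi>) = f4 G D (\<xi> $ ix 10) (\<xi> $ ix 9) (\<xi> $ ix 8) (\<xi> $ ix 7) (\<xi> $ ix 6)"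
    by (simp add: bc_def brl_def sum_lc[simplified] F[simplified]) (simp add: a b power2_eq_square field_simps)?
  have r14: "(\<Sum>m=1..11. bc a b 1 4 m * Fn a b m \<xi>) = 0"
    by (simp add: bc_def brl_def sum_lc[simplified] F[simplified]) (simp add: a b power2_eq_square field_simps)?
  have r15: "(\<Sum>m=1..11. bc a b 1 5 m * Fn a b m \<xi>) = (\<xi> $ ix 6)"
    by (simp add: bc_def brl_def sum_lc[simplified] F[simplified]) (simp add: a b power2_eq_square field_simps)?
  have r23: "(\<Sum>m=1..11. bc a b 2 3 m * Fn a b m \<xi>) = (D + (-1) * G) * (\<xi> $ ix 6)"
    by (simp add: bc_def brl_def sum_lc[simplified] F[simplified]) (simp add: a b power2_eq_square field_simps)?
  have r24: "(\<Sum>m=1..11. bc a b 2 4 m * Fn a b m \<xi>) = (\<xi> $ ix 6) + (D + (-1) * G) * (\<xi> $ ix 7)"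
    by (simp add: bc_def brl_def sum_lc[simplified] F[simplified]) (simp add: a b power2_eq_square field_simps)?
  have r25: "(\<Sum>m=1..11. bc a b 2 5 m * Fn a b m \<xi>) = (-1) * (\<xi> $ ix 7) + (4 * D + (-10) * G) * (\<xi> $ ix 8)"
    by (simp add: bc_def brl_def sum_lc[simplified] F[simplified]) (simp add: a b power2_eq_square field_simps)?
  have r34: "(\<Sum>m=1..11. bc a b 3 4 m * Fn a b m \<xi>) = 2 * (\<xi> $ ix 7) + ((-3) * D + 9 * G) * (\<xi> $ ix 8)"
    by (simp add: bc_def brl_def sum_lc[simplified] F[simplified]) (simp add: a b power2_eq_square field_simps)?
  have r35: "(\<Sum>m=1..11. bc a b 3 5 m * Fn a b m \<xi>) = 2 * (\<xi> $ ix 8) + ((-3) * D + 9 * G) * (\<xi> $ ix 9)"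
    by (simp add: bc_def brl_def sum_lc[simplified] F[simplified]) (simp add: a b power2_eq_square field_simps)?
  have r45: "(\<Sum>m=1..11. bc a b 4 5 m * Fn a b m \<xi>) = 3 * (\<xi> $ ix 9) + ((-6) * D + (27/2) * G) * (\<xi> $ ix 10) + ((9/4) * G * D) * 1"
    by (simp add: bc_def brl_def sum_lc[simplified] F[simplified]) (simp add: a b power2_eq_square field_simps)?
  have "i = 1 \<or> i = 2 \<or> i = 3 \<or> i = 4" "j = 2 \<or> j = 3 \<or> j = 4 \<or> j = 5"
    using ij False by linarith+
  then consider "i = 1" "j = 2" | "i = 1" "j = 3" | "i = 1" "j = 4" | "i = 1" "j = 5" | "i = 2" "j = 3" | "i = 2" "j = 4" | "i = 2" "j = 5" | "i = 3" "j = 4" | "i = 3" "j = 5" | "i = 4" "j = 5"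
    using ij(2) by (elim disjE) simp_all
  then show ?thesis
  proof cases
    case 1 show ?thesis by (simp only: 1 DF c1 c2 r12 cocycle_12)
  next
    case 2 show ?thesis by (simp only: 2 DF c1 c3 r13 cocycle_13)
  next
    case 3 show ?thesis by (simp only: 3 DF c1 c4 r14 cocycle_14)
  next
    case 4 show ?thesis by (simp only: 4 DF c1 c5 r15 cocycle_15)
  next
    case 5 show ?thesis by (simp only: 5 DF c2 c3 r23 cocycle_23)
  next
    case 6 show ?thesis by (simp only: 6 DF c2 c4 r24 cocycle_24)
  next
    case 7 show ?thesis by (simp only: 7 DF c2 c5 r25 cocycle_25)
  next
    case 8 show ?thesis by (simp only: 8 DF c3 c4 r34 cocycle_34)
  next
    case 9 show ?thesis by (simp only: 9 DF c3 c5 r35 cocycle_35)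
  next
    case 10 show ?thesis by (simp only: 10 DF c4 c5 r45 cocycle_45)
  qed
qed

definition phi :: "real \<Rightarrow> real \<Rightarrow> real^11 \<Rightarrow> real^11 \<Rightarrow> real" where
  "phi a b x \<xi> = (\<Sum>i\<in>UNIV. x $ i * Fn a b (idx i) \<xi>)"

definition dphi :: "real \<Rightarrow> real \<Rightarrow> real^11 \<Rightarrow> real^11 \<Rightarrow> real^11 \<Rightarrow> real" where
  "dphi a b x \<xi> v = (\<Sum>i\<in>UNIV. x $ i * DFn a b (idx i) \<xi> v)"

lemma phi_linear: "phi a b (c *\<^sub>R x + y) \<xi> = c * phi a b x \<xi> + phi a b y \<xi>"
  by (simp add: phi_def distrib_right sum.distrib sum_distrib_left mult.assoc)

lemma phi_minus: "phi a b (- x) \<xi> = - phi a b x \<xi>"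
  by (simp add: phi_def sum_negf)

lemma dphi_linear: "dphi a b (c *\<^sub>R x + y) \<xi> v = c * dphi a b x \<xi> v + dphi a b y \<xi> v"
  by (simp add: dphi_def distrib_right sum.distrib sum_distrib_left mult.assoc)

lemma dphi_linear_right: "dphi a b x \<xi> (c *\<^sub>R v + w) = c * dphi a b x \<xi> v + dphi a b x \<xi> w"
  by (simp add: dphi_def DFn_linear distrib_left sum.distrib sum_distrib_left mult_ac)

lemma dphi_axis: "dphi a b (axis i 1) \<xi> v = DFn a b (idx i) \<xi> v"
  by (simp add: dphi_def axis_def if_distrib[of "\<lambda>x. x * _"] cong: if_cong)

lemma ad_axis_axis: "(ad_mat a b (axis i 1) *v axis j 1) $ k = bc a b (idx i) (idx j) (idx k)"
  using ad_axis[of "idx i" a b 1 k j] idx_ge_1[of i] idx_le_11[of i]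
  by (simp add: matrix_vector_mult_basis column_def)

text \<open>The defect B is bilinear and antisymmetric, so pairs of basis vectors with i < j
  suffice.\<close>

lemma cocycle:
  assumes top: "\<xi> $ ix 11 = 1"
  shows "dphi a b y \<xi> (\<xi> v* ad_mat a b x) - dphi a b x \<xi> (\<xi> v* ad_mat a b y) = phi a b (ad_mat a b x *v y) \<xi>"
proof -
  define B where "B x y = dphi a b y \<xi> (\<xi> v* ad_mat a b x) - dphi a b x \<xi> (\<xi> v* ad_mat a b y) - phi a b (ad_mat a b x *v y) \<xi>" for x y
  have skew: "B x y = - B y x" for x y
    unfolding B_def ad_skew[of a b x y] phi_minus by simp
  have l1: "B (c *\<^sub>R x + x') y = c * B x y + B x' y" for c x x' y
    unfolding B_def dphi_linear ad_add ad_scaleR vm.add_right vm.scaleR_right mv.add_left mv.scaleR_left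
      dphi_linear_right phi_linear by (simp add: algebra_simps)
  have l2: "B y (c *\<^sub>R x + x') = c * B y x + B y x'" for c x x' y
    unfolding skew[of y "c *\<^sub>R x + x'"] skew[of y x] skew[of y x'] l1 by simp
  have z: "B 0 y = 0" "B y 0 = 0" for y
    using l1[of 1 0 0 y] l2[of y 1 0 0] by simp_all
  have "linear (\<lambda>x. B x y)" for y
  proof (rule linearI)
    show "B (x1 + x2) y = B x1 y + B x2 y" for x1 x2 using l1[of 1 x1 x2 y] by simp
    show "B (c *\<^sub>R x) y = c *\<^sub>R B x y" for c x using l1[of c x 0 y] z by simp
  qed
  moreover have "linear (B y)" for y
  proof (rule linearI)
    show "B y (x1 + x2) = B y x1 + B y x2" for x1 x2 using l2[of y 1 x1 x2] by simp
    show "B y (c *\<^sub>R x) = c *\<^sub>R B y x" for c x using l2[of y c x 0] z by simp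
  qed
  ultimately have "bilinear B" by (simp add: bilinear_def)
  moreover have "bilinear (\<lambda>(x::real^11) (y::real^11). (0::real))"
    by (simp add: bilinear_def linear_zero)
  moreover have "B i j = 0" if ij: "i \<in> Basis" "j \<in> Basis" for i j
  proof -
    obtain i' j' where i: "i = axis i' 1" and j: "j = axis j' 1" using ij by (auto simp: Basis_vec_def)
    have lt: "B (axis i' 1) (axis j' 1) = 0" if "idx i' < idx j'" for i' j'
    proof -
      have "phi a b (ad_mat a b (axis i' 1) *v axis j' 1) \<xi> = (\<Sum>k\<in>UNIV. bc a b (idx i') (idx j') (idx k) * Fn a b (idx k) \<xi>)"
        by (simp add: phi_def ad_axis_axis)
      also have "\<dots> = (\<Sum>m=1..11. bc a b (idx i') (idx j') m * Fn a b m \<xi>)"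
        by (rule sum_idx)
      also have "\<dots> = DFn a b (idx j') \<xi> (coad a b (idx i') \<xi>) - DFn a b (idx i') \<xi> (coad a b (idx j') \<xi>)"
        using cocycle_basis[OF top idx_ge_1 that idx_le_11, of a b] by simp
      finally show ?thesis unfolding B_def dphi_axis coad_def by simp
    qed
    consider "idx i' < idx j'" | "idx j' < idx i'" | "i' = j'" by (metis idx_eq_iff linorder_neqE_nat)
    then show ?thesis
    proof cases
      case 1 then show ?thesis unfolding i j by (rule lt)
    next
      case 2 then show ?thesis unfolding i j using lt[of j' i'] skew[of "axis i' 1" "axis j' 1"] by linarith
    next
      case 3 then show ?thesis unfolding i j using skew[of "axis i' 1" "axis i' 1"] by simp
    qed
  qed
  ultimately have "B = (\<lambda>x y. 0)" by (intro bilinear_eq_stdbasis)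
  then have "B x y = 0" by simp
  then show ?thesis by (simp add: B_def)
qed

lemma phi_curve:
  assumes "(X has_vector_derivative X') (at t within S)" "(\<xi> has_vector_derivative v) (at t within S)"
  shows "((\<lambda>t. phi a b (X t) (\<xi> t)) has_vector_derivative phi a b X' (\<xi> t) + dphi a b (X t) (\<xi> t) v) (at t within S)"
proof -
  have c: "((\<lambda>t. X t $ i) has_real_derivative X' $ i) (at t within S)" for i
    using bounded_linear.has_vector_derivative[OF bounded_linear_vec_nth assms(1)]
    by (simp add: has_real_derivative_iff_has_vector_derivative)
  have "((\<lambda>t. phi a b (X t) (\<xi> t)) has_real_derivative
      (\<Sum>i\<in>UNIV. X' $ i * Fn a b (idx i) (\<xi> t) + DFn a b (idx i) (\<xi> t) v * X t $ i)) (at t within S)"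
    unfolding phi_def by (intro DERIV_sum DERIV_mult c Fn_deriv assms)
  then show ?thesis
    by (simp add: has_real_derivative_iff_has_vector_derivative phi_def dphi_def sum.distrib mult.commute)
qed

lemma phi_continuous: "continuous_on S X \<Longrightarrow> continuous_on S \<xi> \<Longrightarrow> continuous_on S (\<lambda>p. phi a b (X p) (\<xi> p))"
  unfolding phi_def by (intro continuous_intros Fn_continuous)

lemma dphi_continuous: "continuous_on S X \<Longrightarrow> continuous_on S \<xi> \<Longrightarrow> continuous_on S v \<Longrightarrow>
    continuous_on S (\<lambda>p. dphi a b (X p) (\<xi> p) (v p))"
  unfolding dphi_def by (intro continuous_intros DFn_continuous)

text \<open>The phase of the representation is the integral of the cocycle along the one-parameter group;
  the cocycle identity makes it multiplicative up to a constant.\<close>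

definition theta :: "real \<Rightarrow> real \<Rightarrow> real^11 \<Rightarrow> real^11 \<Rightarrow> real" where
  "theta a b x \<xi> = integral {0..1} (\<lambda>s. phi a b x (\<xi> v* E a b (s *\<^sub>R x)))"

lemma E_swap: "ad_mat a b w ** E a b x = E a b x ** ad_mat a b (E a b (- x) *v w)"
  by (simp add: E_conj' mv.scaleR_left matrix_vector_mul_assoc E_minus_right)

text \<open>Differentiation under the integral produces the derivative of phi along w transported
  through exp(s x), that is along y(s). The cocycle identity exchanges the roles of x and y(s),
  which turns the integrand into the total s-derivative of phi on y(s), so only the end points s = 0
  and s = 1 remain.\<close>

lemma theta_deriv:
  assumes top: "\<xi> $ ix 11 = 1" and t: "t \<in> {0..1}"
  shows "((\<lambda>t. theta a b x (\<xi> v* E a b (t *\<^sub>R w))) has_vector_derivative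
    phi a b (E a b (- x) *v w) (\<xi> v* E a b (t *\<^sub>R w) v* E a b x) - phi a b w (\<xi> v* E a b (t *\<^sub>R w))) (at t within {0..1})"
proof -
  define \<zeta> where "\<zeta> t s = \<xi> v* E a b (t *\<^sub>R w) v* E a b (s *\<^sub>R x)" for t s
  define y where "y s = E a b (- (s *\<^sub>R x)) *v w" for s
  define D where "D t s = dphi a b x (\<zeta> t s) (\<zeta> t s v* ad_mat a b (y s))" for t s
  have z11: "\<zeta> t s $ ix 11 = 1" for t s using top by (simp add: \<zeta>_def row_E_11)
  have dt: "((\<lambda>t. \<zeta> t s) has_vector_derivative \<zeta> t s v* ad_mat a b (y s)) (at t within S)" for t s S
  proof -
    have "((\<lambda>t. \<xi> v* (E a b (t *\<^sub>R w) ** E a b (s *\<^sub>R x))) has_vector_derivative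
       \<xi> v* (ad_mat a b w ** E a b (t *\<^sub>R w) ** E a b (s *\<^sub>R x))) (at t within S)"
      using vm.has_vector_derivative[OF has_vector_derivative_const[of \<xi>]
          mm.has_vector_derivative[OF E_deriv[of a b w t S] has_vector_derivative_const[of "E a b (s *\<^sub>R x)"]]] by simp
    moreover have "ad_mat a b w ** E a b (t *\<^sub>R w) ** E a b (s *\<^sub>R x) = E a b (t *\<^sub>R w) ** E a b (s *\<^sub>R x) ** ad_mat a b (y s)"
      unfolding E_commute[of a b w t] y_def matrix_mul_assoc[symmetric] by (simp only: E_swap[of a b w "s *\<^sub>R x"])
    ultimately show ?thesis by (simp add: \<zeta>_def vector_matrix_mul_assoc)
  qed
  have ds: "((\<lambda>s. \<zeta> t s) has_vector_derivative \<zeta> t s v* ad_mat a b x) (at s within S)" for t s S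
    unfolding \<zeta>_def
    using vm.has_vector_derivative[OF has_vector_derivative_const[of "\<xi> v* E a b (t *\<^sub>R w)"] E_deriv[of a b x s S]]
    by (simp add: E_commute vector_matrix_mul_assoc matrix_mul_assoc)
  have dy: "(y has_vector_derivative - (ad_mat a b x *v y s)) (at s within S)" for s S
    unfolding y_def
    using mv.has_vector_derivative[OF E_deriv_minus[of a b x s S] has_vector_derivative_const[of w]]
    by (simp add: mv.minus_left matrix_vector_mul_assoc)
  have yc: "continuous_on UNIV y" unfolding y_def by (intro mv.continuous_on continuous_E_comp continuous_intros)
  have zc: "continuous_on T (\<lambda>p. \<zeta> (fst p) (snd p))" for T
    unfolding \<zeta>_def by (intro vm.continuous_on continuous_E_comp continuous_intros)
  have "((\<lambda>t. integral (cbox 0 1) (\<lambda>s. phi a b x (\<zeta> t s))) has_vector_derivative integral (cbox 0 1) (D t)) (at t within {0..1})"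
  proof (rule leibniz_rule_vector_derivative)
    show "((\<lambda>t. phi a b x (\<zeta> t s)) has_vector_derivative D t s) (at t within {0..1})" for t s
      using phi_curve[OF has_vector_derivative_const[of x] dt[of s t "{0..1}"], of a b] by (simp add: D_def phi_def)
    show "(\<lambda>s. phi a b x (\<zeta> t s)) integrable_on cbox 0 1" for t
    proof (intro integrable_continuous phi_continuous continuous_intros)
      show "continuous_on (cbox 0 1) (\<zeta> t)" unfolding \<zeta>_def
        by (intro vm.continuous_on continuous_E_comp continuous_intros)
    qed
    have "continuous_on ({0..1} \<times> cbox 0 1) (\<lambda>p. D (fst p) (snd p))"
      unfolding D_def
      by (intro dphi_continuous vm.continuous_on zc continuous_intros
          continuous_on_compose2[OF linear_continuous_on[OF linear_conv_bounded_linear[THEN iffD1, OF linear_ad]]]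
          continuous_on_compose2[OF yc]) auto
    then show "continuous_on ({0..1} \<times> cbox 0 1) (\<lambda>(t, s). D t s)" by (simp add: case_prod_beta')
  qed (use t in auto)
  moreover have "(D t has_integral phi a b (y 1) (\<zeta> t 1) - phi a b (y 0) (\<zeta> t 0)) {0..1}"
  proof (rule fundamental_theorem_of_calculus)
    show "((\<lambda>s. phi a b (y s) (\<zeta> t s)) has_vector_derivative D t s) (at s within {0..1})" for s
    proof -
      have "phi a b (- (ad_mat a b x *v y s)) (\<zeta> t s) + dphi a b (y s) (\<zeta> t s) (\<zeta> t s v* ad_mat a b x) = D t s"
        using cocycle[OF z11[of t s], where x = x and y = "y s" and a = a and b = b] by (simp add: phi_minus D_def)
      then show ?thesis using phi_curve[OF dy[of s "{0..1}"] ds[of t s "{0..1}"], of a b] by simp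
    qed
  qed simp
  ultimately have "((\<lambda>t. integral {0..1} (\<lambda>s. phi a b x (\<zeta> t s))) has_vector_derivative
      phi a b (y 1) (\<zeta> t 1) - phi a b (y 0) (\<zeta> t 0)) (at t within {0..1})"
    by (simp add: integral_unique)
  then show ?thesis by (simp add: theta_def \<zeta>_def y_def)
qed

text \<open>The rows \<eta> and \<xi> are joined by the path of exp(t w). Along it the boundary
  terms of \<open>theta_deriv\<close> telescope: the end of the path of x is the start of the path
  of y, and both ways lead to the end of the path of z. So the failure to be additive does not
  depend on the row.\<close>

lemma theta_mult:
  assumes z: "E a b x ** E a b y = E a b z" and top: "\<xi> $ ix 11 = 1" "\<eta> $ ix 11 = 1"
  shows "theta a b x \<xi> + theta a b y (\<xi> v* E a b x) - theta a b z \<xi> =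
    theta a b x \<eta> + theta a b y (\<eta> v* E a b x) - theta a b z \<eta>"
proof -
  define w where "w = solve a b \<eta> \<xi>"
  have w: "\<eta> v* E a b w = \<xi>" unfolding w_def by (intro row_solve top)
  define w' where "w' = E a b (- x) *v w"
  have sw: "E a b (t *\<^sub>R w) ** E a b x = E a b x ** E a b (t *\<^sub>R w')" if "t \<in> {0..1}" for t
  proof -
    define F where "F t = E a b x ** E a b (t *\<^sub>R w') ** E a b (- x) ** E a b (- (t *\<^sub>R w))" for t
    have "(F has_vector_derivative 0) (at t within {0..1})" for t
    proof -
      have "ad_mat a b w ** E a b x = E a b x ** ad_mat a b w'" unfolding w'_def by (rule E_swap)
      then have e: "ad_mat a b w ** (E a b x ** Y) = E a b x ** (ad_mat a b w' ** Y)" for Y by (simp add: matrix_mul_assoc)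
      have f: "E a b (- x) ** (ad_mat a b w ** Y) = ad_mat a b w' ** (E a b (- x) ** Y)" for Y
        by (simp add: w'_def E_conj' matrix_mul_assoc)
      have g: "ad_mat a b w' ** (E a b (t *\<^sub>R w') ** Y) = E a b (t *\<^sub>R w') ** (ad_mat a b w' ** Y)" for Y
        by (simp add: matrix_mul_assoc E_commute)
      have 0: "((\<lambda>t. E a b (t *\<^sub>R w')) has_vector_derivative ad_mat a b w' ** E a b (t *\<^sub>R w')) (at t within {0..1})"
        by (rule E_deriv)
      note 1 = mm.has_vector_derivative[OF mm.has_vector_derivative[OF mm.has_vector_derivative[OF
            has_vector_derivative_const[of "E a b x"] 0] has_vector_derivative_const[of "E a b (- x)"]] E_deriv_minus[of a b w t "{0..1}"]]
      show ?thesis unfolding F_def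
        by (rule has_vector_derivative_eq_rhs[OF 1])
          (simp only: mm.minus_right mm.zero_left mm.zero_right mm.add_left mm.add_right matrix_mul_assoc[symmetric] f g add_0_left add_0_right, simp)
    qed
    then have "F t = F 0" using that by (intro const_on_unit) auto
    then have "F t = mat 1" by (simp add: F_def E_minus_right)
    then have "F t ** E a b (t *\<^sub>R w) ** E a b x = E a b (t *\<^sub>R w) ** E a b x" by simp
    then show ?thesis by (simp add: F_def E_cancel)
  qed
  define T where "T t = theta a b x (\<eta> v* E a b (t *\<^sub>R w)) + theta a b y (\<eta> v* E a b x v* E a b (t *\<^sub>R w'))
     - theta a b z (\<eta> v* E a b (t *\<^sub>R w))" for t
  have zw: "E a b (- y) *v w' = E a b (- z) *v w"
  proof -
    have "E a b (- z) = E a b (- y) ** E a b (- x)"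
    proof -
      have "E a b (- y) ** E a b (- x) ** (E a b x ** E a b y) ** E a b (- z) = E a b (- y) ** E a b (- x)"
        unfolding z by (simp add: E_cancel)
      moreover have "E a b (- y) ** E a b (- x) ** (E a b x ** E a b y) = mat 1"
        by (simp add: matrix_mul_assoc E_cancel E_minus_left)
      ultimately show ?thesis by simp
    qed
    then show ?thesis by (simp add: w'_def matrix_vector_mul_assoc)
  qed
  have "(T has_vector_derivative 0) (at t within {0..1})" if t: "t \<in> {0..1}" for t
  proof -
    have \<eta>x: "(\<eta> v* E a b x) $ ix 11 = 1" using top by (simp add: row_E_11)
    have e: "\<eta> v* E a b x v* E a b (t *\<^sub>R w') = \<eta> v* E a b (t *\<^sub>R w) v* E a b x"
      by (simp add: vector_matrix_mul_assoc sw[OF t])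
    have e2: "\<eta> v* E a b x v* E a b (t *\<^sub>R w') v* E a b y = \<eta> v* E a b (t *\<^sub>R w) v* E a b z"
      by (simp add: e) (simp add: vector_matrix_mul_assoc z[symmetric] matrix_mul_assoc)
    note 1 = has_vector_derivative_diff[OF has_vector_derivative_add[OF theta_deriv[OF top(2) t, of a b x w]
          theta_deriv[OF \<eta>x t, of a b y w']] theta_deriv[OF top(2) t, of a b z w]]
    show ?thesis unfolding T_def
      by (rule has_vector_derivative_eq_rhs[OF 1]) (simp only: e2, simp add: e w'_def[symmetric] zw)
  qed
  then have "T 1 = T 0" by (intro const_on_unit) auto
  moreover have "\<eta> v* E a b x v* E a b w' = \<xi> v* E a b x"
  proof -
    have "\<eta> v* (E a b x ** E a b w') = \<eta> v* (E a b w ** E a b x)" using sw[of 1] by simp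
    then show ?thesis unfolding vector_matrix_mul_assoc[symmetric] w .
  qed
  ultimately show ?thesis by (simp add: T_def w)
qed

lemma theta_continuous:
  assumes "continuous_on S X" "continuous_on S \<xi>"
  shows "continuous_on S (\<lambda>p. theta a b (X p) (\<xi> p))"
proof -
  have "continuous_on UNIV (\<lambda>q. theta a b (fst q) (snd q))"
    unfolding theta_def cbox_interval[symmetric]
  proof (rule integral_continuous_on_param)
    show "continuous_on (UNIV \<times> cbox 0 1) (\<lambda>(q, s). phi a b (fst q) (snd q v* E a b (s *\<^sub>R fst q)))"
      unfolding case_prod_beta'
      by (intro phi_continuous vm.continuous_on continuous_E_comp continuous_intros)
  qed
  from continuous_on_compose2[OF this continuous_on_Pair[OF assms]] show ?thesis by simp
qed

section \<open>Square-integrable functions\<close>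

text \<open>Functions rather than classes modulo null functions; \<open>ip\<close> and
  \<open>nsq\<close> do not see the difference, and equalities are stated almost everywhere where it
  matters.\<close>

definition sqi :: "'a measure \<Rightarrow> ('a \<Rightarrow> complex) set" where
  "sqi M = {f. f \<in> borel_measurable M \<and> integrable M (\<lambda>x. (cmod (f x))\<^sup>2)}"

definition ip :: "'a measure \<Rightarrow> ('a \<Rightarrow> complex) \<Rightarrow> ('a \<Rightarrow> complex) \<Rightarrow> complex" where
  "ip M f g = (\<integral>x. f x * cnj (g x) \<partial>M)"

definition nsq :: "'a measure \<Rightarrow> ('a \<Rightarrow> complex) \<Rightarrow> real" where
  "nsq M f = (\<integral>x. (cmod (f x))\<^sup>2 \<partial>M)"

lemma cnj_measurable [measurable]: "cnj \<in> borel \<rightarrow>\<^sub>M borel"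
  by (intro borel_measurable_continuous_onI continuous_intros)

lemma cmod_add_sq_le: "(cmod (x + y))\<^sup>2 \<le> 2 * (cmod x)\<^sup>2 + 2 * (cmod y)\<^sup>2"
proof -
  have "(cmod (x + y))\<^sup>2 \<le> (cmod x + cmod y)\<^sup>2" by (simp add: norm_triangle_ineq power_mono)
  also have "\<dots> \<le> 2 * (cmod x)\<^sup>2 + 2 * (cmod y)\<^sup>2"
    using zero_le_power2[of "cmod x - cmod y"] by (simp add: power2_eq_square algebra_simps)
  finally show ?thesis .
qed

lemma sqi_measurable [measurable_dest]: "f \<in> sqi M \<Longrightarrow> f \<in> borel_measurable M"
  by (simp add: sqi_def)

lemma sqi_integrable: "f \<in> sqi M \<Longrightarrow> integrable M (\<lambda>x. (cmod (f x))\<^sup>2)"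
  by (simp add: sqi_def)

lemma sqi_prod_integrable:
  assumes "f \<in> sqi M" "g \<in> sqi M" shows "integrable M (\<lambda>x. f x * cnj (g x))"
proof (rule Bochner_Integration.integrable_bound)
  show "integrable M (\<lambda>x. (cmod (f x))\<^sup>2 + (cmod (g x))\<^sup>2)"
    using assms by (intro Bochner_Integration.integrable_add sqi_integrable)
  show "(\<lambda>x. f x * cnj (g x)) \<in> borel_measurable M" using assms[THEN sqi_measurable] by measurable
  show "AE x in M. norm (f x * cnj (g x)) \<le> norm ((cmod (f x))\<^sup>2 + (cmod (g x))\<^sup>2)"
  proof (intro AE_I2)
    fix x
    have "cmod (f x) * cmod (g x) \<le> (cmod (f x))\<^sup>2 + (cmod (g x))\<^sup>2"
      using sum_squares_bound[of "cmod (f x)" "cmod (g x)"] zero_le_power2[of "cmod (f x)"] zero_le_power2[of "cmod (g x)"]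
      by linarith
    then show "norm (f x * cnj (g x)) \<le> norm ((cmod (f x))\<^sup>2 + (cmod (g x))\<^sup>2)" by (simp add: norm_mult)
  qed
qed

lemma sqi_zero [simp]: "(\<lambda>_. 0) \<in> sqi M"
  by (simp add: sqi_def)

lemma sqi_lincomb:
  assumes "f \<in> sqi M" "g \<in> sqi M" shows "(\<lambda>x. c * f x + g x) \<in> sqi M"
  unfolding sqi_def
proof safe
  show m: "(\<lambda>x. c * f x + g x) \<in> borel_measurable M" using assms[THEN sqi_measurable] by measurable
  show "integrable M (\<lambda>x. (cmod (c * f x + g x))\<^sup>2)"
  proof (rule Bochner_Integration.integrable_bound)
    show "integrable M (\<lambda>x. 2 * (cmod c)\<^sup>2 * (cmod (f x))\<^sup>2 + 2 * (cmod (g x))\<^sup>2)"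
      using assms by (intro Bochner_Integration.integrable_add integrable_mult_right sqi_integrable)
    show "(\<lambda>x. (cmod (c * f x + g x))\<^sup>2) \<in> borel_measurable M" using m by measurable
    show "AE x in M. norm ((cmod (c * f x + g x))\<^sup>2) \<le> norm (2 * (cmod c)\<^sup>2 * (cmod (f x))\<^sup>2 + 2 * (cmod (g x))\<^sup>2)"
    proof (intro AE_I2)
      fix x show "norm ((cmod (c * f x + g x))\<^sup>2) \<le> norm (2 * (cmod c)\<^sup>2 * (cmod (f x))\<^sup>2 + 2 * (cmod (g x))\<^sup>2)"
        using cmod_add_sq_le[of "c * f x" "g x"] by (simp add: norm_mult power_mult_distrib)
    qed
  qed
qed

lemma sqi_scale: "f \<in> sqi M \<Longrightarrow> (\<lambda>x. c * f x) \<in> sqi M"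
  using sqi_lincomb[of f M "\<lambda>_. 0" c] by simp

lemma sqi_diff: "f \<in> sqi M \<Longrightarrow> g \<in> sqi M \<Longrightarrow> (\<lambda>x. f x - g x) \<in> sqi M"
  using sqi_lincomb[of g M f "-1"] by simp

lemma sqi_sum: "(\<And>i. i \<in> I \<Longrightarrow> f i \<in> sqi M) \<Longrightarrow> (\<lambda>x. \<Sum>i\<in>I. c i * f i x) \<in> sqi M"
  by (induction I rule: infinite_finite_induct) (auto intro: sqi_lincomb)

lemma ip_lincomb:
  assumes "f \<in> sqi M" "g \<in> sqi M" "h \<in> sqi M"
  shows "ip M (\<lambda>x. c * f x + g x) h = c * ip M f h + ip M g h"
proof -
  have "ip M (\<lambda>x. c * f x + g x) h = (\<integral>x. c * (f x * cnj (h x)) + g x * cnj (h x) \<partial>M)"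
    by (simp add: ip_def algebra_simps)
  also have "\<dots> = c * ip M f h + ip M g h"
    using assms by (simp add: ip_def sqi_prod_integrable)
  finally show ?thesis .
qed

lemma ip_cnj: "ip M f g = cnj (ip M g f)"
  unfolding ip_def by (subst Bochner_Integration.integral_cnj[symmetric]) (simp add: mult.commute)

lemma ip_diff: "f \<in> sqi M \<Longrightarrow> g \<in> sqi M \<Longrightarrow> h \<in> sqi M \<Longrightarrow> ip M (\<lambda>x. f x - g x) h = ip M f h - ip M g h"
  using ip_lincomb[of g M f h "-1"] by simp

lemma ip_scale: "ip M (\<lambda>x. c * f x) h = c * ip M f h"
  by (simp add: ip_def mult.assoc)

lemma ip_scale_right: "ip M f (\<lambda>x. c * h x) = cnj c * ip M f h"
  using ip_cnj[of M f "\<lambda>x. c * h x"] ip_cnj[of M f h] by (simp add: ip_scale)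

lemma ip_diff_right: "f \<in> sqi M \<Longrightarrow> g \<in> sqi M \<Longrightarrow> h \<in> sqi M \<Longrightarrow> ip M h (\<lambda>x. f x - g x) = ip M h f - ip M h g"
  using ip_cnj[of M h "\<lambda>x. f x - g x"] ip_cnj[of M h f] ip_cnj[of M h g] by (simp add: ip_diff)

lemma ip_sum: "(\<And>i. i \<in> I \<Longrightarrow> f i \<in> sqi M) \<Longrightarrow> h \<in> sqi M \<Longrightarrow> ip M (\<lambda>x. \<Sum>i\<in>I. c i * f i x) h = (\<Sum>i\<in>I. c i * ip M (f i) h)"
proof (induction I rule: infinite_finite_induct)
  case (insert i I)
  then show ?case using ip_lincomb[of "f i" M "\<lambda>x. \<Sum>i\<in>I. c i * f i x" h "c i"] by (simp add: sqi_sum)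
qed (simp_all add: ip_def)

lemma ip_sum_right: "(\<And>i. i \<in> I \<Longrightarrow> f i \<in> sqi M) \<Longrightarrow> h \<in> sqi M \<Longrightarrow> ip M h (\<lambda>x. \<Sum>i\<in>I. c i * f i x) = (\<Sum>i\<in>I. cnj (c i) * ip M h (f i))"
  using ip_cnj[of M h "\<lambda>x. \<Sum>i\<in>I. c i * f i x"] ip_cnj[of M h] by (simp add: ip_sum)

lemma ip_self: "ip M f f = of_real (nsq M f)"
  unfolding ip_def nsq_def by (simp add: complex_norm_square[symmetric] flip: integral_complex_of_real of_real_power)

lemma nsq_nonneg [simp]: "0 \<le> nsq M f"
  by (simp add: nsq_def)

lemma nsq_diff_commute: "nsq M (\<lambda>x. f x - g x) = nsq M (\<lambda>x. g x - f x)"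
  by (simp add: nsq_def norm_minus_commute)

lemma nsq_diff: assumes "f \<in> sqi M" "g \<in> sqi M"
  shows "nsq M (\<lambda>x. f x - c * g x) = nsq M f - 2 * Re (cnj c * ip M f g) + (cmod c)\<^sup>2 * nsq M g"
proof -
  have "complex_of_real (nsq M (\<lambda>x. f x - c * g x)) = ip M (\<lambda>x. f x - c * g x) (\<lambda>x. f x - c * g x)"
    by (rule ip_self[symmetric])
  also have "\<dots> = ip M f f - cnj c * ip M f g - (c * ip M g f - c * (cnj c * ip M g g))"
    using assms by (simp add: ip_diff ip_diff_right ip_scale ip_scale_right sqi_diff sqi_scale) (simp add: algebra_simps)
  also have "ip M g f = cnj (ip M f g)" by (rule ip_cnj)
  finally have "nsq M (\<lambda>x. f x - c * g x) = Re (ip M f f - cnj c * ip M f g - (c * cnj (ip M f g) - c * (cnj c * ip M g g)))"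
    by (metis Re_complex_of_real)
  then show ?thesis unfolding cmod_power2 by (simp add: ip_self power2_eq_square algebra_simps)
qed

lemma Cauchy_Schwarz: assumes "f \<in> sqi M" "g \<in> sqi M" shows "(cmod (ip M f g))\<^sup>2 \<le> nsq M f * nsq M g"
proof (cases "nsq M g = 0")
  case True
  define z where "z = ip M f g"
  have *: "0 \<le> nsq M f - 2 * t * (cmod (ip M f g))\<^sup>2" for t :: real
  proof -
    have "Re (cnj (of_real t * z) * z) = t * (cmod z)\<^sup>2"
      unfolding cmod_power2 by (simp add: power2_eq_square algebra_simps)
    then show ?thesis
      using nsq_diff[OF assms, of "of_real t * z"] nsq_nonneg[of M "\<lambda>x. f x - of_real t * z * g x"] True
      by (simp add: z_def)
  qed
  have "cmod (ip M f g) = 0"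
  proof (rule ccontr)
    assume "cmod (ip M f g) \<noteq> 0"
    \<comment> \<open>This value of t makes the right-hand side of the inequality equal to
      -1.\<close>
    then show False using *[of "(nsq M f + 1) / (2 * (cmod (ip M f g))\<^sup>2)"] by simp
  qed
  then show ?thesis using True by simp
next
  case False
  define c where "c = ip M f g / of_real (nsq M g)"
  have "0 \<le> nsq M f - 2 * Re (cnj c * ip M f g) + (cmod c)\<^sup>2 * nsq M g"
    using nsq_diff[OF assms, of c] nsq_nonneg by metis
  moreover have "Re (cnj c * ip M f g) = (cmod (ip M f g))\<^sup>2 / nsq M g"
    unfolding cmod_power2 by (simp add: c_def power2_eq_square add_divide_distrib)
  moreover have "(cmod c)\<^sup>2 * nsq M g = (cmod (ip M f g))\<^sup>2 / nsq M g"
    using False by (simp add: c_def norm_divide power_divide power2_eq_square)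
  ultimately have "(cmod (ip M f g))\<^sup>2 / nsq M g \<le> nsq M f" by simp
  then show ?thesis using False nsq_nonneg[of M g] by (simp add: divide_le_eq)
qed

lemma ip_cong_AE: assumes "f \<in> sqi M" "f' \<in> sqi M" "g \<in> sqi M" "AE x in M. f x = f' x" shows "ip M f g = ip M f' g"
proof -
  note [measurable] = assms(1-3)[THEN sqi_measurable]
  show ?thesis unfolding ip_def
  proof (intro integral_cong_AE)
    show "AE x in M. f x * cnj (g x) = f' x * cnj (g x)" using assms(4) by eventually_elim simp
  qed measurable
qed

section \<open>Completeness and orthogonal projection\<close>

lemma sqi_complete:
  assumes f: "\<And>k. f k \<in> sqi M" and C: "\<And>e. e > 0 \<Longrightarrow> \<exists>N. \<forall>m\<ge>N. \<forall>n\<ge>N. nsq M (\<lambda>x. f m x - f n x) < e"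
  obtains F where "F \<in> sqi M" "(\<lambda>k. nsq M (\<lambda>x. f k x - F x)) \<longlonglongrightarrow> 0"
proof -
  note fm [measurable] = sqi_measurable[OF f]
  have "\<exists>N. \<forall>m\<ge>N. \<forall>n\<ge>N. nsq M (\<lambda>x. f m x - f n x) < (1/4) ^ k" for k
    by (rule C) simp
  then obtain N where N: "\<And>k m n. m \<ge> N k \<Longrightarrow> n \<ge> N k \<Longrightarrow> nsq M (\<lambda>x. f m x - f n x) < (1/4) ^ k"
    by metis
  \<comment> \<open>Summing makes r monotone and at least N k; the summand k makes it tend to
    infinity.\<close>
  define r where "r k = (\<Sum>j\<le>k. N j) + k" for k
  have rN: "r k \<ge> N k" for k 
  proof -
    have "N k \<le> (\<Sum>j\<le>k. N j)" by (rule member_le_sum) auto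
    then show ?thesis by (simp add: r_def)
  qed
  have rmono: "r (Suc k) \<ge> r k" for k by (simp add: r_def)
  define d where "d k x = f (r (Suc k)) x - f (r k) x" for k x
  have dm [measurable]: "d k \<in> borel_measurable M" for k unfolding d_def by measurable
  have d_sqi: "d k \<in> sqi M" for k unfolding d_def by (intro sqi_diff f)
  have dn: "nsq M (d k) < (1/4) ^ k" for k
    unfolding d_def using rN[of k] rmono[of k] by (intro N) auto
  \<comment> \<open>The measure may be infinite, so the sum of the |d k| cannot be integrated
    directly. The weights 2^k are harmless against the bounds 4^-k, and 2 |d| \<le> 2^k |d|^2 + 2^-k
    recovers absolute summability at a point from the finiteness of H.\<close>
  define H where "H x = (\<Sum>k. ennreal (2 ^ k * (cmod (d k x))\<^sup>2))" for x
  have "(\<integral>\<^sup>+x. H x \<partial>M) = (\<Sum>k. \<integral>\<^sup>+x. ennreal (2 ^ k * (cmod (d k x))\<^sup>2) \<partial>M)"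
    unfolding H_def by (intro nn_integral_suminf) measurable
  also have "\<dots> = (\<Sum>k. ennreal (2 ^ k * nsq M (d k)))"
  proof (intro arg_cong[where f = suminf] ext)
    fix k show "(\<integral>\<^sup>+x. ennreal (2 ^ k * (cmod (d k x))\<^sup>2) \<partial>M) = ennreal (2 ^ k * nsq M (d k))"
      using sqi_integrable[OF d_sqi, of k] by (subst nn_integral_eq_integral) (auto simp: nsq_def)
  qed
  also have "\<dots> \<le> (\<Sum>k. ennreal ((1/2) ^ k))"
  proof (intro suminf_le ennreal_leI)
    fix k :: nat
    have "2 ^ k * nsq M (d k) \<le> 2 ^ k * (1/4) ^ k" using dn[of k] by simp
    also have "\<dots> = (1/2) ^ k" by (simp flip: power_mult_distrib)
    finally show "2 ^ k * nsq M (d k) \<le> (1/2) ^ k" .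
  qed auto
  also have "\<dots> = ennreal 2"
  proof (rule suminf_ennreal_eq)
    show "(\<lambda>k. (1/2) ^ k) sums (2::real)" using geometric_sums[of "1/2 :: real"] by simp
  qed simp
  also have "\<dots> < \<infinity>" by simp
  finally have Hf: "AE x in M. H x \<noteq> \<infinity>"
    by (intro nn_integral_PInf_AE) (auto simp: H_def)
  have conv: "convergent (\<lambda>k. f (r k) x)" if "H x \<noteq> \<infinity>" for x
  proof -
    have s1: "summable (\<lambda>k. 2 ^ k * (cmod (d k x))\<^sup>2)"
      using that by (intro summable_suminf_not_top) (auto simp: H_def)
    have s2: "summable (\<lambda>k. (1/2) ^ k :: real)" by (simp add: summable_geometric)
    have "summable (\<lambda>k. cmod (d k x))"
    proof (rule summable_comparison_test'[OF summable_add[OF s1 s2]])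
      fix k :: nat
      have "0 \<le> (cmod (d k x) * 2 ^ k - 1)\<^sup>2 * (1/2) ^ k" by simp
      also have "\<dots> = 2 ^ k * (cmod (d k x))\<^sup>2 - 2 * cmod (d k x) + (1/2) ^ k"
        by (simp add: power2_eq_square power_divide field_simps)
      finally show "norm (cmod (d k x)) \<le> 2 ^ k * (cmod (d k x))\<^sup>2 + (1/2) ^ k"
        by (simp) (smt (verit) norm_ge_zero)
    qed
    then have "summable (\<lambda>k. d k x)" by (rule summable_norm_cancel)
    then have "convergent (\<lambda>n. \<Sum>k<n. d k x)" by (simp add: summable_iff_convergent)
    moreover have "(\<Sum>k<n. d k x) = f (r n) x - f (r 0) x" for n
      unfolding d_def by (rule sum_lessThan_telescope)
    ultimately have "convergent (\<lambda>n. (f (r n) x - f (r 0) x) + f (r 0) x)"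
      by (intro convergent_add convergent_const) simp
    then show ?thesis by simp
  qed
  define F where "F x = lim (\<lambda>k. f (r k) x)" for x
  have Fm [measurable]: "F \<in> borel_measurable M" unfolding F_def by measurable
  have lim: "AE x in M. (\<lambda>k. f (r k) x) \<longlonglongrightarrow> F x"
    using Hf by eventually_elim (simp add: F_def conv convergent_LIMSEQ_iff[symmetric])
  \<comment> \<open>Fatou's lemma along the subsequence, for every index m from N k on and not only
    for those of the subsequence; so the whole sequence converges.\<close>
  have fatou: "(\<integral>\<^sup>+x. ennreal ((cmod (f m x - F x))\<^sup>2) \<partial>M) \<le> ennreal ((1/4) ^ k)" if m: "m \<ge> N k" for m k
  proof -
    have "(\<integral>\<^sup>+x. ennreal ((cmod (f m x - F x))\<^sup>2) \<partial>M) = (\<integral>\<^sup>+x. liminf (\<lambda>j. ennreal ((cmod (f m x - f (r j) x))\<^sup>2)) \<partial>M)"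
    proof (intro nn_integral_cong_AE)
      show "AE x in M. ennreal ((cmod (f m x - F x))\<^sup>2) = liminf (\<lambda>j. ennreal ((cmod (f m x - f (r j) x))\<^sup>2))"
        using lim
      proof eventually_elim
        case (elim x)
        then have "(\<lambda>j. ennreal ((cmod (f m x - f (r j) x))\<^sup>2)) \<longlonglongrightarrow> ennreal ((cmod (f m x - F x))\<^sup>2)"
          by (intro tendsto_ennrealI tendsto_intros)
        then show ?case by (intro lim_imp_Liminf[symmetric]) simp_all
      qed
    qed
    also have "\<dots> \<le> liminf (\<lambda>j. \<integral>\<^sup>+x. ennreal ((cmod (f m x - f (r j) x))\<^sup>2) \<partial>M)"
      by (intro nn_integral_liminf) measurable
    also have "\<dots> \<le> ennreal ((1/4) ^ k)"
    proof (intro Liminf_le)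
      show "\<forall>\<^sub>F j in sequentially. (\<integral>\<^sup>+x. ennreal ((cmod (f m x - f (r j) x))\<^sup>2) \<partial>M) \<le> ennreal ((1/4) ^ k)"
        using eventually_ge_at_top[of "N k"]
      proof eventually_elim
        case (elim j)
        have "j \<le> r j" by (simp add: r_def)
        then have "nsq M (\<lambda>x. f m x - f (r j) x) < (1/4) ^ k" using elim m by (intro N) auto
        then show ?case
          using sqi_integrable[OF sqi_diff[OF f f], of m "r j"] by (subst nn_integral_eq_integral) (auto simp: nsq_def intro!: ennreal_leI)
      qed
    qed simp
    finally show ?thesis .
  qed
  have diff_sqi: "(\<lambda>x. f m x - F x) \<in> sqi M" if "m \<ge> N 0" for m
    unfolding sqi_def using fatou[OF that]
    by (auto intro!: integrableI_bounded simp: le_less_trans)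
  have F: "F \<in> sqi M"
    using sqi_diff[OF f[of "N 0"] diff_sqi[OF order_refl]] by simp
  show ?thesis
  proof (rule that[OF F])
    show "(\<lambda>k. nsq M (\<lambda>x. f k x - F x)) \<longlonglongrightarrow> 0"
    proof (rule LIMSEQ_I)
      fix e :: real assume "e > 0"
      then obtain k where k: "(1/4::real) ^ k < e" using real_arch_pow_inv[of e "1/4"] by auto
      have "norm (nsq M (\<lambda>x. f m x - F x) - 0) < e" if "m \<ge> N k" for m
      proof -
        have s: "(\<lambda>x. f m x - F x) \<in> sqi M" by (intro sqi_diff f F)
        have "ennreal (nsq M (\<lambda>x. f m x - F x)) \<le> ennreal ((1/4) ^ k)"
          using fatou[OF that] sqi_integrable[OF s] by (subst (asm) nn_integral_eq_integral) (auto simp: nsq_def)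
        then show ?thesis using k by simp
      qed
      then show "\<exists>no. \<forall>n\<ge>no. norm (nsq M (\<lambda>x. f n x - F x) - 0) < e" by blast
    qed
  qed
qed

lemma ip_tendsto:
  assumes "\<And>k. s k \<in> sqi M" "F \<in> sqi M" "h \<in> sqi M" "(\<lambda>k. nsq M (\<lambda>x. s k x - F x)) \<longlonglongrightarrow> 0"
  shows "(\<lambda>k. ip M (s k) h) \<longlonglongrightarrow> ip M F h"
proof -
  have "(\<lambda>k. (cmod (ip M (s k) h - ip M F h))\<^sup>2) \<longlonglongrightarrow> 0"
  proof (rule tendsto_sandwich[OF _ _ tendsto_const])
    show "(\<lambda>k. nsq M (\<lambda>x. s k x - F x) * nsq M h) \<longlonglongrightarrow> 0"
      using tendsto_mult_right[OF assms(4), of "nsq M h"] by simp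
    show "\<forall>\<^sub>F k in sequentially. (cmod (ip M (s k) h - ip M F h))\<^sup>2 \<le> nsq M (\<lambda>x. s k x - F x) * nsq M h"
      using Cauchy_Schwarz[OF sqi_diff[OF assms(1,2)] assms(3)] assms by (simp add: ip_diff)
  qed simp
  then have "(\<lambda>k. cmod (ip M (s k) h - ip M F h)) \<longlonglongrightarrow> 0"
    using tendsto_real_sqrt[of "\<lambda>k. (cmod (ip M (s k) h - ip M F h))\<^sup>2" 0] by simp
  then show ?thesis by (simp add: tendsto_norm_zero_iff LIM_zero_iff)
qed

lemma sqi_projection:
  assumes V: "V \<subseteq> sqi M" "(\<lambda>_. 0) \<in> V" and lc: "\<And>f g c. f \<in> V \<Longrightarrow> g \<in> V \<Longrightarrow> (\<lambda>x. c * f x + g x) \<in> V"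
    and cl: "\<And>s g. (\<And>k. s k \<in> V) \<Longrightarrow> g \<in> sqi M \<Longrightarrow> (\<lambda>k. nsq M (\<lambda>x. s k x - g x)) \<longlonglongrightarrow> 0 \<Longrightarrow> g \<in> V"
    and g: "g \<in> sqi M"
  obtains p where "p \<in> V" "\<And>v. v \<in> V \<Longrightarrow> ip M (\<lambda>x. g x - p x) v = 0"
proof -
  define D where "D = (\<lambda>v. nsq M (\<lambda>x. g x - v x)) ` V"
  define d where "d = Inf D"
  have bdd: "bdd_below D" unfolding D_def by (intro bdd_belowI[of _ 0]) auto
  have dle: "d \<le> nsq M (\<lambda>x. g x - v x)" if "v \<in> V" for v
    unfolding d_def using that by (intro cInf_lower bdd) (auto simp: D_def)
  have "\<exists>v\<in>V. nsq M (\<lambda>x. g x - v x) < d + 1 / (real k + 1)" for k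
    using cInf_lessD[of D "d + 1 / (real k + 1)"] V(2) by (fastforce simp: D_def d_def)
  then obtain v where v: "\<And>k. v k \<in> V" "\<And>k. nsq M (\<lambda>x. g x - v k x) < d + 1 / (real k + 1)" by metis
  have vs: "v k \<in> sqi M" for k using v(1) V(1) by auto
  have par: "nsq M (\<lambda>x. v m x - v n x) \<le> 2 / (real m + 1) + 2 / (real n + 1)" for m n
  proof -
    \<comment> \<open>The midpoint competes for the infimum, so the parallelogram identity bounds
      the distance between two near-minimisers.\<close>
    define w where "w x = (1/2) * v m x + (1/2) * v n x" for x
    have "(\<lambda>x. (1/2) * v n x) \<in> V" using lc[OF v(1)[of n] V(2), of "1/2"] by simp
    then have w: "w \<in> V" unfolding w_def using lc[OF v(1)] by blast
    have ws: "w \<in> sqi M" using w V(1) by auto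
    have "(cmod (v m x - v n x))\<^sup>2 = 2 * (cmod (g x - v m x))\<^sup>2 + 2 * (cmod (g x - v n x))\<^sup>2 - 4 * (cmod (g x - w x))\<^sup>2" for x
      unfolding cmod_power2 w_def by (simp add: power2_eq_square field_simps)
    then have "nsq M (\<lambda>x. v m x - v n x) = (\<integral>x. 2 * (cmod (g x - v m x))\<^sup>2 + 2 * (cmod (g x - v n x))\<^sup>2 - 4 * (cmod (g x - w x))\<^sup>2 \<partial>M)"
      by (simp add: nsq_def)
    also have "\<dots> = 2 * nsq M (\<lambda>x. g x - v m x) + 2 * nsq M (\<lambda>x. g x - v n x) - 4 * nsq M (\<lambda>x. g x - w x)"
      unfolding nsq_def using sqi_integrable[OF sqi_diff[OF g vs]] sqi_integrable[OF sqi_diff[OF g ws]] by simp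
    finally show ?thesis using v(2)[of m] v(2)[of n] dle[OF w] by simp
  qed
  obtain p where p: "p \<in> sqi M" "(\<lambda>k. nsq M (\<lambda>x. v k x - p x)) \<longlonglongrightarrow> 0"
  proof (rule sqi_complete[OF vs])
    fix e :: real assume "e > 0"
    then obtain N where N: "inverse (real (Suc N)) < e / 4" using reals_Archimedean[of "e/4"] by auto
    have "nsq M (\<lambda>x. v m x - v n x) < e" if "m \<ge> N" "n \<ge> N" for m n
    proof -
      have "1 / (real k + 1) < e / 4" if "k \<ge> N" for k
      proof -
        have "1 / (real k + 1) \<le> 1 / (real N + 1)" using that by (intro divide_left_mono) auto
        then show ?thesis using N by (simp add: inverse_eq_divide add.commute)
      qed
      from this[OF that(1)] this[OF that(2)] show ?thesis using par[of m n] by simp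
    qed
    then show "\<exists>N. \<forall>m\<ge>N. \<forall>n\<ge>N. nsq M (\<lambda>x. v m x - v n x) < e" by blast
  qed
  have pV: "p \<in> V" using cl[OF v(1) p] .
  show ?thesis
  proof (rule that[OF pV])
    fix u assume u: "u \<in> V"
    then have us: "u \<in> sqi M" using V(1) by auto
    define z where "z = ip M (\<lambda>x. g x - p x) u"
    have lim: "(\<lambda>k. ip M (\<lambda>x. g x - v k x) u) \<longlonglongrightarrow> z"
      unfolding z_def
    proof (rule ip_tendsto[OF sqi_diff[OF g vs] sqi_diff[OF g p(1)] us])
      show "(\<lambda>k. nsq M (\<lambda>x. g x - v k x - (g x - p x))) \<longlonglongrightarrow> 0"
        using p(2) by (simp add: nsq_diff_commute[of M p])
    qed
    have ineq: "2 * Re (cnj c * z) \<le> (cmod c)\<^sup>2 * nsq M u" for c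
    proof (rule LIMSEQ_le)
      show "(\<lambda>k. 2 * Re (cnj c * ip M (\<lambda>x. g x - v k x) u)) \<longlonglongrightarrow> 2 * Re (cnj c * z)"
        by (intro tendsto_intros lim)
      show "(\<lambda>k. 1 / (real k + 1) + (cmod c)\<^sup>2 * nsq M u) \<longlonglongrightarrow> (cmod c)\<^sup>2 * nsq M u"
        using tendsto_add[OF LIMSEQ_inverse_real_of_nat tendsto_const[of "(cmod c)\<^sup>2 * nsq M u"]]
        by (simp add: inverse_eq_divide add.commute)
      have "2 * Re (cnj c * ip M (\<lambda>x. g x - v k x) u) \<le> 1 / (real k + 1) + (cmod c)\<^sup>2 * nsq M u" for k
      proof -
        have "(\<lambda>x. c * u x + v k x) \<in> V" by (rule lc[OF u v(1)])
        from dle[OF this] have "d \<le> nsq M (\<lambda>x. g x - v k x - c * u x)" by (simp add: algebra_simps)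
        then show ?thesis using nsq_diff[OF sqi_diff[OF g vs[of k]] us, of c] v(2)[of k] by simp
      qed
      then show "\<exists>N. \<forall>k\<ge>N. 2 * Re (cnj c * ip M (\<lambda>x. g x - v k x) u) \<le> 1 / (real k + 1) + (cmod c)\<^sup>2 * nsq M u" by blast
    qed
    \<comment> \<open>With c = t * z the inequality becomes quadratic in t; the 1 in the denominator
      keeps \<open>t * nsq M u\<close> at most 1 even when u has norm 0.\<close>
    define t where "t = 1 / (nsq M u + 1)"
    have t: "t > 0" "t * nsq M u \<le> 1" 
  proof -
    have "nsq M u + 1 > 0" using nsq_nonneg[of M u] by linarith
    then show "t > 0" "t * nsq M u \<le> 1" by (simp_all add: t_def divide_simps)
  qed
    have "Re (cnj (of_real t * z) * z) = t * (cmod z)\<^sup>2"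
      unfolding cmod_power2 by (simp add: power2_eq_square algebra_simps)
    then have "2 * t * (cmod z)\<^sup>2 \<le> t\<^sup>2 * (cmod z)\<^sup>2 * nsq M u"
      using ineq[of "of_real t * z"] by (simp add: norm_mult power_mult_distrib)
    also have "\<dots> = t * (cmod z)\<^sup>2 * (t * nsq M u)" by (simp add: power2_eq_square)
    also have "\<dots> \<le> t * (cmod z)\<^sup>2 * 1" using t by (intro mult_left_mono) auto
    finally have "t * (cmod z)\<^sup>2 \<le> 0" by simp
    then have "z = 0" using t(1) by (simp add: mult_le_0_iff)
    then show "ip M (\<lambda>x. g x - p x) u = 0" by (simp add: z_def)
  qed
qed

section \<open>Orthonormal systems and the identification with l2\<close>

lemma nsq_orthonormal_sum:
  assumes "finite I" "\<And>i. i \<in> I \<Longrightarrow> e i \<in> sqi M" "\<And>i j. i \<in> I \<Longrightarrow> j \<in> I \<Longrightarrow> ip M (e i) (e j) = (if i = j then 1 else 0)"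
  shows "nsq M (\<lambda>x. \<Sum>i\<in>I. c i * e i x) = (\<Sum>i\<in>I. (cmod (c i))\<^sup>2)"
proof -
  have "complex_of_real (nsq M (\<lambda>x. \<Sum>i\<in>I. c i * e i x)) = (\<Sum>i\<in>I. c i * (\<Sum>j\<in>I. cnj (c j) * ip M (e i) (e j)))"
    unfolding ip_self[symmetric] using assms by (simp add: ip_sum ip_sum_right sqi_sum)
  also have "\<dots> = (\<Sum>i\<in>I. c i * cnj (c i))"
  proof (intro sum.cong refl)
    fix i assume i: "i \<in> I"
    have "(\<Sum>j\<in>I. cnj (c j) * ip M (e i) (e j)) = (\<Sum>j\<in>I. if i = j then cnj (c i) else 0)"
      using i assms(3) by (intro sum.cong) auto
    then show "c i * (\<Sum>j\<in>I. cnj (c j) * ip M (e i) (e j)) = c i * cnj (c i)" using i assms(1) by simp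
  qed
  also have "\<dots> = complex_of_real (\<Sum>i\<in>I. (cmod (c i))\<^sup>2)" by (simp add: complex_norm_square[symmetric])
  finally show ?thesis using of_real_eq_iff by blast
qed

lemma Bessel:
  assumes I: "finite I" "\<And>i. i \<in> I \<Longrightarrow> e i \<in> sqi M" "\<And>i j. i \<in> I \<Longrightarrow> j \<in> I \<Longrightarrow> ip M (e i) (e j) = (if i = j then 1 else 0)"
    and f: "f \<in> sqi M"
  shows "(\<Sum>i\<in>I. (cmod (ip M f (e i)))\<^sup>2) \<le> nsq M f"
proof -
  define g where "g x = (\<Sum>i\<in>I. ip M f (e i) * e i x)" for x
  have g: "g \<in> sqi M" unfolding g_def by (intro sqi_sum I)
  have "ip M f g = (\<Sum>i\<in>I. cnj (ip M f (e i)) * ip M f (e i))"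
    unfolding g_def using I f by (simp add: ip_sum_right)
  also have "\<dots> = complex_of_real (\<Sum>i\<in>I. (cmod (ip M f (e i)))\<^sup>2)" by (simp add: complex_norm_square[symmetric] mult.commute[of "cnj _"])
  finally have 1: "ip M f g = complex_of_real (\<Sum>i\<in>I. (cmod (ip M f (e i)))\<^sup>2)" .
  have 2: "nsq M g = (\<Sum>i\<in>I. (cmod (ip M f (e i)))\<^sup>2)"
    unfolding g_def by (rule nsq_orthonormal_sum[OF I])
  show ?thesis using nsq_diff[OF f g, of 1] nsq_nonneg[of M "\<lambda>x. f x - 1 * g x"] 1 2 by simp
qed

definition onb :: "'a measure \<Rightarrow> (nat \<Rightarrow> 'a \<Rightarrow> complex) \<Rightarrow> bool" where
  "onb M b \<longleftrightarrow> (\<forall>n. b n \<in> sqi M) \<and> (\<forall>m n. ip M (b m) (b n) = (if m = n then 1 else 0)) \<and>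
    (\<forall>f\<in>sqi M. (\<forall>n. ip M f (b n) = 0) \<longrightarrow> (AE x in M. f x = 0))"

text \<open>Surjectivity of the coefficient map onto l2; \<open>onb_coord_l2\<close> and
  \<open>onb_unique\<close> supply its range and its injectivity modulo null functions.\<close>

lemma onb_partial_sums:
  assumes "onb M b" "a \<in> l2"
  obtains F where "F \<in> sqi M" "\<And>n. ip M F (b n) = a n" "(\<lambda>N. nsq M (\<lambda>x. (\<Sum>n<N. a n * b n x) - F x)) \<longlonglongrightarrow> 0"
proof -
  have b: "b n \<in> sqi M" and o: "ip M (b m) (b n) = (if m = n then 1 else 0)" for m n
    using assms(1) by (auto simp: onb_def)
  define S where "S N x = (\<Sum>n<N. a n * b n x)" for N x
  have S: "S N \<in> sqi M" for N unfolding S_def by (intro sqi_sum b)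
  have sm: "summable (\<lambda>n. (cmod (a n))\<^sup>2)" using assms(2) by (simp add: l2_def)
  have le: "nsq M (\<lambda>x. S m x - S n x) = (\<Sum>k\<in>{n..<m}. (cmod (a k))\<^sup>2)" if "n \<le> m" for m n
  proof -
    have "{..<m} = {..<n} \<union> {n..<m}" using that by auto
    then have "S m x - S n x = (\<Sum>k\<in>{n..<m}. a k * b k x)" for x
      unfolding S_def by (simp add: sum.union_disjoint ivl_disj_int_one)
    then show ?thesis using nsq_orthonormal_sum[of "{n..<m}" b M a] b o by simp
  qed
  obtain F where F: "F \<in> sqi M" "(\<lambda>k. nsq M (\<lambda>x. S k x - F x)) \<longlonglongrightarrow> 0"
  proof (rule sqi_complete[OF S])
    fix e :: real assume "e > 0"
    then obtain N where N: "\<And>m n. m \<ge> N \<Longrightarrow> norm (\<Sum>k\<in>{m..<n}. (cmod (a k))\<^sup>2) < e"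
      using sm unfolding summable_Cauchy by blast
    have *: "nsq M (\<lambda>x. S m x - S n x) < e" if "n \<ge> N" "n \<le> m" for m n
      using N[OF that(1), of m] le[OF that(2)] by (simp add: sum_nonneg)
    have "nsq M (\<lambda>x. S m x - S n x) < e" if "m \<ge> N" "n \<ge> N" for m n
      using *[of n m] *[of m n] that nsq_diff_commute[of M "S m" "S n"] by (cases "n \<le> m") auto
    then show "\<exists>N. \<forall>m\<ge>N. \<forall>n\<ge>N. nsq M (\<lambda>x. S m x - S n x) < e" by blast
  qed
  have "ip M F (b n) = a n" for n
  proof (rule LIMSEQ_unique[OF ip_tendsto[OF S F(1) b F(2)]])
    have "ip M (S N) (b n) = a n" if "N > n" for N
    proof -
      have "ip M (S N) (b n) = (\<Sum>k<N. a k * ip M (b k) (b n))"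
        unfolding S_def by (intro ip_sum b)
      also have "\<dots> = (\<Sum>k<N. if k = n then a n else 0)" by (intro sum.cong) (auto simp: o)
      finally show ?thesis using that by simp
    qed
    then show "(\<lambda>k. ip M (S k) (b n)) \<longlonglongrightarrow> a n"
      by (intro tendsto_eventually) (auto intro: eventually_mono[OF eventually_gt_at_top[of n]])
  qed
  then show ?thesis using that F by (simp add: S_def)
qed

lemma onb_coord_l2: assumes "onb M b" "f \<in> sqi M" shows "(\<lambda>n. ip M f (b n)) \<in> l2"
proof -
  have "(\<Sum>n<N. (cmod (ip M f (b n)))\<^sup>2) \<le> nsq M f" for N
    using assms by (intro Bessel) (auto simp: onb_def)
  then show ?thesis unfolding l2_def by (auto intro!: bounded_imp_summable[where B = "nsq M f"])
      (metis lessThan_Suc_atMost)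
qed

lemma onb_unique:
  assumes "onb M b" "f \<in> sqi M" "g \<in> sqi M" "\<And>n. ip M f (b n) = ip M g (b n)" shows "AE x in M. f x = g x"
proof -
  have "ip M (\<lambda>x. f x - g x) (b n) = 0" for n
    using assms by (subst ip_diff) (auto simp: onb_def)
  then have "AE x in M. f x - g x = 0"
    using assms(1) sqi_diff[OF assms(2,3)] unfolding onb_def by blast
  then show ?thesis by eventually_elim simp
qed

lemma onb_Parseval:
  assumes "onb M b" "f \<in> sqi M" "g \<in> sqi M"
  shows "l2_inner (\<lambda>n. ip M f (b n)) (\<lambda>n. ip M g (b n)) = ip M f g"
proof -
  have b: "b n \<in> sqi M" for n using assms(1) by (auto simp: onb_def)
  obtain F where F: "F \<in> sqi M" "\<And>n. ip M F (b n) = ip M f (b n)"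
    "(\<lambda>N. nsq M (\<lambda>x. (\<Sum>n<N. ip M f (b n) * b n x) - F x)) \<longlonglongrightarrow> 0"
    using onb_partial_sums[OF assms(1) onb_coord_l2[OF assms(1,2)]] by blast
  have "(\<lambda>N. ip M (\<lambda>x. \<Sum>n<N. ip M f (b n) * b n x) g) \<longlonglongrightarrow> ip M F g"
    by (intro ip_tendsto sqi_sum b F assms)
  moreover have "ip M (\<lambda>x. \<Sum>n<N. ip M f (b n) * b n x) g = (\<Sum>n<N. ip M f (b n) * cnj (ip M g (b n)))" for N
  proof -
    have "ip M (b n) g = cnj (ip M g (b n))" for n by (rule ip_cnj)
    then show ?thesis by (simp add: ip_sum b assms)
  qed
  ultimately have "(\<lambda>n. ip M f (b n) * cnj (ip M g (b n))) sums ip M F g" by (simp add: sums_def)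
  moreover have "ip M F g = ip M f g"
    using onb_unique[OF assms(1) F(1) assms(2) F(2)] F(1) assms by (intro ip_cong_AE)
  ultimately show ?thesis by (simp add: l2_inner_def sums_iff)
qed

text \<open>Lets the projection theorem for \<open>sqi\<close> produce orthogonal vectors in l2 as
  well.\<close>

lemma l2_eq_sqi: "l2 = sqi (count_space UNIV)"
  by (auto simp: l2_def sqi_def integrable_count_space_nat_iff)

lemma l2_inner_eq_ip: assumes "f \<in> l2" "g \<in> l2" shows "l2_inner f g = ip (count_space UNIV) f g"
  using sqi_prod_integrable[of f "count_space UNIV" g] assms
  by (simp add: l2_eq_sqi l2_inner_def ip_def integral_count_space_nat)

lemma l2_norm_eq_nsq: assumes "f \<in> l2" shows "l2_norm f = sqrt (nsq (count_space UNIV) f)"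
  using sqi_integrable[of f "count_space UNIV"] assms
  by (simp add: l2_eq_sqi l2_norm_def nsq_def integral_count_space_nat)

lemma closed_l2_subspace_orthogonal:
  assumes V: "closed_l2_subspace V" and ne: "V \<noteq> l2"
  obtains g where "g \<in> l2" "g \<noteq> (\<lambda>_. 0)" "\<And>v. v \<in> V \<Longrightarrow> l2_inner v g = 0"
proof -
  let ?C = "count_space UNIV :: nat measure"
  have sub: "V \<subseteq> sqi ?C" using V by (simp add: closed_l2_subspace_def l2_eq_sqi)
  obtain h where h: "h \<in> l2" "h \<notin> V" using V ne by (auto simp: closed_l2_subspace_def)
  obtain p where p: "p \<in> V" "\<And>v. v \<in> V \<Longrightarrow> ip ?C (\<lambda>x. h x - p x) v = 0"
  proof (rule sqi_projection[of V ?C h])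
    show "(\<lambda>x. c * f x + g x) \<in> V" if "f \<in> V" "g \<in> V" for f g c using that V by (simp add: closed_l2_subspace_def)
    show "g \<in> V" if s: "\<And>k. s k \<in> V" and g: "g \<in> sqi ?C" and lim: "(\<lambda>k. nsq ?C (\<lambda>x. s k x - g x)) \<longlonglongrightarrow> 0" for s g
    proof -
      have "(\<lambda>n. s k n - g n) \<in> l2" for k unfolding l2_eq_sqi using s sub g by (intro sqi_diff) auto
      then have "(\<lambda>k. l2_norm (\<lambda>n. s k n - g n)) \<longlonglongrightarrow> 0"
        using tendsto_real_sqrt[OF lim] by (simp add: l2_norm_eq_nsq)
      then show ?thesis using V s g unfolding closed_l2_subspace_def l2_eq_sqi by blast
    qed
  qed (use sub V h in \<open>auto simp: closed_l2_subspace_def l2_eq_sqi\<close>)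
  define g where "g x = h x - p x" for x
  have ps: "p \<in> sqi ?C" using p(1) sub by auto
  have g: "g \<in> l2" using h(1) ps unfolding g_def l2_eq_sqi by (intro sqi_diff)
  show ?thesis
  proof (rule that[OF g])
    show "g \<noteq> (\<lambda>_. 0)"
    proof
      assume "g = (\<lambda>_. 0)"
      then have "h = p" by (auto simp: g_def fun_eq_iff)
      then show False using h p by simp
    qed
    fix v assume v: "v \<in> V"
    then have "v \<in> l2" using sub by (auto simp: l2_eq_sqi)
    then have "l2_inner v g = cnj (ip ?C g v)" using l2_inner_eq_ip[of v g] g ip_cnj[of ?C v g] by simp
    then show "l2_inner v g = 0" using p(2)[OF v] unfolding g_def[abs_def] by simp
  qed
qed

section \<open>Characters\<close>

definition chr :: "real^'n \<Rightarrow> real^'n \<Rightarrow> complex" where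
  "chr k u = cis (2 * pi * (k \<bullet> u))"

lemma norm_chr [simp]: "cmod (chr k u) = 1"
  by (simp add: chr_def)

lemma chr_0 [simp]: "chr 0 u = 1" by (simp add: chr_def)

lemma chr_add: "chr (k + l) u = chr k u * chr l u"
  by (simp add: chr_def cis_mult inner_add_left algebra_simps)

lemma chr_cnj: "cnj (chr k u) = chr (- k) u"
  by (simp add: chr_def cis_cnj)

lemma chr_measurable [measurable]: "chr k \<in> borel_measurable borel"
  unfolding chr_def by (intro borel_measurable_continuous_onI continuous_intros)

text \<open>Half-open, so that the translates by integer points partition the space.\<close>

definition cube :: "real^'n \<Rightarrow> (real^'n) set" where
  "cube c = {u. \<forall>b\<in>Basis. c \<bullet> b \<le> u \<bullet> b \<and> u \<bullet> b < c \<bullet> b + 1}"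

lemma mem_cube: "u \<in> cube c \<longleftrightarrow> (\<forall>i. c $ i \<le> u $ i \<and> u $ i < c $ i + 1)"
  by (simp add: cube_def Basis_vec_def inner_axis)

lemma cube_indicator: "indicator (cube c) u = (\<Prod>b\<in>Basis. indicator {c \<bullet> b..<c \<bullet> b + 1} (u \<bullet> b) :: 'a::{comm_semiring_1})"
proof (cases "u \<in> cube c")
  case True
  then show ?thesis by (auto simp: cube_def intro!: prod.neutral[symmetric])
next
  case False
  then obtain b where "b \<in> Basis" "indicator {c \<bullet> b..<c \<bullet> b + 1} (u \<bullet> b) = (0::'a)"
    by (auto simp: cube_def indicator_def)
  then have "(\<Prod>b\<in>Basis. indicator {c \<bullet> b..<c \<bullet> b + 1} (u \<bullet> b) :: 'a) = 0"
    by (intro prod_zero) auto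
  then show ?thesis using False by simp
qed

lemma cube_sets [measurable]: "cube c \<in> sets borel"
proof -
  have "cube c = (\<Inter>b\<in>Basis. {u. c \<bullet> b \<le> u \<bullet> b} \<inter> {u. u \<bullet> b < c \<bullet> b + 1})"
    by (auto simp: cube_def)
  also have "\<dots> \<in> sets borel"
    by (intro sets.countable_INT' sets.Int borel_closed borel_open closed_Collect_le open_Collect_less continuous_intros)
       (auto simp: countable_finite)
  finally show ?thesis .
qed

section \<open>Integrals of characters over cubes\<close>

lemma lborel_integral_prod:
  fixes f :: "real^'n \<Rightarrow> real \<Rightarrow> complex"
  assumes f: "\<And>b. b \<in> Basis \<Longrightarrow> integrable lborel (f b)"
  shows "integrable lborel (\<lambda>u. \<Prod>b\<in>Basis. f b (u \<bullet> b))" "(\<integral>u. (\<Prod>b\<in>Basis. f b (u \<bullet> b)) \<partial>lborel) = (\<Prod>b\<in>Basis. \<integral>x. f b x \<partial>lborel)"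
proof -
  interpret product_sigma_finite "\<lambda>_::real^'n. lborel :: real measure" ..
  have T: "(\<lambda>g. \<Sum>b\<in>Basis. g b *\<^sub>R b) \<in> measurable (\<Pi>\<^sub>M b\<in>(Basis :: (real^'n) set). lborel) borel" by measurable
  have e: "(\<Prod>b\<in>Basis. f b ((\<Sum>b'\<in>Basis. g b' *\<^sub>R b') \<bullet> b)) = (\<Prod>b\<in>Basis. f b (g b))" for g :: "real^'n \<Rightarrow> real"
    by (intro prod.cong refl) (simp add: inner_sum_left inner_Basis if_distrib cong: if_cong)
  have m: "f b \<in> borel_measurable borel" if "b \<in> Basis" for b using f[OF that] by auto
  have meas: "(\<lambda>u. \<Prod>b\<in>Basis. f b (u \<bullet> b)) \<in> borel_measurable borel"
    by (intro borel_measurable_prod measurable_compose[OF _ m]) auto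
  have "integrable (\<Pi>\<^sub>M b\<in>Basis. lborel) (\<lambda>g. \<Prod>b\<in>Basis. f b (g b))"
    by (intro product_integrable_prod f) auto
  then show "integrable lborel (\<lambda>u. \<Prod>b\<in>Basis. f b (u \<bullet> b))"
    by (subst lborel_eq) (simp add: integrable_distr_eq[OF T meas] e)
  show "(\<integral>u. (\<Prod>b\<in>Basis. f b (u \<bullet> b)) \<partial>lborel) = (\<Prod>b\<in>Basis. \<integral>x. f b x \<partial>lborel)"
    by (subst lborel_eq) (simp add: integral_distr[OF T meas] e product_integral_prod f)
qed

lemma integral_half_open_cis:
  fixes c :: real and k :: int
  shows "integrable lborel (\<lambda>x. indicator {c..<c+1} x * cis (2 * pi * (of_int k * x)))"
    and "(\<integral>x. indicator {c..<c+1} x * cis (2 * pi * (of_int k * x)) \<partial>lborel) = (if k = 0 then 1 else 0)"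
proof -
  let ?f = "\<lambda>x. cis (2 * pi * (of_int k * x))"
  have cont: "continuous_on S ?f" for S by (intro continuous_intros)
  have fm [measurable]: "?f \<in> borel_measurable borel" by (intro borel_measurable_continuous_onI cont)
  have i: "integrable lborel (\<lambda>x. indicator {c..c+1} x *\<^sub>R ?f x)"
    using borel_integrable_compact[of "{c..c+1}" ?f] cont by simp
  have ae: "AE x in lborel. indicator {c..c+1} x *\<^sub>R ?f x = indicator {c..<c+1} x * ?f x"
    using AE_lborel_singleton[of "c+1"] by eventually_elim (auto simp: indicator_def)
  show "integrable lborel (\<lambda>x. indicator {c..<c+1} x * ?f x)"
    by (rule integrable_cong_AE_imp[OF i _ ae]) measurable
  have eq: "(\<integral>x. indicator {c..<c+1} x * ?f x \<partial>lborel) = (\<integral>x. indicator {c..c+1} x *\<^sub>R ?f x \<partial>lborel)"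
    using ae by (intro integral_cong_AE) (measurable, auto)
  show "(\<integral>x. indicator {c..<c+1} x * ?f x \<partial>lborel) = (if k = 0 then 1 else 0)"
  proof (cases "k = 0")
    case True
    have "(\<integral>x. indicator {c..c+1} x *\<^sub>R (1::complex) \<partial>lborel) = of_real (c + 1) - of_real c"
      by (intro integral_FTC_atLeastAtMost) (auto intro!: derivative_eq_intros simp: has_vector_derivative_def scaleR_conv_of_real)
    then show ?thesis unfolding eq using True by simp
  next
    case False
    let ?F = "\<lambda>x. cis (2 * pi * (of_int k * x)) / (2 * pi * of_int k * \<i>)"
    have F: "(?F has_vector_derivative ?f x) (at x within S)" for x S
    proof -
      define A where "A = 2 * pi * of_int k * \<i>"
      have e: "cis (2 * pi * (of_int k * x)) = exp (x *\<^sub>R A)" for x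
        by (simp add: cis_conv_exp A_def scaleR_conv_of_real mult_ac)
      have "A \<noteq> 0" using False by (simp add: A_def)
      then show ?thesis
        using has_vector_derivative_divide[OF exp_scaleR_has_vector_derivative_right[of A x S], of A]
        unfolding e A_def[symmetric] by simp
    qed
    have "(\<integral>x. indicator {c..c+1} x *\<^sub>R ?f x \<partial>lborel) = ?F (c + 1) - ?F c"
      by (intro integral_FTC_atLeastAtMost F cont) auto
    also have "cis (2 * pi * (of_int k * (c + 1))) = cis (2 * pi * (of_int k * c)) * cis (2 * pi * of_int k)"
      by (simp add: cis_mult algebra_simps)
    also have "cis (2 * pi * of_int k) = 1" using cis_multiple_2pi[of "of_int k"] by simp
    finally show ?thesis unfolding eq using False by simp
  qed
qed

definition pt :: "('n \<Rightarrow> int) \<Rightarrow> real^'n" where "pt m = (\<chi> i. of_int (m i))"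

lemma pt_add: "pt k + pt l = pt (\<lambda>i. k i + l i)" and pt_minus: "- pt k = pt (\<lambda>i. - k i)" and pt_0: "pt (\<lambda>_. 0) = 0"
  by (simp_all add: pt_def vec_eq_iff)

lemma pt_diff: "pt k - pt l = pt (\<lambda>i. k i - l i)"
  by (simp add: pt_def vec_eq_iff)

lemma chr_cube_integral:
  fixes c :: "real^'n"
  shows "integrable lborel (\<lambda>u. indicator (cube c) u * chr (pt k) u)"
    and "(\<integral>u. indicator (cube c) u * chr (pt k) u \<partial>lborel) = (if k = (\<lambda>_. 0) then 1 else 0)"
proof -
  define f where "f b x = indicator {c \<bullet> b..<c \<bullet> b + 1} x * cis (2 * pi * ((pt k \<bullet> b) * x))" for b :: "real^'n" and x
  have ki: "\<exists>j. pt k \<bullet> b = of_int j" if "b \<in> Basis" for b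
    using that by (auto simp: Basis_vec_def inner_axis pt_def)
  have e: "indicator (cube c) u * chr (pt k) u = (\<Prod>b\<in>Basis. f b (u \<bullet> b))" for u
  proof -
    have "chr (pt k) u = (\<Prod>b\<in>Basis. cis (2 * pi * ((pt k \<bullet> b) * (u \<bullet> b))))"
      unfolding chr_def cis_conv_exp euclidean_inner[of "pt k" u]
      by (simp add: sum_distrib_left exp_sum of_real_sum[symmetric] del: of_real_sum) (simp add: sum_distrib_left exp_sum)
    then show ?thesis by (simp add: f_def cube_indicator prod.distrib)
  qed
  have fi: "integrable lborel (f b)" if "b \<in> Basis" for b
  proof -
    have "\<exists>j. pt k \<bullet> b = of_int j" by (rule ki[OF that])
    then obtain j where j: "pt k \<bullet> b = of_int j" by blast
    show ?thesis unfolding f_def[abs_def] j by (rule integral_half_open_cis(1))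
  qed
  show "integrable lborel (\<lambda>u. indicator (cube c) u * chr (pt k) u)"
    unfolding e by (rule lborel_integral_prod(1)) (rule fi)
  have "(\<integral>u. indicator (cube c) u * chr (pt k) u \<partial>lborel) = (\<Prod>b\<in>Basis. \<integral>x. f b x \<partial>lborel)"
    unfolding e by (rule lborel_integral_prod(2)) (rule fi)
  also have "\<dots> = (\<Prod>b\<in>Basis. if pt k \<bullet> b = 0 then 1 else 0)"
  proof (intro prod.cong refl)
    fix b :: "real^'n" assume "b \<in> Basis"
    then obtain j where j: "pt k \<bullet> b = of_int j" using ki by blast
    show "(\<integral>x. f b x \<partial>lborel) = (if pt k \<bullet> b = 0 then 1 else 0)"
      unfolding f_def j by (subst integral_half_open_cis(2)) simp
  qed
  also have "\<dots> = (if k = (\<lambda>_. 0) then 1 else 0)"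
  proof (cases "k = (\<lambda>_. 0)")
    case True then show ?thesis by (simp add: pt_0)
  next
    case False
    then obtain i where "k i \<noteq> 0" by auto
    then have "pt k \<bullet> axis i 1 \<noteq> 0" by (simp add: inner_axis pt_def)
    then show ?thesis using False by (auto intro!: prod_zero bexI[of _ "axis i 1"])
  qed
  finally show "(\<integral>u. indicator (cube c) u * chr (pt k) u \<partial>lborel) = (if k = (\<lambda>_. 0) then 1 else 0)" .
qed

text \<open>The Gabor system of the unit cube: the first component of p is the frequency, the second
  the position of the cube.\<close>

definition bas :: "('n \<Rightarrow> int) \<times> ('n \<Rightarrow> int) \<Rightarrow> real^'n \<Rightarrow> complex" where
  "bas p u = indicator (cube (pt (snd p))) u * chr (pt (fst p)) u"

lemma bas_measurable [measurable]: "bas p \<in> borel_measurable borel"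
  unfolding bas_def by measurable

lemma cube_disjoint: "u \<in> cube (pt m) \<Longrightarrow> u \<in> cube (pt l) \<Longrightarrow> m = l"
proof
  fix i assume "u \<in> cube (pt m)" "u \<in> cube (pt l)"
  then have "of_int (m i) \<le> u $ i" "u $ i < of_int (m i) + 1" "of_int (l i) \<le> u $ i" "u $ i < of_int (l i) + 1"
    by (auto simp: mem_cube pt_def)
  then show "m i = l i" by linarith
qed

lemma cube_cover: "u \<in> cube (pt (\<lambda>i. \<lfloor>u $ i\<rfloor>))"
  by (simp add: mem_cube pt_def)

lemma bas_orthonormal:
  shows "bas p \<in> sqi lborel" "ip lborel (bas p) (bas q) = (if p = q then 1 else 0)"
proof -
  have "(cmod (bas p u))\<^sup>2 = cmod (indicator (cube (pt (snd p))) u * chr (pt (\<lambda>_. 0)) u)" for u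
    by (simp add: bas_def norm_mult indicator_def)
  then show "bas p \<in> sqi lborel"
    unfolding sqi_def using integrable_norm[OF chr_cube_integral(1)[of "pt (snd p)" "\<lambda>_. 0"]] by simp
  show "ip lborel (bas p) (bas q) = (if p = q then 1 else 0)"
  proof (cases "snd p = snd q")
    case False
    then have "bas p u * cnj (bas q u) = 0" for u
      using cube_disjoint[of u "snd p" "snd q"] by (auto simp: bas_def indicator_def)
    then have "ip lborel (bas p) (bas q) = 0" unfolding ip_def by (simp only: integral_zero)
    then show ?thesis using False by auto
  next
    case True
    have "bas p u * cnj (bas q u) = indicator (cube (pt (snd p))) u * chr (pt (\<lambda>i. fst p i - fst q i)) u" for u
      using True by (simp add: bas_def indicator_def chr_cnj chr_add[symmetric] pt_diff[symmetric])
    then have "ip lborel (bas p) (bas q) = (if (\<lambda>i. fst p i - fst q i) = (\<lambda>_. 0) then 1 else 0)"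
      unfolding ip_def by (simp only: chr_cube_integral(2))
    then show ?thesis using True by (simp add: fun_eq_iff prod_eq_iff)
  qed
qed

text \<open>Uniqueness of Fourier coefficients: the bounded multipliers preserving the annihilator of the
  characters form an algebra closed under bounded pointwise limits, so the sets whose indicator is
  a multiplier form a \<open>\<sigma>\<close>-algebra.\<close>

definition ann :: "(real^'n) set \<Rightarrow> (real^'n) set \<Rightarrow> (real^'n \<Rightarrow> complex) set" where
  "ann L W = {H. integrable lborel H \<and> (\<forall>u. u \<notin> W \<longrightarrow> H u = 0) \<and> (\<forall>k\<in>L. (\<integral>u. H u * chr k u \<partial>lborel) = 0)}"

text \<open>L is a set of frequencies and W a set carrying the functions. Two instances are needed:
  all frequencies on the whole space, for irreducibility, and the integer lattice on one cube, for
  the orthonormal basis.\<close>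

definition mult :: "(real^'n) set \<Rightarrow> (real^'n) set \<Rightarrow> (real^'n \<Rightarrow> complex) set" where
  "mult L W = {p. p \<in> borel_measurable borel \<and> bounded (range p) \<and> (\<forall>H\<in>ann L W. (\<lambda>u. p u * H u) \<in> ann L W)}"

lemma integrable_chr: "integrable lborel H \<Longrightarrow> integrable lborel (\<lambda>u. H u * chr k u)"
  by (rule Bochner_Integration.integrable_bound[of _ H]) (auto simp: norm_mult)

lemma integrable_bounded_mult:
  fixes H :: "real^'n \<Rightarrow> complex"
  assumes "integrable lborel H" "p \<in> borel_measurable borel" "\<And>u. cmod (p u) \<le> B"
  shows "integrable lborel (\<lambda>u. p u * H u)"
proof (rule Bochner_Integration.integrable_bound)
  show "integrable lborel (\<lambda>u. B *\<^sub>R H u)" using assms(1) by simp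
  show "(\<lambda>u. p u * H u) \<in> borel_measurable lborel" using assms(1,2) by measurable
  have B: "0 \<le> B" using assms(3)[of undefined] norm_ge_zero order_trans by blast
  show "AE u in lborel. norm (p u * H u) \<le> norm (B *\<^sub>R H u)"
    using assms(3) B by (intro AE_I2) (auto simp: norm_mult intro!: mult_right_mono)
qed

lemma multD: assumes "p \<in> mult L W" obtains B where "\<And>u. cmod (p u) \<le> B"
  using assms by (auto simp: mult_def bounded_iff)

lemma mult_measurable: "p \<in> mult L W \<Longrightarrow> p \<in> borel_measurable borel"
  by (simp add: mult_def)

lemma annI_mult:
  assumes "H \<in> ann L W" "p \<in> borel_measurable borel" "\<And>u. cmod (p u) \<le> B"
    "\<And>k. k \<in> L \<Longrightarrow> (\<integral>u. p u * H u * chr k u \<partial>lborel) = 0"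
  shows "(\<lambda>u. p u * H u) \<in> ann L W"
  using assms integrable_bounded_mult[of H p B] by (auto simp: ann_def)

lemma mult_const: "(\<lambda>_. c) \<in> mult L W"
  by (auto simp: mult_def ann_def mult.assoc)

lemma mult_times: assumes "p \<in> mult L W" "q \<in> mult L W" shows "(\<lambda>u. p u * q u) \<in> mult L W"
proof -
  obtain B where B: "\<And>u. cmod (p u) \<le> B" using multD[OF assms(1)] by blast
  obtain C where C: "\<And>u. cmod (q u) \<le> C" using multD[OF assms(2)] by blast
  have "cmod (p u * q u) \<le> B * C" for u
    unfolding norm_mult using B[of u] C[of u] order_trans[OF norm_ge_zero B[of u]] by (intro mult_mono) auto
  then have "bounded (range (\<lambda>u. p u * q u))" by (auto simp: bounded_iff)
  moreover have "(\<lambda>u. p u * q u * H u) \<in> ann L W" if "H \<in> ann L W" for H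
    using assms that by (force simp: mult_def mult.assoc)
  ultimately show ?thesis using assms[THEN mult_measurable] by (simp add: mult_def)
qed

lemma mult_add: assumes "p \<in> mult L W" "q \<in> mult L W" shows "(\<lambda>u. p u + q u) \<in> mult L W"
proof -
  obtain B where B: "\<And>u. cmod (p u) \<le> B" using multD[OF assms(1)] by blast
  obtain C where C: "\<And>u. cmod (q u) \<le> C" using multD[OF assms(2)] by blast
  have b: "cmod (p u + q u) \<le> B + C" for u
    using B[of u] C[of u] norm_triangle_ineq[of "p u" "q u"] by linarith
  then have "bounded (range (\<lambda>u. p u + q u))" by (auto simp: bounded_iff)
  moreover have "(\<lambda>u. (p u + q u) * H u) \<in> ann L W" if H: "H \<in> ann L W" for H
  proof (rule annI_mult[OF H _ b])
    show "(\<lambda>u. p u + q u) \<in> borel_measurable borel" using assms[THEN mult_measurable] by simp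
    fix k assume k: "k \<in> L"
    have pH: "(\<lambda>u. p u * H u) \<in> ann L W" "(\<lambda>u. q u * H u) \<in> ann L W" using assms H by (auto simp: mult_def)
    then have "integrable lborel (\<lambda>u. p u * H u * chr k u)" "integrable lborel (\<lambda>u. q u * H u * chr k u)"
      by (auto simp: ann_def intro!: integrable_chr)
    then have "(\<integral>u. (p u + q u) * H u * chr k u \<partial>lborel) = (\<integral>u. p u * H u * chr k u \<partial>lborel) + (\<integral>u. q u * H u * chr k u \<partial>lborel)"
      by (subst Bochner_Integration.integral_add[symmetric]) (auto simp: algebra_simps)
    also have "\<dots> = 0" using pH k by (auto simp: ann_def)
    finally show "(\<integral>u. (p u + q u) * H u * chr k u \<partial>lborel) = 0" .
  qed
  ultimately show ?thesis using assms[THEN mult_measurable] by (simp add: mult_def)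
qed

lemma mult_sum: "(\<And>i. i \<in> I \<Longrightarrow> p i \<in> mult L W) \<Longrightarrow> (\<lambda>u. \<Sum>i\<in>I. p i u) \<in> mult L W"
  by (induction I rule: infinite_finite_induct) (auto intro: mult_add mult_const)

lemma mult_power: "p \<in> mult L W \<Longrightarrow> (\<lambda>u. p u ^ n) \<in> mult L W"
  by (induction n) (auto intro: mult_times mult_const)

lemma mult_limit:
  assumes p: "\<And>n. p n \<in> mult L W" and B: "\<And>n u. cmod (p n u) \<le> B"
    and lim: "\<And>u. (\<lambda>n. p n u) \<longlonglongrightarrow> q u"
  shows "q \<in> mult L W"
proof -
  have pm [measurable]: "p n \<in> borel_measurable borel" for n using p by (simp add: mult_def)
  have qm [measurable]: "q \<in> borel_measurable borel" by (rule borel_measurable_LIMSEQ_metric[OF pm lim])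
  have qB: "cmod (q u) \<le> B" for u
    by (rule LIMSEQ_le_const2[OF tendsto_norm[OF lim]]) (use B in auto)
  have "(\<lambda>u. q u * H u) \<in> ann L W" if H: "H \<in> ann L W" for H
  proof (rule annI_mult[OF H qm qB])
    fix k assume k: "k \<in> L"
    have Hi: "integrable lborel H" using H by (simp add: ann_def)
    then have [measurable]: "H \<in> borel_measurable borel" by auto
    have "(\<lambda>n. \<integral>u. p n u * H u * chr k u \<partial>lborel) \<longlonglongrightarrow> (\<integral>u. q u * H u * chr k u \<partial>lborel)"
    proof (rule integral_dominated_convergence[where w = "\<lambda>u. B * cmod (H u)"])
      show "integrable lborel (\<lambda>u. B * cmod (H u))" using Hi by simp
      show "AE u in lborel. (\<lambda>n. p n u * H u * chr k u) \<longlonglongrightarrow> q u * H u * chr k u"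
        by (intro AE_I2 tendsto_intros lim)
      show "AE u in lborel. norm (p n u * H u * chr k u) \<le> B * cmod (H u)" for n
        using B by (intro AE_I2) (auto simp: norm_mult intro!: mult_right_mono)
    qed measurable
    moreover have "(\<integral>u. p n u * H u * chr k u \<partial>lborel) = 0" for n
      using p[of n] H k by (auto simp: mult_def ann_def)
    ultimately show "(\<integral>u. q u * H u * chr k u \<partial>lborel) = 0"
      using LIMSEQ_unique by (simp add: LIMSEQ_const_iff)
  qed
  then show ?thesis using qB by (auto simp: mult_def bounded_iff)
qed

text \<open>Multiplication by a character shifts the Fourier coefficients, so a shift that preserves
  L preserves their vanishing.\<close>

lemma mult_chr: assumes "\<And>l. l \<in> L \<Longrightarrow> k + l \<in> L" shows "chr k \<in> mult L W"
proof -
  have "(\<lambda>u. chr k u * H u) \<in> ann L W" if H: "H \<in> ann L W" for H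
  proof (rule annI_mult[OF H, where B = 1])
    fix l assume "l \<in> L"
    then have "(\<integral>u. H u * chr (k + l) u \<partial>lborel) = 0" using assms H by (auto simp: ann_def)
    then show "(\<integral>u. chr k u * H u * chr l u \<partial>lborel) = 0" by (simp add: chr_add mult_ac)
  qed auto
  then show ?thesis by (auto simp: mult_def bounded_iff)
qed

text \<open>Half spaces of multipliers: Bernstein polynomials of a multiplier approximate continuous functions
  of it, which in turn approximate the indicator function.\<close>

lemma mult_positive:
  fixes \<psi> :: "real^'n \<Rightarrow> real"
  assumes psi: "(\<lambda>u. complex_of_real (\<psi> u)) \<in> mult L W" and b: "\<And>u. \<bar>\<psi> u\<bar> \<le> 1"
  shows "indicator {u. \<psi> u > 0} \<in> mult L W"
proof -
  define s where "s u = (\<psi> u + 1) / 2" for u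
  have s01: "s u \<in> {0..1}" for u using b[of u] by (auto simp: s_def abs_le_iff)
  have sm: "(\<lambda>u. complex_of_real (s u)) \<in> mult L W"
  proof -
    have "(\<lambda>u. complex_of_real (\<psi> u) * (1/2) + 1/2) \<in> mult L W"
      by (intro mult_add mult_times psi mult_const)
    then show ?thesis by (simp add: s_def add_divide_distrib)
  qed
  have cont: "(\<lambda>u. complex_of_real (g (s u))) \<in> mult L W" if g: "continuous_on {0..1} g" for g :: "real \<Rightarrow> real"
  proof -
    have "\<exists>N. \<forall>x\<in>{0..1}. \<bar>g x - (\<Sum>k\<le>N. g (k/N) * Bernstein N k x)\<bar> < 1 / (real n + 1)" for n
    proof -
      have "0 < 1 / (real n + 1)" by simp
      from Bernstein_Weierstrass[OF g this] show ?thesis by blast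
    qed
    then have "\<exists>N. \<forall>n. \<forall>x\<in>{0..1}. \<bar>g x - (\<Sum>k\<le>N n. g (k/N n) * Bernstein (N n) k x)\<bar> < 1 / (real n + 1)"
      by (intro choice allI)
    then obtain N where N: "\<And>n x. x \<in> {0..1} \<Longrightarrow> \<bar>g x - (\<Sum>k\<le>N n. g (k/N n) * Bernstein (N n) k x)\<bar> < 1 / (real n + 1)"
      by blast
    define p where "p n u = (\<Sum>k\<le>N n. g (k/N n) * Bernstein (N n) k (s u))" for n u
    have pm: "(\<lambda>u. complex_of_real (p n u)) \<in> mult L W" for n
    proof -
      have "(\<lambda>u. \<Sum>k\<le>N n. complex_of_real (g (k/N n)) * (of_nat (N n choose k) * of_real (s u) ^ k * (1 + (-1) * of_real (s u)) ^ (N n - k))) \<in> mult L W"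
        by (intro mult_sum mult_times mult_power mult_add mult_const sm)
      then show ?thesis by (simp add: p_def Bernstein_def)
    qed
    have close: "\<bar>g (s u) - p n u\<bar> < 1 / (real n + 1)" for n u
      unfolding p_def using N s01 by blast
    obtain C where C: "\<And>x. x \<in> {0..1} \<Longrightarrow> \<bar>g x\<bar> \<le> C"
    proof -
      have "bounded (g ` {0..1})" by (rule compact_imp_bounded[OF compact_continuous_image[OF g compact_Icc]])
      then obtain C where "\<forall>y\<in>g ` {0..1}. norm y \<le> C" unfolding bounded_iff by blast
      then show thesis using that[of C] by simp
    qed
    show ?thesis
    proof (rule mult_limit[OF pm])
      show "cmod (complex_of_real (p n u)) \<le> C + 1" for n u
      proof -
        have "1 / (real n + 1) \<le> 1" by simp
        then have "\<bar>p n u\<bar> \<le> C + 1" using close[of u n] C[OF s01[of u]] by linarith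
        then show ?thesis by simp
      qed
      show "(\<lambda>n. complex_of_real (p n u)) \<longlonglongrightarrow> complex_of_real (g (s u))" for u
      proof (intro tendsto_of_real LIMSEQ_I)
        fix e :: real assume "e > 0"
        then obtain M where M: "inverse (real (Suc M)) < e" using reals_Archimedean by blast
        have "norm (p n u - g (s u)) < e" if "n \<ge> M" for n
        proof -
          have "1 / (real n + 1) \<le> 1 / (real M + 1)" using that by (intro divide_left_mono) auto
          then show ?thesis using close[of u n] M by (simp add: inverse_eq_divide add.commute abs_minus_commute)
        qed
        then show "\<exists>M. \<forall>n\<ge>M. norm (p n u - g (s u)) < e" by blast
      qed
    qed
  qed
  \<comment> \<open>A ramp that is 0 up to 1/2 and has slope n until it reaches 1; since s > 1/2
    exactly where \<psi> > 0, the ramps of s tend to the indicator from below.\<close>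
  define g where "g n x = min 1 (max 0 (real n * (x - 1/2)))" for n :: nat and x :: real
  show ?thesis
  proof (rule mult_limit[where p = "\<lambda>n u. complex_of_real (g n (s u))" and B = 1])
    show "(\<lambda>u. complex_of_real (g n (s u))) \<in> mult L W" for n
      by (intro cont) (auto simp: g_def intro!: continuous_intros)
    show "cmod (complex_of_real (g n (s u))) \<le> 1" for n u by (simp add: g_def)
    fix u
    show "(\<lambda>n. complex_of_real (g n (s u))) \<longlonglongrightarrow> indicator {u. \<psi> u > 0} u"
    proof (cases "\<psi> u > 0")
      case True
      then have "0 < \<psi> u / 2" by simp
      from reals_Archimedean3[OF this] obtain M :: nat where M: "real M * (\<psi> u / 2) > 1" by blast
      have "g n (s u) = 1" if "n \<ge> M" for n
      proof -
        have "real M * (\<psi> u / 2) \<le> real n * (\<psi> u / 2)" using that True by (intro mult_right_mono) auto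
        moreover have e: "s u - 1/2 = \<psi> u / 2" by (simp add: s_def field_simps)
        ultimately show ?thesis using M unfolding g_def e by linarith
      qed
      then have "(\<lambda>n. complex_of_real (g n (s u))) \<longlonglongrightarrow> 1"
        by (intro tendsto_eventually eventually_sequentiallyI[of M]) simp
      then show ?thesis using True by simp
    next
      case False
      have "g n (s u) = 0" for n
      proof -
        have "s u - 1/2 \<le> 0" using False by (simp add: s_def field_simps)
        then have "real n * (s u - 1/2) \<le> 0" by (intro mult_nonneg_nonpos) auto
        then show ?thesis by (simp add: g_def)
      qed
      then show ?thesis using False by simp
    qed
  qed
qed

definition msets :: "(real^'n) set \<Rightarrow> (real^'n) set \<Rightarrow> (real^'n) set set" where
  "msets L W = {A. A \<in> sets borel \<and> indicator A \<in> mult L W}"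

lemma msets_Compl: assumes "A \<in> msets L W" shows "- A \<in> msets L W"
proof -
  have "(\<lambda>u. 1 + (-1) * indicator A u :: complex) \<in> mult L W"
    using assms by (intro mult_add mult_times mult_const) (simp add: msets_def)
  moreover have "(\<lambda>u. 1 + (-1) * indicator A u :: complex) = indicator (- A)" by (auto simp: indicator_def)
  ultimately show ?thesis using assms by (simp add: msets_def borel_comp)
qed

lemma msets_Int: assumes "A \<in> msets L W" "B \<in> msets L W" shows "A \<inter> B \<in> msets L W"
proof -
  have "(\<lambda>u. indicator A u * indicator B u :: complex) \<in> mult L W"
    using assms by (intro mult_times) (simp_all add: msets_def)
  moreover have "(\<lambda>u. indicator A u * indicator B u :: complex) = indicator (A \<inter> B)" by (auto simp: indicator_def)
  ultimately show ?thesis using assms by (auto simp: msets_def)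
qed

lemma msets_empty: "{} \<in> msets L W"
  using mult_const[of 0 L W] by (simp add: msets_def indicator_def[abs_def])

lemma msets_Un: "A \<in> msets L W \<Longrightarrow> B \<in> msets L W \<Longrightarrow> A \<union> B \<in> msets L W"
  using msets_Compl[OF msets_Int[OF msets_Compl msets_Compl], of A L W B] by simp

lemma msets_UN: assumes A: "\<And>n::nat. A n \<in> msets L W" shows "(\<Union>n. A n) \<in> msets L W"
proof -
  have fin: "(\<Union>i<n. A i) \<in> msets L W" for n
    by (induction n) (auto simp: lessThan_Suc msets_empty intro!: msets_Un A)
  have "indicator (\<Union>n. A n) \<in> mult L W"
  proof (rule mult_limit[where p = "\<lambda>n. indicator (\<Union>i<n. A i)" and B = 1])
    show "indicator (\<Union>i<n. A i) \<in> mult L W" for n using fin by (simp add: msets_def)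
    show "cmod (indicator (\<Union>i<n. A i) u) \<le> 1" for n u by (simp add: indicator_def)
    show "(\<lambda>n. indicator (\<Union>i<n. A i) u :: complex) \<longlonglongrightarrow> indicator (\<Union>n. A n) u" for u
      by (rule LIMSEQ_indicator_UN)
  qed
  then show ?thesis using A by (auto simp: msets_def)
qed

lemma msets_borel:
  assumes "\<And>c i. {u. c < u $ i} \<in> msets L W" shows "sets borel \<subseteq> msets L W"
proof -
  have "sigma_algebra UNIV (msets L W)"
    unfolding sigma_algebra_iff2
    by (auto simp: Compl_eq_Diff_UNIV[symmetric] msets_empty intro: msets_Compl msets_UN)
  moreover have "(\<lambda>(a, i). {x. a < x \<bullet> i}) ` (UNIV \<times> Basis) \<subseteq> msets L W"
    using assms by (auto simp: Basis_vec_def inner_axis)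
  ultimately have "sigma_sets UNIV ((\<lambda>(a, i). {x. a < x \<bullet> i}) ` (UNIV \<times> Basis)) \<subseteq> msets L W"
    by (rule sigma_algebra.sigma_sets_subset)
  then show ?thesis by (subst borel_eq_halfspace_greater) simp
qed

text \<open>Once all Borel sets are multipliers, frequency 0 says that H has integral 0 over every
  Borel set.\<close>

lemma ann_zero:
  fixes L W :: "(real^'n) set"
  assumes "0 \<in> L" "sets borel \<subseteq> msets L W" "H \<in> ann L W" shows "AE u in lborel. H u = 0"
proof (rule sigma_finite_measure.density_zero[OF sigma_finite_lborel])
  show "integrable lborel H" using assms by (simp add: ann_def)
  fix A :: "(real^'n) set" assume "A \<in> sets lborel"
  then have "indicator A \<in> mult L W" using assms by (auto simp: msets_def)
  then have "(\<lambda>u. indicator A u * H u) \<in> ann L W" using assms by (auto simp: mult_def)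
  then have "(\<integral>u. indicator A u * H u * chr 0 u \<partial>lborel) = 0" using assms(1) unfolding ann_def by blast
  moreover have "indicator A u * H u = indicat_real A u *\<^sub>R H u" for u by (simp add: indicator_def)
  ultimately show "set_lebesgue_integral lborel A H = 0" by (simp add: set_lebesgue_integral_def)
qed

lemma msets_sin:
  assumes "k \<in> L" "\<And>k l. k \<in> L \<Longrightarrow> l \<in> L \<Longrightarrow> k + l \<in> L" "\<And>k. k \<in> L \<Longrightarrow> - k \<in> L"
  shows "{u. sin (2 * pi * (k \<bullet> u) - d) > 0} \<in> msets L W"
proof -
  let ?\<psi> = "\<lambda>u. sin (2 * pi * (k \<bullet> u) - d)"
  \<comment> \<open>Euler's formula: a shifted sine is a combination of the characters k and -
    k.\<close>
  have "(\<lambda>u. (- \<i> / 2) * (cis (- d) * chr k u) + (\<i> / 2) * (cis d * chr (- k) u)) \<in> mult L W"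
    using assms(2)[OF assms(1)] assms(2)[OF assms(3)[OF assms(1)]] by (intro mult_add mult_times mult_const mult_chr)
  moreover have "(- \<i> / 2) * (cis (- d) * chr k u) + (\<i> / 2) * (cis d * chr (- k) u) = complex_of_real (?\<psi> u)" for u
    by (simp add: chr_def complex_eq_iff cis.sel cis_mult field_simps sin_diff cos_diff)
  ultimately have "(\<lambda>u. complex_of_real (?\<psi> u)) \<in> mult L W" by simp
  then have "indicator {u. ?\<psi> u > 0} \<in> mult L W" by (rule mult_positive) simp
  moreover have "{u. ?\<psi> u > 0} \<in> sets borel"
    by (intro borel_open open_Collect_less continuous_intros)
  ultimately show ?thesis by (simp add: msets_def)
qed

text \<open>Half spaces are limits of the sets where a sine of very long period, with a zero at u_i
  = c, is positive: for each fixed u the sign of that sine is eventually the sign of u_i -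
  c.\<close>

lemma fourier_unique:
  fixes F :: "real^'n \<Rightarrow> complex"
  assumes "integrable lborel F" "\<And>k. (\<integral>u. F u * chr k u \<partial>lborel) = 0"
  shows "AE u in lborel. F u = 0"
proof (rule ann_zero[where L = UNIV and W = UNIV])
  show "F \<in> ann UNIV UNIV" using assms by (simp add: ann_def)
  show "sets borel \<subseteq> msets UNIV (UNIV :: (real^'n) set)"
  proof (rule msets_borel)
    fix c :: real and i :: 'n
    define A where "A n = {u::real^'n. sin (2 * pi * (((1 / (4 * (real n + 1))) *\<^sub>R axis i 1) \<bullet> u) - 2 * pi * c / (4 * (real n + 1))) > 0}" for n
    have A: "A n \<in> msets UNIV UNIV" for n unfolding A_def by (rule msets_sin) auto
    have "indicator {u. c < u $ i} \<in> mult UNIV (UNIV :: (real^'n) set)"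
    proof (rule mult_limit[where p = "\<lambda>n. indicator (A n)" and B = 1])
      show "indicator (A n) \<in> mult UNIV UNIV" for n using A by (simp add: msets_def)
      show "cmod (indicator (A n) u) \<le> 1" for n u by (simp add: indicator_def)
      fix u :: "real^'n"
      obtain M :: nat where M: "\<bar>u $ i - c\<bar> < real M" using reals_Archimedean2 by blast
      have "u \<in> A n \<longleftrightarrow> c < u $ i" if "n \<ge> M" for n
      proof -
        define x where "x = (u $ i - c) / (2 * (real n + 1))"
        have x: "\<bar>x\<bar> < 1" using M that by (simp add: x_def)
        have "2 * pi * (((1 / (4 * (real n + 1))) *\<^sub>R axis i 1) \<bullet> u) - 2 * pi * c / (4 * (real n + 1)) = pi * x"
        proof -
          define N where "N = real n + 1"
          have "N > 0" by (simp add: N_def)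
          then have "2 * pi * (u $ i / (4 * N)) - 2 * pi * c / (4 * N) = pi * ((u $ i - c) / (2 * N))"
            by (simp add: field_simps)
          then show ?thesis by (simp add: x_def inner_axis' N_def)
        qed
        then have "u \<in> A n \<longleftrightarrow> sin (pi * x) > 0" by (simp add: A_def)
        also have "\<dots> \<longleftrightarrow> x > 0"
        proof (cases "x > 0")
          case True
          have "pi * x < pi" using x pi_gt_zero by simp
          then show ?thesis using True by (simp add: sin_gt_zero)
        next
          case False
          have "pi * (- x) \<le> pi * 1" using x by (intro mult_left_mono) auto
          then have "sin (pi * (- x)) \<ge> 0" using False by (intro sin_ge_zero) (auto simp: mult_nonneg_nonpos)
          then show ?thesis using False by simp
        qed
        also have "\<dots> \<longleftrightarrow> c < u $ i" by (simp add: x_def zero_less_divide_iff)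
        finally show ?thesis .
      qed
      then show "(\<lambda>n. indicator (A n) u :: complex) \<longlonglongrightarrow> indicator {u. c < u $ i} u"
        by (intro tendsto_eventually eventually_sequentiallyI[of M]) (simp add: indicator_def)
    qed
    moreover have "{u :: real^'n. c < u $ i} \<in> sets borel"
      by (intro borel_open open_Collect_less continuous_intros)
    ultimately show "{u. c < u $ i} \<in> msets UNIV (UNIV :: (real^'n) set)" by (simp add: msets_def)
  qed
qed simp

text \<open>With integer frequencies the sine has period 1, and its positive set is an arc of length
  1/2. Inside the cube a half space u_i > m_i + t is the union of two such arcs for t < 1/2 and
  their intersection for t \<ge> 1/2, the second arc starting at 1/2.\<close>

lemma fourier_unique_cube:
  fixes F :: "real^'n \<Rightarrow> complex"
  assumes F: "integrable lborel F" and zero: "\<And>u. u \<notin> cube (pt m) \<Longrightarrow> F u = 0"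
    and four: "\<And>k. (\<integral>u. F u * chr (pt k) u \<partial>lborel) = 0"
  shows "AE u in lborel. F u = 0"
proof (rule ann_zero[where L = "range pt" and W = "cube (pt m)"])
  let ?L = "range (pt :: ('n \<Rightarrow> int) \<Rightarrow> real^'n)" and ?W = "cube (pt m) :: (real^'n) set"
  show "0 \<in> ?L" using pt_0 by (metis rangeI)
  have L: "k + l \<in> ?L" "- k \<in> ?L" if "k \<in> ?L" "l \<in> ?L" for k l using that by (auto simp: pt_add pt_minus)
  show "F \<in> ann ?L ?W" using assms by (auto simp: ann_def)
  \<comment> \<open>Functions in the annihilator vanish off the cube, so only the trace of a set on
    the cube matters.\<close>
  have W: "A \<in> msets ?L ?W" if B: "B \<in> msets ?L ?W" and AB: "A \<inter> ?W = B \<inter> ?W" and A: "A \<in> sets borel" for A B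
  proof -
    have "(\<lambda>u. indicator A u * H u) \<in> ann ?L ?W" if H: "H \<in> ann ?L ?W" for H
    proof -
      have eq: "(\<lambda>u. indicator A u * H u) = (\<lambda>u. indicator B u * H u)"
      proof
        fix u show "indicator A u * H u = indicator B u * H u"
          using H AB by (cases "u \<in> ?W") (auto simp: ann_def indicator_def)
      qed
      show ?thesis unfolding eq using B H by (simp add: msets_def mult_def)
    qed
    then show ?thesis using A by (auto simp: msets_def mult_def bounded_iff indicator_def intro!: exI[of _ 1])
  qed
  show "sets borel \<subseteq> msets ?L ?W"
  proof (rule msets_borel)
    fix c :: real and i :: 'n
    have hs: "{u :: real^'n. c < u $ i} \<in> sets borel" for c
      by (intro borel_open open_Collect_less continuous_intros)
    have e: "(axis i 1 :: real^'n) \<in> ?L"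
      by (rule image_eqI[of _ _ "\<lambda>j. if j = i then 1 else 0"]) (auto simp: pt_def axis_def vec_eq_iff)
    define P where "P t = {u :: real^'n. sin (2 * pi * (axis i 1 \<bullet> u) - 2 * pi * t) > 0}" for t
    have P: "P t \<in> msets ?L ?W" for t unfolding P_def using L by (intro msets_sin e) auto
    have sinpos: "sin (2 * pi * x) > 0 \<longleftrightarrow> 0 < x \<and> x < 1/2" if "0 \<le> x" "x < 1" for x
    proof (cases "0 < x \<and> x < 1/2")
      case True then show ?thesis by (intro iffI sin_gt_zero) auto
    next
      case False
      show ?thesis
      proof (cases "x = 0")
        case False
        then have "1/2 \<le> x" using that \<open>\<not> (0 < x \<and> x < 1/2)\<close> by auto
        then have "sin (2 * pi * x - pi) \<ge> 0" using that by (intro sin_ge_zero) (auto simp: field_simps)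
        then have "sin (2 * pi * x) \<le> 0" by (simp add: sin_diff)
        then show ?thesis using \<open>1/2 \<le> x\<close> by auto
      qed simp
    qed
    have sinneg: "sin (2 * pi * x) > 0 \<longleftrightarrow> x < - 1/2" if "- 1 < x" "x < 0" for x
    proof -
      have "sin (2 * pi * x) = sin (2 * pi * (x + 1))" by (simp add: distrib_left sin_add)
      then show ?thesis using sinpos[of "x + 1"] that by auto
    qed
    have Pmem: "u \<in> P (of_int (m i) + t) \<longleftrightarrow> (t < u $ i - of_int (m i) \<and> u $ i - of_int (m i) < t + 1/2) \<or> u $ i - of_int (m i) < t - 1/2"
      if "u \<in> ?W" "0 \<le> t" "t < 1" for u t
    proof -
      define v where "v = u $ i - of_int (m i)"
      have v: "0 \<le> v" "v < 1" using that(1) by (auto simp: mem_cube pt_def v_def dest!: spec[of _ i])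
      have "2 * pi * (axis i 1 \<bullet> u) - 2 * pi * (of_int (m i) + t) = 2 * pi * (v - t)"
        by (simp add: v_def inner_axis' algebra_simps)
      then have "u \<in> P (of_int (m i) + t) \<longleftrightarrow> sin (2 * pi * (v - t)) > 0" by (simp add: P_def)
      also have "\<dots> \<longleftrightarrow> (t < v \<and> v < t + 1/2) \<or> v < t - 1/2"
        using sinpos[of "v - t"] sinneg[of "v - t"] v that(2,3) by (cases "v < t") auto
      finally show ?thesis by (simp only: v_def)
    qed
    have half: "{u. of_int (m i) + t < u $ i} \<in> msets ?L ?W" if t: "0 < t" "t < 1" for t
    proof (cases "t < 1/2")
      case True
      have "u \<in> P (of_int (m i) + t) \<union> P (of_int (m i) + 1/2) \<longleftrightarrow> of_int (m i) + t < u $ i" if "u \<in> ?W" for u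
        using Pmem[OF that, of t] Pmem[OF that, of "1/2"] t True that by (auto simp: mem_cube pt_def dest!: spec[of _ i])
      then show ?thesis by (intro W[OF msets_Un[OF P[of "of_int (m i) + t"] P[of "of_int (m i) + 1/2"]]] hs) auto
    next
      case False
      have "u \<in> P (of_int (m i) + t) \<inter> P (of_int (m i) + 1/2) \<longleftrightarrow> of_int (m i) + t < u $ i" if "u \<in> ?W" for u
        using Pmem[OF that, of t] Pmem[OF that, of "1/2"] t False that by (auto simp: mem_cube pt_def dest!: spec[of _ i])
      then show ?thesis by (intro W[OF msets_Int[OF P[of "of_int (m i) + t"] P[of "of_int (m i) + 1/2"]]] hs) auto
    qed
    have UNIV: "UNIV \<in> msets ?L ?W" using msets_Compl[OF msets_empty] by simp
    consider "c < of_int (m i)" | "c = of_int (m i)" | "of_int (m i) < c" "c < of_int (m i) + 1" | "of_int (m i) + 1 \<le> c" by linarith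
    then show "{u. c < u $ i} \<in> msets ?L ?W"
    proof cases
      case 1
      show ?thesis by (rule W[OF UNIV _ hs]) (use 1 in \<open>auto simp: mem_cube pt_def dest!: spec[of _ i]\<close>)
    next
      case 2
      \<comment> \<open>The value t = 0 is excluded from \<open>half\<close>, since there the two
        arcs would miss the point 1/2; it is reached as a limit of t = 1 / (n + 2).\<close>
      have "(\<Union>n::nat. {u :: real^'n. of_int (m i) + 1 / (real n + 2) < u $ i}) \<in> msets ?L ?W"
        by (intro msets_UN half) auto
      also have "(\<Union>n::nat. {u :: real^'n. of_int (m i) + 1 / (real n + 2) < u $ i}) = {u. c < u $ i}"
      proof (intro set_eqI iffI)
        fix u :: "real^'n" assume "u \<in> {u. c < u $ i}"
        then have "0 < u $ i - of_int (m i)" using 2 by simp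
        then obtain n where n: "inverse (real (Suc n)) < u $ i - of_int (m i)" using reals_Archimedean by blast
        have "1 / (real n + 2) \<le> inverse (real (Suc n))" by (simp add: inverse_eq_divide divide_simps)
        then show "u \<in> (\<Union>n::nat. {u. of_int (m i) + 1 / (real n + 2) < u $ i})" using n by (auto intro!: exI[of _ n])
      next
        fix u :: "real^'n" assume "u \<in> (\<Union>n::nat. {u. of_int (m i) + 1 / (real n + 2) < u $ i})"
        then obtain n :: nat where "of_int (m i) + 1 / (real n + 2) < u $ i" by auto
        moreover have "0 < 1 / (real n + 2)" by simp
        ultimately show "u \<in> {u. c < u $ i}" using 2 unfolding mem_Collect_eq by linarith
      qed
      finally show ?thesis .
    next
      case 3
      then show ?thesis using half[of "c - of_int (m i)"] by simp
    next
      case 4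
      show ?thesis by (rule W[OF msets_empty _ hs]) (use 4 in \<open>auto simp: mem_cube pt_def dest!: spec[of _ i]\<close>)
    qed
  qed
qed

lemma infinite_int_fun: "infinite (UNIV :: ('n::finite \<Rightarrow> int) set)"
proof -
  have "inj (\<lambda>k::int. (\<lambda>_::'n. k))" by (auto simp: inj_def fun_eq_iff)
  then have "infinite (range (\<lambda>k::int. (\<lambda>_::'n. k)))" by (simp add: finite_image_iff infinite_UNIV_int)
  then show ?thesis by (rule infinite_super[OF subset_UNIV])
qed

lemma bij_from_nat_into:
  assumes "infinite (UNIV :: 'a::countable set)" shows "bij (from_nat_into (UNIV :: 'a set))"
  using bij_betw_from_nat_into[OF countableI_type assms] .

lemma bij_int_fun: "bij (from_nat_into (UNIV :: ('n::finite \<Rightarrow> int) set))"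
  by (rule bij_from_nat_into[OF infinite_int_fun])

lemma bij_int_fun_pair: "bij (from_nat_into (UNIV :: (('n::finite \<Rightarrow> int) \<times> ('n \<Rightarrow> int)) set))"
  by (rule bij_from_nat_into) (simp add: finite_prod infinite_int_fun)

definition basn :: "nat \<Rightarrow> real^'n \<Rightarrow> complex" where
  "basn n = bas (from_nat_into UNIV n)"

text \<open>Completeness is local: a function orthogonal to the system vanishes almost everywhere on
  each cube by \<open>fourier_unique_cube\<close>, and countably many cubes cover the space.\<close>

lemma basn_onb: "onb (lborel :: (real^'n) measure) basn"
proof -
  let ?e = "from_nat_into (UNIV :: (('n \<Rightarrow> int) \<times> ('n \<Rightarrow> int)) set)"
  have bij: "bij ?e" by (rule bij_int_fun_pair)
  have "AE u in lborel. f u = 0" if f: "f \<in> sqi lborel" and z: "\<And>n. ip lborel f (basn n) = 0" for f :: "real^'n \<Rightarrow> complex"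
  proof -
    have z': "ip lborel f (bas p) = 0" for p
    proof -
      obtain n where "p = ?e n" using surjD[OF bij_is_surj[OF bij], of p] by blast
      then show ?thesis using z[of n] by (simp add: basn_def)
    qed
    have "AE u in lborel. indicator (cube (pt m)) u * f u = 0" for m :: "'n \<Rightarrow> int"
    proof (rule fourier_unique_cube[of _ m])
      have "bas (\<lambda>_. 0, m) = indicator (cube (pt m))" by (simp add: bas_def fun_eq_iff pt_0)
      then have "indicator (cube (pt m)) \<in> sqi (lborel :: (real^'n) measure)" using bas_orthonormal(1)[of "(\<lambda>_. 0, m)"] by simp
      from sqi_prod_integrable[OF f this] have "integrable lborel (\<lambda>u. f u * cnj (indicator (cube (pt m)) u))" .
      moreover have "f u * cnj (indicator (cube (pt m)) u) = indicator (cube (pt m)) u * f u" for u by (simp add: indicator_def)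
      ultimately show "integrable lborel (\<lambda>u. indicator (cube (pt m)) u * f u)" by simp
      show "indicator (cube (pt m)) u * f u = 0" if "u \<notin> cube (pt m)" for u using that by simp
      fix k
      have "indicator (cube (pt m)) u * f u * chr (pt k) u = f u * cnj (bas (\<lambda>i. - k i, m) u)" for u
        by (simp add: bas_def chr_cnj pt_minus indicator_def)
      then have "(\<integral>u. indicator (cube (pt m)) u * f u * chr (pt k) u \<partial>lborel) = ip lborel f (bas (\<lambda>i. - k i, m))"
        unfolding ip_def by presburger
      then show "(\<integral>u. indicator (cube (pt m)) u * f u * chr (pt k) u \<partial>lborel) = 0"
        using z'[of "(\<lambda>i. - k i, m)"] by simp
    qed
    then have "AE u in lborel. \<forall>m. indicator (cube (pt m)) u * f u = 0" by (subst AE_all_countable) simp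
    then show ?thesis
    proof eventually_elim
      case (elim u)
      from elim[rule_format, of "\<lambda>i. \<lfloor>u $ i\<rfloor>"] show ?case using cube_cover[of u] by (auto simp: indicator_def)
    qed
  qed
  moreover have "ip lborel (basn k) (basn n :: real^'n \<Rightarrow> complex) = (if k = n then 1 else 0)" for k n
    using bij by (simp add: basn_def bas_orthonormal(2) bij_def inj_eq)
  ultimately show ?thesis by (auto simp: onb_def basn_def bas_orthonormal(1))
qed

section \<open>A Plancherel inequality for functions carried by a cube\<close>

lemma nn_integral_cubes:
  fixes g :: "real^'n \<Rightarrow> ennreal"
  assumes [measurable]: "g \<in> borel_measurable borel"
  shows "(\<integral>\<^sup>+s. g s \<partial>lborel) = (\<integral>\<^sup>+s. indicator (cube 0) s * (\<Sum>n. g (s + pt (from_nat_into UNIV n))) \<partial>lborel)"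
proof -
  let ?e = "from_nat_into (UNIV :: ('n \<Rightarrow> int) set)"
  have bij: "bij ?e" by (rule bij_int_fun)
  have one: "(\<Sum>n. indicator (cube (pt (?e n))) s) = (1::ennreal)" for s :: "real^'n"
  proof -
    obtain N where N: "?e N = (\<lambda>i. \<lfloor>s $ i\<rfloor>)" using surjD[OF bij_is_surj[OF bij], of "\<lambda>i. \<lfloor>s $ i\<rfloor>"] by metis
    have cov: "s \<in> cube (pt (?e N))" unfolding N by (rule cube_cover)
    have "indicator (cube (pt (?e n))) s = (if n = N then 1 else 0 :: ennreal)" for n
    proof (cases "n = N")
      case False
      then have "?e n \<noteq> ?e N" using bij_is_inj[OF bij] by (simp add: inj_eq)
      then have "s \<notin> cube (pt (?e n))" using cube_disjoint[OF _ cov] by blast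
      then show ?thesis using False by simp
    qed (simp add: cov)
    then show ?thesis using sums_single[of N "\<lambda>_. 1 :: ennreal"] by (simp add: sums_iff)
  qed
  have "(\<integral>\<^sup>+s. g s \<partial>lborel) = (\<integral>\<^sup>+s. (\<Sum>n. indicator (cube (pt (?e n))) s * g s) \<partial>lborel)"
    by (simp add: ennreal_suminf_multc one)
  also have "\<dots> = (\<Sum>n. \<integral>\<^sup>+s. indicator (cube (pt (?e n))) s * g s \<partial>lborel)"
    by (intro nn_integral_suminf) measurable
  also have "\<dots> = (\<Sum>n. \<integral>\<^sup>+s. indicator (cube 0) s * g (s + pt (?e n)) \<partial>lborel)"
  proof (intro arg_cong[where f = suminf] ext)
    fix n
    have "(\<integral>\<^sup>+s. indicator (cube (pt (?e n))) s * g s \<partial>lborel) = (\<integral>\<^sup>+s. indicator (cube (pt (?e n))) s * g s \<partial>distr lborel borel ((+) (pt (?e n))))"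
      by (simp add: lborel_distr_plus)
    also have "\<dots> = (\<integral>\<^sup>+s. indicator (cube (pt (?e n))) (pt (?e n) + s) * g (pt (?e n) + s) \<partial>lborel)"
      by (intro nn_integral_distr) measurable
    also have "\<dots> = (\<integral>\<^sup>+s. indicator (cube 0) s * g (s + pt (?e n)) \<partial>lborel)"
      by (intro nn_integral_cong) (auto simp: indicator_def mem_cube add.commute)
    finally show "(\<integral>\<^sup>+s. indicator (cube (pt (?e n))) s * g s \<partial>lborel) = (\<integral>\<^sup>+s. indicator (cube 0) s * g (s + pt (?e n)) \<partial>lborel)" .
  qed
  also have "\<dots> = (\<integral>\<^sup>+s. (\<Sum>n. indicator (cube 0) s * g (s + pt (?e n))) \<partial>lborel)"
    by (intro nn_integral_suminf[symmetric]) measurable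
  finally show ?thesis by (simp add: ennreal_suminf_cmult)
qed

text \<open>For fixed s the values of the transform at s plus the integer points are the Fourier
  coefficients on the cube of h multiplied by a unimodular function. Bessel bounds the sum of their
  squares by the norm of h, and integrating over s in a cube of volume 1 gives the claim.\<close>

lemma fourier_L2_bound:
  fixes h :: "real^'n \<Rightarrow> complex"
  assumes h: "h \<in> sqi lborel" and zero: "\<And>u. u \<notin> cube 0 \<Longrightarrow> h u = 0"
    and meas: "(\<lambda>s. \<integral>u. h u * cnj (chr s u) \<partial>lborel) \<in> borel_measurable borel"
  shows "(\<integral>\<^sup>+s. ennreal ((cmod (\<integral>u. h u * cnj (chr s u) \<partial>lborel))\<^sup>2) \<partial>lborel) \<le> ennreal (nsq lborel h)"
proof -
  let ?e = "from_nat_into (UNIV :: ('n \<Rightarrow> int) set)"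
  have inj: "inj ?e" using bij_int_fun by (rule bij_is_inj)
  let ?g = "\<lambda>s. ennreal ((cmod (\<integral>u. h u * cnj (chr s u) \<partial>lborel))\<^sup>2)"
  have bound: "(\<Sum>n. ?g (s + pt (?e n))) \<le> ennreal (nsq lborel h)" for s
  proof (rule suminf_le_const)
    fix N
    define H where "H u = h u * cnj (chr s u)" for u
    have hm [measurable]: "h \<in> borel_measurable borel" using h by (simp add: sqi_def)
    have HH: "(cmod (H u))\<^sup>2 = (cmod (h u))\<^sup>2" for u by (simp add: H_def norm_mult)
    have Hm: "H \<in> borel_measurable borel" unfolding H_def by measurable
    then have Hs: "H \<in> sqi lborel" using h HH by (simp add: sqi_def)
    have nH: "nsq lborel H = nsq lborel h" by (simp add: nsq_def HH)
    have "(\<integral>u. h u * cnj (chr (s + pt (?e n)) u) \<partial>lborel) = ip lborel H (bas (?e n, \<lambda>_. 0))" for n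
    proof -
      have "h u * cnj (chr (s + pt (?e n)) u) = H u * cnj (bas (?e n, \<lambda>_. 0) u)" for u
        using zero[of u] by (cases "u \<in> cube 0") (simp_all add: H_def bas_def chr_add pt_0)
      then show ?thesis by (simp add: ip_def)
    qed
    then have "(\<Sum>n<N. ?g (s + pt (?e n))) = (\<Sum>n<N. ennreal ((cmod (ip lborel H (bas (?e n, \<lambda>_. 0))))\<^sup>2))" by simp
    also have "\<dots> = ennreal (\<Sum>n<N. (cmod (ip lborel H (bas (?e n, \<lambda>_. 0))))\<^sup>2)" by simp
    also have "\<dots> \<le> ennreal (nsq lborel H)"
    proof (intro ennreal_leI Bessel Hs)
      show "ip lborel (bas (?e i, \<lambda>_. 0) :: real^'n \<Rightarrow> complex) (bas (?e j, \<lambda>_. 0)) = (if i = j then 1 else 0)" for i j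
        unfolding bas_orthonormal(2) prod.inject inj_eq[OF inj] by simp
    qed (simp, rule bas_orthonormal(1))
    finally show "(\<Sum>n<N. ?g (s + pt (?e n))) \<le> ennreal (nsq lborel h)" by (simp only: nH)
  qed simp
  have gm: "?g \<in> borel_measurable borel"
  proof -
    have "(\<lambda>z::complex. ennreal ((cmod z)\<^sup>2)) \<in> borel_measurable borel" by measurable
    from measurable_compose[OF meas this] show ?thesis .
  qed
  have "(\<integral>\<^sup>+s. ?g s \<partial>lborel) = (\<integral>\<^sup>+s. indicator (cube 0) s * (\<Sum>n. ?g (s + pt (?e n))) \<partial>lborel)"
    by (rule nn_integral_cubes[OF gm])
  also have "\<dots> \<le> (\<integral>\<^sup>+s. ennreal (nsq lborel h) * indicator (cube (0 :: real^'n)) s \<partial>lborel)"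
  proof (intro nn_integral_mono)
    fix s :: "real^'n"
    have "indicator (cube 0) s * x \<le> y * indicator (cube 0) s" if "x \<le> y" for x y :: ennreal
      using that by (cases "s \<in> cube 0") simp_all
    then show "indicator (cube 0) s * (\<Sum>n. ?g (s + pt (?e n))) \<le> ennreal (nsq lborel h) * indicator (cube 0) s"
      using bound by blast
  qed
  also have "\<dots> = ennreal (nsq lborel h) * emeasure lborel (cube (0 :: real^'n))"
    by (subst nn_integral_cmult_indicator) auto
  also have "emeasure lborel (cube (0 :: real^'n)) = 1"
  proof -
    have "emeasure lborel (cube (0 :: real^'n)) = (\<integral>\<^sup>+s. indicator (cube (0 :: real^'n)) s \<partial>lborel)"
      by (rule nn_integral_indicator[symmetric]) simp
    also have "\<dots> = (\<integral>\<^sup>+s. (\<Prod>b\<in>Basis. indicator {0..<1} (s \<bullet> b)) \<partial>(lborel :: (real^'n) measure))"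
      by (intro nn_integral_cong) (simp add: cube_indicator)
    also have "\<dots> = (\<Prod>b\<in>(Basis :: (real^'n) set). \<integral>\<^sup>+x. indicator {0..<1::real} x \<partial>lborel)"
      by (rule nn_integral_lborel_prod) auto
    finally show ?thesis by simp
  qed
  finally show ?thesis by simp
qed

section \<open>The representation\<close>

definition d5 :: "5 \<Rightarrow> nat" where "d5 i = nat (Rep_bit1 i) + 1"

lemma d5_le_iff: "d5 i \<le> d5 j \<longleftrightarrow> i \<le> j"
proof -
  have r: "Rep_bit1 i \<in> {0..<5}" for i :: 5
    using Rep_bit1[of i] by simp
  show ?thesis using r[of i] r[of j] by (auto simp: d5_def less_eq_bit1_def nat_le_eq_zle)
qed

lemma inj_d5: "inj d5"
  by (metis d5_le_iff injI order_antisym order_refl)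

lemma d5_less_iff: "d5 i < d5 j \<longleftrightarrow> i < j"
  by (metis d5_le_iff linorder_not_le)

lemma range_d5: "range d5 = {1..5}"
proof -
  have "1 \<le> d5 i \<and> d5 i \<le> 5" for i :: 5
    using Rep_bit1[of i] by (auto simp: d5_def nat_le_iff)
  then have "range d5 \<subseteq> {1..5}"
    by auto
  moreover have "card (range d5) = 5"
    using card_image[OF inj_d5] by simp
  ultimately show ?thesis
    by (intro card_subset_eq) auto
qed

lemma d5_bounds: "1 \<le> d5 i" "d5 i \<le> 5"
  using range_d5 by auto

definition i5 :: "nat \<Rightarrow> 5" where "i5 = inv d5"

lemma i5_d5 [simp]: "i5 (d5 i) = i"
  by (simp add: i5_def inj_d5)

lemma d5_i5: "1 \<le> k \<Longrightarrow> k \<le> 5 \<Longrightarrow> d5 (i5 k) = k"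
  unfolding i5_def by (rule f_inv_into_f) (simp add: range_d5)

lemma sum_d5: "(\<Sum>i\<in>UNIV. f (d5 i)) = f 1 + f 2 + f 3 + f 4 + f 5" for f :: "nat \<Rightarrow> 'a::comm_monoid_add"
proof -
  have "(\<Sum>i\<in>UNIV. f (d5 i)) = sum f {1..5}" using sum.reindex[OF inj_d5, of f] by (simp add: range_d5)
  also have "{1..5::nat} = {1,2,3,4,5}" by (rule set_eqI) (simp, arith)
  finally show ?thesis by (simp add: add.assoc)
qed

lemma sum_split: "(\<Sum>k\<in>UNIV. f k) = (\<Sum>i\<in>UNIV. f (ix (d5 i))) + (\<Sum>i\<in>UNIV. f (ix (11 - d5 i))) + f (ix 11)"
  for f :: "11 \<Rightarrow> 'a::comm_monoid_add"
  unfolding sum_ix sum11 sum_d5[of "\<lambda>k. f (ix k)"] sum_d5[of "\<lambda>k. f (ix (11 - k))"] by (simp add: ac_simps)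

lemma ix_d5: "idx (ix (d5 i)) = d5 i" "idx (ix (11 - d5 i)) = 11 - d5 i"
  using d5_bounds[of i] by simp_all

text \<open>The entries 6 to 10 are listed backwards, u_i being entry 11 - i: index i then refers to
  the dual weights i and 11 - i, and the linear parts of the maps below are triangular.\<close>

definition rowpu :: "real^5 \<Rightarrow> real^5 \<Rightarrow> real^11" where
  "rowpu p u = (\<chi> j. if idx j = 11 then 1 else if 6 \<le> idx j then u $ i5 (11 - idx j) else p $ i5 (idx j))"

definition upart :: "real^11 \<Rightarrow> real^5" where "upart \<xi> = (\<chi> i. \<xi> $ ix (11 - d5 i))"
definition ppart :: "real^11 \<Rightarrow> real^5" where "ppart \<xi> = (\<chi> i. \<xi> $ ix (d5 i))"

abbreviation rowu :: "real^5 \<Rightarrow> real^11" where "rowu u \<equiv> rowpu 0 u"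

lemma rowpu_nth: "rowpu p u $ ix 11 = 1" "rowpu p u $ ix (d5 i) = p $ i" "rowpu p u $ ix (11 - d5 i) = u $ i"
  using d5_bounds[of i] by (auto simp: rowpu_def ix_d5)

lemma vec11_eqI: assumes "\<And>i. x $ ix (d5 i) = y $ ix (d5 i)" "\<And>i. x $ ix (11 - d5 i) = y $ ix (11 - d5 i)" "x $ ix 11 = y $ ix 11"
  shows "x = (y :: 'a^11)"
proof (rule vec_eq_iff[THEN iffD2], rule allI)
  fix j :: 11
  consider "idx j = 11" | "6 \<le> idx j" "idx j \<le> 10" | "1 \<le> idx j" "idx j \<le> 5" using idx_ge_1[of j] idx_le_11[of j] by linarith
  then show "x $ j = y $ j"
  proof cases
    case 1 then show ?thesis using assms(3) by (metis ix_idx)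
  next
    case 2
    then have "ix (11 - d5 (i5 (11 - idx j))) = j" by (simp add: d5_i5)
    then show ?thesis using assms(2)[of "i5 (11 - idx j)"] by simp
  next
    case 3
    then have "ix (d5 (i5 (idx j))) = j" by (simp add: d5_i5)
    then show ?thesis using assms(1)[of "i5 (idx j)"] by simp
  qed
qed

lemma rowpu_parts: "\<xi> $ ix 11 = 1 \<Longrightarrow> rowpu (ppart \<xi>) (upart \<xi>) = \<xi>"
  by (rule vec11_eqI) (simp_all add: rowpu_nth ppart_def upart_def)

lemma upart_rowpu [simp]: "upart (rowpu p u) = u" and ppart_rowpu [simp]: "ppart (rowpu p u) = p"
  by (simp_all add: upart_def ppart_def rowpu_nth vec_eq_iff)

lemma rowpu_linear_cont: "continuous_on S f \<Longrightarrow> continuous_on S g \<Longrightarrow> continuous_on S (\<lambda>x. rowpu (f x) (g x))"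
  unfolding rowpu_def
proof (rule continuous_on_vec_lambda)
  fix j assume "continuous_on S f" "continuous_on S g"
  then show "continuous_on S (\<lambda>x. if idx j = 11 then 1 else if 6 \<le> idx j then g x $ i5 (11 - idx j) else f x $ i5 (idx j))"
    by (cases "idx j = 11"; cases "6 \<le> idx j"; simp) (intro continuous_intros; assumption)+
qed

lemma upart_cont: "continuous_on S f \<Longrightarrow> continuous_on S (\<lambda>x. upart (f x))"
  and ppart_cont: "continuous_on S f \<Longrightarrow> continuous_on S (\<lambda>x. ppart (f x))"
  unfolding upart_def ppart_def by (intro continuous_on_vec_lambda continuous_intros; assumption)+

lemma lrow_eq: "lrow = rowu 0"
proof -
  have "ix (d5 i) \<noteq> ix 11" "ix (11 - d5 i) \<noteq> ix 11" for i
    using d5_bounds[of i] by simp_all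
  then show ?thesis by (intro vec11_eqI) (simp_all add: rowpu_nth axis_def)
qed

definition act :: "real^11^11 \<Rightarrow> real^5 \<Rightarrow> real^5" where
  "act g u = upart (rowu u v* g)"

definition low :: "real^11^11 \<Rightarrow> bool" where
  "low g \<longleftrightarrow> (\<forall>k j. idx k < idx j \<longrightarrow> g $ k $ j = 0) \<and> (\<forall>k. g $ k $ k = 1)"

lemma low_E: "low (E a b x)"
  by (simp add: low_def E_lower E_diag)

text \<open>Column j of a lower triangular matrix starts at row j, so entries 6 to 10 of the product
  see only entries 6 to 11 of the row. Hence \<open>act\<close> may use any row over u.\<close>

lemma upart_mult:
  assumes "low g" "\<xi> $ ix 11 = \<eta> $ ix 11" "upart \<xi> = upart \<eta>"
  shows "upart (\<xi> v* g) = upart (\<eta> v* g)"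
proof -
  have "(\<xi> v* g) $ ix (11 - d5 i) = (\<eta> v* g) $ ix (11 - d5 i)" for i
  proof -
    have "g $ ix (d5 j) $ ix (11 - d5 i) = 0" for j
      using assms(1) d5_bounds[of i] d5_bounds[of j] by (simp add: low_def ix_d5)
    moreover have "\<xi> $ ix (11 - d5 j) = \<eta> $ ix (11 - d5 j)" for j
      using assms(3) by (simp add: upart_def vec_eq_iff)
    ultimately show ?thesis using assms(2) by (simp add: vector_matrix_mult_def sum_split)
  qed
  then show ?thesis by (simp add: upart_def)
qed

lemma upart_act: "low g \<Longrightarrow> \<xi> $ ix 11 = 1 \<Longrightarrow> upart (\<xi> v* g) = act g (upart \<xi>)"
  unfolding act_def by (intro upart_mult) (simp_all add: rowpu_nth)

lemma act_mult: "act (E a b x ** E a b y) u = act (E a b y) (act (E a b x) u)"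
  unfolding act_def[of "E a b x ** E a b y"] vector_matrix_mul_assoc[symmetric]
  by (subst upart_act[OF low_E]) (simp_all add: row_E_11 rowpu_nth act_def)

lemma act_1 [simp]: "act (mat 1) u = u"
  by (simp add: act_def)

lemma act_minus: "act (E a b (- x)) (act (E a b x) u) = u" "act (E a b x) (act (E a b (- x)) u) = u"
  by (simp_all add: E_minus_left E_minus_right flip: act_mult)

lemma act_cont: "continuous_on S X \<Longrightarrow> continuous_on S f \<Longrightarrow> continuous_on S (\<lambda>p. act (E a b (X p)) (f p))"
  unfolding act_def by (intro upart_cont vm.continuous_on rowpu_linear_cont continuous_E_comp continuous_intros)

text \<open>Parameters that agree below coordinate 6 give exponentials that agree in the columns 6
  to 10, where no index difference reaches 6. So the action on u depends only on the first five
  coordinates, and the ideal acts trivially.\<close>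

lemma act_cong:
  assumes "supp_ge 6 (x - y)" shows "act (E a b x) = act (E a b y)"
proof
  fix u
  have "E a b x $ k $ ix (11 - d5 i) = E a b y $ k $ ix (11 - d5 i)" for k i
  proof -
    have j: "6 \<le> idx (ix (11 - d5 i))" using d5_bounds[of i] by (simp add: ix_d5)
    have "E a b x $ k $ ix (11 - d5 i) - E a b y $ k $ ix (11 - d5 i) = ad_mat a b (x - y) $ k $ ix (11 - d5 i)"
      using j idx_le_11[of k] by (intro agree_E[OF assms]) simp
    also have "\<dots> = 0"
      using j idx_le_11[of k] by (intro gradedD[OF graded_ad[OF assms]]) simp
    finally show ?thesis by simp
  qed
  then show "act (E a b x) u = act (E a b y) u" by (simp add: act_def upart_def vector_matrix_mult_def)
qed

section \<open>Affine form of the action and invariance of Lebesgue measure\<close>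

lemma act_affine:
  "act g u = (\<chi> i j. g $ ix (11 - d5 j) $ ix (11 - d5 i)) *v u + (\<chi> i. g $ ix 11 $ ix (11 - d5 i))"
  by (simp add: act_def upart_def vec_eq_iff vector_matrix_mult_def matrix_vector_mult_def sum_split rowpu_nth mult.commute)

lemma ppart_affine:
  "ppart (rowpu p u v* g) = (\<chi> i j. g $ ix (d5 j) $ ix (d5 i)) *v p + ppart (rowpu 0 u v* g)"
  by (simp add: ppart_def vec_eq_iff vector_matrix_mult_def matrix_vector_mult_def sum_split rowpu_nth mult.commute)

lemma det_act: assumes "low g" shows "det (\<chi> i j. g $ ix (11 - d5 j) $ ix (11 - d5 i)) = 1"
proof (subst det_lowerdiagonal)
  show "(\<chi> i j. g $ ix (11 - d5 j) $ ix (11 - d5 i)) $ i $ j = 0" if "i < j" for i j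
    using assms that d5_bounds[of i] d5_bounds[of j] by (simp add: low_def ix_d5 flip: d5_less_iff)
qed (use assms in \<open>simp add: low_def\<close>)

lemma det_ppart: assumes "low g" shows "det (\<chi> i j. g $ ix (d5 j) $ ix (d5 i)) = 1"
proof (subst det_upperdiagonal)
  show "(\<chi> i j. g $ ix (d5 j) $ ix (d5 i)) $ i $ j = 0" if "j < i" for i j
    using assms that by (simp add: low_def ix_d5 d5_less_iff)
qed (use assms in \<open>simp add: low_def\<close>)

lemma lborel_affine_matrix:
  fixes M :: "real^'n::{finite,wellorder}^'n::_"
  assumes "det M \<noteq> 0"
  shows "lborel = density (distr lborel borel (\<lambda>u. M *v u + c)) (\<lambda>_. ennreal \<bar>det M\<bar>)"
proof (rule lborel_eqI)
  let ?T = "\<lambda>u. M *v u + c"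
  have T [measurable]: "?T \<in> borel_measurable borel"
    by (intro borel_measurable_continuous_onI continuous_intros mv.continuous_on)
  show "sets (density (distr lborel borel ?T) (\<lambda>_. ennreal \<bar>det M\<bar>)) = sets borel" by simp
  fix l u :: "real^'n::_" assume lu: "\<And>b. b \<in> Basis \<Longrightarrow> l \<bullet> b \<le> u \<bullet> b"
  obtain N where N: "M ** N = mat 1" "N ** M = mat 1" using assms invertible_det_nz[of M] by (auto simp: invertible_def)
  have detN: "det N = 1 / det M" using det_mul[of M N] N assms by (simp add: field_simps)
  have pre: "?T -` box l u = (*v) N ` box (l - c) (u - c)"
  proof (intro set_eqI iffI)
    fix x assume "x \<in> ?T -` box l u"
    then have "M *v x \<in> box (l - c) (u - c)" by (simp add: mem_box inner_diff_left inner_add_left algebra_simps)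
    moreover have "x = N *v (M *v x)" by (simp add: matrix_vector_mul_assoc N)
    ultimately show "x \<in> (*v) N ` box (l - c) (u - c)" by blast
  next
    fix x assume "x \<in> (*v) N ` box (l - c) (u - c)"
    then obtain y where y: "y \<in> box (l - c) (u - c)" "x = N *v y" by blast
    then have "M *v x = y" by (simp add: matrix_vector_mul_assoc N)
    then show "x \<in> ?T -` box l u" using y(1) by (simp add: mem_box inner_diff_left inner_add_left algebra_simps)
  qed
  have lin: "linear ((*v) N)" by (rule matrix_vector_mul_linear)
  have lm: "(*v) N ` box (l - c) (u - c) \<in> lmeasurable" by (intro measurable_linear_image lin) simp
  have bs: "(*v) N ` box (l - c) (u - c) \<in> sets borel"
    unfolding pre[symmetric] using measurable_sets[OF T, of "box l u"] by simp
  have "emeasure lborel ((*v) N ` box (l - c) (u - c)) = ennreal (measure lebesgue ((*v) N ` box (l - c) (u - c)))"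
    using emeasure_eq_measure2[OF lm] emeasure_completion[of _ lborel] bs by simp
  also have "measure lebesgue ((*v) N ` box (l - c) (u - c)) = \<bar>det (matrix ((*v) N))\<bar> * measure lebesgue (box (l - c) (u - c))"
    by (intro measure_linear_image lin) simp
  also have "measure lebesgue (box (l - c) (u - c)) = (\<Prod>b\<in>Basis. (u - l) \<bullet> b)"
    using lu by (simp add: measure_lborel_box_eq inner_diff_left)
  finally have "emeasure lborel (?T -` box l u) = ennreal (\<bar>1 / det M\<bar> * (\<Prod>b\<in>Basis. (u - l) \<bullet> b))"
    by (simp only: pre matrix_of_matrix_vector_mul detN)
  then have "emeasure (density (distr lborel borel ?T) (\<lambda>_. ennreal \<bar>det M\<bar>)) (box l u)
     = ennreal \<bar>det M\<bar> * ennreal (\<bar>1 / det M\<bar> * (\<Prod>b\<in>Basis. (u - l) \<bullet> b))"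
    by (simp add: emeasure_density_const emeasure_distr)
  also have "\<dots> = ennreal (\<Prod>b\<in>Basis. (u - l) \<bullet> b)"
    using assms by (simp add: ennreal_mult'[symmetric] abs_divide)
  finally show "emeasure (density (distr lborel borel ?T) (\<lambda>_. ennreal \<bar>det M\<bar>)) (box l u) = (\<Prod>b\<in>Basis. (u - l) \<bullet> b)" .
qed

lemma nn_integral_affine_matrix:
  fixes M :: "real^'n::{finite,wellorder}^'n::_"
  assumes "det M \<noteq> 0" and [measurable]: "f \<in> borel_measurable borel"
  shows "(\<integral>\<^sup>+u. f u \<partial>lborel) = ennreal \<bar>det M\<bar> * (\<integral>\<^sup>+u. f (M *v u + c) \<partial>lborel)"
proof -
  have T [measurable]: "(\<lambda>u. M *v u + c) \<in> borel_measurable borel"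
    by (intro borel_measurable_continuous_onI continuous_intros mv.continuous_on)
  show ?thesis
    by (subst lborel_affine_matrix[OF assms(1), of c])
      (simp add: nn_integral_density nn_integral_cmult nn_integral_distr)
qed

lemma distr_affine_matrix:
  fixes M :: "real^'n::{finite,wellorder}^'n::_"
  assumes "det M = 1" shows "distr lborel borel (\<lambda>u. M *v u + c) = lborel"
  using lborel_affine_matrix[of M c] assms by (simp add: density_1)

lemma distr_act: "distr lborel borel (act (E a b x)) = lborel"
  unfolding act_affine[abs_def] by (rule distr_affine_matrix[OF det_act[OF low_E]])

lemma upart_nth: assumes "upart \<xi> = upart \<eta>" "6 \<le> k" "k \<le> 10" shows "\<xi> $ ix k = \<eta> $ ix k"
proof -
  have "11 - d5 (i5 (11 - k)) = k" using assms by (simp add: d5_i5)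
  moreover have "upart \<xi> $ i5 (11 - k) = upart \<eta> $ i5 (11 - k)" using assms by simp
  ultimately show ?thesis by (simp add: upart_def)
qed

text \<open>Every cocycle value is a function of the entries 6 to 11 alone; therefore the phase
  descends to the quotient with coordinate u.\<close>

lemma phi_upart: assumes "upart \<xi> = upart \<eta>" "\<xi> $ ix 11 = \<eta> $ ix 11" shows "phi a b x \<xi> = phi a b x \<eta>"
proof -
  have e: "\<xi> $ ix k = \<eta> $ ix k" if "6 \<le> k" "k \<le> 11" for k
    using upart_nth[OF assms(1), of k] assms(2) that by (cases "k = 11") auto
  have "Fn a b m \<xi> = Fn a b m \<eta>" if "1 \<le> m" "m \<le> 11" for m
  proof (cases "6 \<le> m")
    case False
    then have "m = 1 \<or> m = 2 \<or> m = 3 \<or> m = 4 \<or> m = 5" using that by arith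
    then show ?thesis by (elim disjE) (simp_all add: Fn_def e)
  qed (use that in \<open>simp add: Fn_top e\<close>)
  then show ?thesis using idx_ge_1 idx_le_11 by (simp add: phi_def)
qed

lemma theta_upart: assumes "upart \<xi> = upart \<eta>" "\<xi> $ ix 11 = \<eta> $ ix 11" shows "theta a b x \<xi> = theta a b x \<eta>"
proof -
  have "phi a b x (\<xi> v* E a b y) = phi a b x (\<eta> v* E a b y)" for y
    using assms by (intro phi_upart upart_mult low_E) (simp_all add: row_E_11)
  then show ?thesis by (simp add: theta_def)
qed

definition Th :: "real \<Rightarrow> real \<Rightarrow> real^11 \<Rightarrow> real^5 \<Rightarrow> real" where
  "Th a b x u = theta a b x (rowu u)"

text \<open>Since matrices act on rows from the right, pulling back along \<open>act\<close>
  respects the order of products: the operator of a product applies that of the second factor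
  first.\<close>

definition Uop :: "real \<Rightarrow> real \<Rightarrow> real^11 \<Rightarrow> (real^5 \<Rightarrow> complex) \<Rightarrow> real^5 \<Rightarrow> complex" where
  "Uop a b x F u = cis (2 * pi * Th a b x u) * F (act (E a b x) u)"

lemma Th_cont: "continuous_on S X \<Longrightarrow> continuous_on S f \<Longrightarrow> continuous_on S (\<lambda>p. Th a b (X p) (f p))"
  unfolding Th_def by (intro theta_continuous rowpu_linear_cont continuous_intros)

lemma Th_mult:
  assumes "E a b x ** E a b y = E a b z"
  shows "Th a b x u + Th a b y (act (E a b x) u) - Th a b z u = Th a b x 0 + Th a b y (act (E a b x) 0) - Th a b z 0"
proof -
  have "theta a b y (rowu v v* E a b x) = Th a b y (act (E a b x) v)" for v
    unfolding Th_def by (rule theta_upart) (simp_all add: act_def row_E_11 rowpu_nth)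
  then show ?thesis
    using theta_mult[OF assms rowpu_nth(1)[of 0 u] rowpu_nth(1)[of 0 0]] by (simp add: Th_def)
qed

lemma Uop_mult:
  assumes "E a b x ** E a b y = E a b z"
  obtains c where "cmod c = 1" "\<And>F u. Uop a b z F u = c * Uop a b x (Uop a b y F) u"
proof
  \<comment> \<open>The defect of the phases, which \<open>Th_mult\<close> shows to be the same at
    every u; it is read off at u = 0.\<close>
  define k where "k = Th a b x 0 + Th a b y (act (E a b x) 0) - Th a b z 0"
  show "cmod (cis (- (2 * pi * k))) = 1" by simp
  fix F u
  have "Th a b z u = Th a b x u + Th a b y (act (E a b x) u) - k"
    using Th_mult[OF assms, of u] by (simp add: k_def)
  then have "cis (2 * pi * Th a b z u) = cis (- (2 * pi * k)) * (cis (2 * pi * Th a b x u) * cis (2 * pi * Th a b y (act (E a b x) u)))"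
    by (simp only:) (simp add: cis_mult algebra_simps)
  moreover have "act (E a b z) u = act (E a b y) (act (E a b x) u)" by (simp add: assms[symmetric] act_mult)
  ultimately show "Uop a b z F u = cis (- (2 * pi * k)) * Uop a b x (Uop a b y F) u" by (simp add: Uop_def)
qed

abbreviation LM :: "(real^5) measure" where "LM \<equiv> lborel"

lemma act_measurable [measurable]: "act (E a b x) \<in> borel_measurable borel"
  by (intro borel_measurable_continuous_onI act_cont continuous_intros)

lemma Uop_measurable: "F \<in> borel_measurable borel \<Longrightarrow> Uop a b x F \<in> borel_measurable borel"
proof -
  assume [measurable]: "F \<in> borel_measurable borel"
  have [measurable]: "(\<lambda>u. cis (2 * pi * Th a b x u)) \<in> borel_measurable borel"
    by (intro borel_measurable_continuous_onI continuous_intros Th_cont)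
  show ?thesis unfolding Uop_def[abs_def] by measurable
qed

lemma integral_act:
  fixes f :: "real^5 \<Rightarrow> 'a::{banach, second_countable_topology}"
  assumes "f \<in> borel_measurable borel"
  shows "(\<integral>u. f (act (E a b x) u) \<partial>LM) = (\<integral>u. f u \<partial>LM)" "integrable LM (\<lambda>u. f (act (E a b x) u)) \<longleftrightarrow> integrable LM f"
  using integral_distr[of "act (E a b x)" LM borel f] integrable_distr_eq[of "act (E a b x)" LM borel f] assms
  by (simp_all add: distr_act)

lemma AE_act: assumes "AE u in LM. P u" "{u. P u} \<in> sets borel" shows "AE u in LM. P (act (E a b x) u)"
proof -
  have "AE u in distr LM borel (act (E a b x)). P u" unfolding distr_act by (rule assms(1))
  then show ?thesis using assms(2) by (subst (asm) AE_distr_iff) auto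
qed

lemma Uop_sqi: assumes F: "F \<in> sqi LM" shows "Uop a b x F \<in> sqi LM"
proof -
  have m: "F \<in> borel_measurable borel" using F by (simp add: sqi_def)
  have "integrable LM (\<lambda>u. (cmod (F (act (E a b x) u)))\<^sup>2)"
    using F m by (subst integral_act(2)) (auto simp: sqi_def)
  then show ?thesis using Uop_measurable[OF m] by (simp add: sqi_def Uop_def norm_mult)
qed

lemma Uop_ip: assumes F: "F \<in> sqi LM" and G: "G \<in> sqi LM" shows "ip LM (Uop a b x F) (Uop a b x G) = ip LM F G"
proof -
  have [measurable]: "F \<in> borel_measurable borel" "G \<in> borel_measurable borel" using F G by (simp_all add: sqi_def)
  have "Uop a b x F u * cnj (Uop a b x G u) = F (act (E a b x) u) * cnj (G (act (E a b x) u))" for u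
  proof -
    have "cis t * cnj (cis t) = 1" for t by (simp add: cis_cnj cis_mult)
    then show ?thesis by (simp add: Uop_def mult_ac)
  qed
  then have "ip LM (Uop a b x F) (Uop a b x G) = (\<integral>u. F (act (E a b x) u) * cnj (G (act (E a b x) u)) \<partial>LM)"
    by (simp add: ip_def)
  also have "\<dots> = ip LM F G" unfolding ip_def
    by (rule integral_act(1)[of "\<lambda>u. F u * cnj (G u)"]) measurable
  finally show ?thesis .
qed

lemma Uop_AE: assumes F: "F \<in> sqi LM" and G: "G \<in> sqi LM" and "AE u in LM. F u = G u" shows "AE u in LM. Uop a b x F u = Uop a b x G u"
proof -
  have [measurable]: "F \<in> borel_measurable borel" "G \<in> borel_measurable borel" using F G by (simp_all add: sqi_def)
  have "AE u in LM. F (act (E a b x) u) = G (act (E a b x) u)"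
    by (rule AE_act[OF assms(3)]) measurable
  then show ?thesis by eventually_elim (simp add: Uop_def)
qed

text \<open>A parameter of the identity may have a central component and hence a non-zero phase. The
  phase is constant in u by \<open>Th_mult\<close> applied to the product of the element with
  itself.\<close>

lemma Uop_0: assumes "E a b x = mat 1" shows "Uop a b x F u = cis (2 * pi * Th a b x 0) * F u"
proof -
  have "Th a b x u + Th a b x u - Th a b x u = Th a b x 0 + Th a b x 0 - Th a b x 0"
    using Th_mult[of a b x x x u] assms by simp
  then show ?thesis by (simp add: Uop_def assms)
qed

section \<open>Transfer of the operators to l2\<close>

definition coords :: "(real^5 \<Rightarrow> complex) \<Rightarrow> nat \<Rightarrow> complex" where
  "coords F n = ip LM F (basn n)"

definition Wi :: "(nat \<Rightarrow> complex) \<Rightarrow> real^5 \<Rightarrow> complex" where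
  "Wi f = (SOME F. F \<in> sqi LM \<and> coords F = f)"

lemma Wi: assumes "f \<in> l2" shows "Wi f \<in> sqi LM" "coords (Wi f) = f"
proof -
  obtain F where "F \<in> sqi LM" "\<And>n. ip LM F (basn n) = f n"
    using onb_partial_sums[OF basn_onb assms] by blast
  then have "\<exists>F. F \<in> sqi LM \<and> coords F = f" by (auto simp: coords_def fun_eq_iff)
  then have "Wi f \<in> sqi LM \<and> coords (Wi f) = f" unfolding Wi_def by (rule someI_ex)
  then show "Wi f \<in> sqi LM" "coords (Wi f) = f" by auto
qed

lemma coords_l2: "F \<in> sqi LM \<Longrightarrow> coords F \<in> l2"
  unfolding coords_def[abs_def] by (rule onb_coord_l2[OF basn_onb])

lemma coords_inner: "F \<in> sqi LM \<Longrightarrow> G \<in> sqi LM \<Longrightarrow> l2_inner (coords F) (coords G) = ip LM F G"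
  unfolding coords_def[abs_def] by (rule onb_Parseval[OF basn_onb])

lemma basn_sqi: "basn n \<in> sqi LM"
  using basn_onb by (auto simp: onb_def)

lemma coords_eq_iff: assumes "F \<in> sqi LM" "G \<in> sqi LM" shows "coords F = coords G \<longleftrightarrow> (AE u in LM. F u = G u)"
proof
  assume "coords F = coords G"
  then show "AE u in LM. F u = G u"
    using onb_unique[OF basn_onb assms] by (simp add: coords_def fun_eq_iff)
next
  assume "AE u in LM. F u = G u"
  then show "coords F = coords G" unfolding coords_def fun_eq_iff using ip_cong_AE[OF assms basn_sqi] by blast
qed

lemma coords_lincomb: "F \<in> sqi LM \<Longrightarrow> G \<in> sqi LM \<Longrightarrow> coords (\<lambda>u. c * F u + G u) = (\<lambda>n. c * coords F n + coords G n)"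
  by (simp add: coords_def fun_eq_iff ip_lincomb basn_sqi)

lemma coords_scale: "coords (\<lambda>u. c * F u) = (\<lambda>n. c * coords F n)"
  by (simp add: coords_def fun_eq_iff ip_scale)

lemma Wi_coords: "F \<in> sqi LM \<Longrightarrow> AE u in LM. Wi (coords F) u = F u"
  using coords_eq_iff[of "Wi (coords F)" F] Wi[OF coords_l2[of F]] by simp

text \<open>A logarithm with coordinate 11 normalised to 0. It reads only the last row and is
  therefore continuous on all matrices, although it inverts the exponential only on
  \<open>GZ a b\<close>.\<close>

definition lg :: "real \<Rightarrow> real \<Rightarrow> real^11^11 \<Rightarrow> real^11" where
  "lg a b g = solve a b lrow (lrow v* g)"

definition rho :: "real \<Rightarrow> real \<Rightarrow> real^11^11 \<Rightarrow> (nat \<Rightarrow> complex) \<Rightarrow> nat \<Rightarrow> complex" where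
  "rho a b g f = coords (Uop a b (lg a b g) (Wi f))"

lemma GZ_E: "GZ a b = range (E a b)"
  by (auto simp: GZ_def E_def)

lemma lrow_11: "lrow $ ix 11 = 1" by (simp add: axis_def)

lemma E_lg: "g \<in> GZ a b \<Longrightarrow> E a b (lg a b g) = g"
proof -
  assume "g \<in> GZ a b"
  then obtain x where g: "g = E a b x" by (auto simp: GZ_E)
  show ?thesis unfolding g lg_def
    by (rule E_eqI) (rule row_solve, simp_all add: lrow_11 row_E_11)
qed

lemma GZ_mult: "g \<in> GZ a b \<Longrightarrow> h \<in> GZ a b \<Longrightarrow> g ** h \<in> GZ a b"
  unfolding GZ_E using E_mult by blast

lemma rho_l2: "f \<in> l2 \<Longrightarrow> rho a b g f \<in> l2"
  unfolding rho_def by (intro coords_l2 Uop_sqi Wi)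

lemma rho_coords: assumes "F \<in> sqi LM" shows "rho a b g (coords F) = coords (Uop a b (lg a b g) F)"
proof -
  have W: "Wi (coords F) \<in> sqi LM" by (intro Wi coords_l2 assms)
  show ?thesis
    unfolding rho_def coords_eq_iff[OF Uop_sqi[OF W] Uop_sqi[OF assms]]
    by (rule Uop_AE[OF W assms Wi_coords[OF assms]])
qed

lemma rho_mult:
  assumes "g \<in> GZ a b" "h \<in> GZ a b"
  obtains c where "cmod c = 1" "\<And>f. f \<in> l2 \<Longrightarrow> rho a b (g ** h) f = (\<lambda>n. c * rho a b g (rho a b h f) n)"
proof -
  have "E a b (lg a b g) ** E a b (lg a b h) = E a b (lg a b (g ** h))"
    using assms by (simp add: E_lg GZ_mult)
  then obtain c where c: "cmod c = 1" "\<And>F u. Uop a b (lg a b (g ** h)) F u = c * Uop a b (lg a b g) (Uop a b (lg a b h) F) u"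
    using Uop_mult by blast
  have "rho a b (g ** h) f = (\<lambda>n. c * rho a b g (rho a b h f) n)" if f: "f \<in> l2" for f
  proof -
    have "rho a b g (rho a b h f) = coords (Uop a b (lg a b g) (Uop a b (lg a b h) (Wi f)))"
      unfolding rho_def[of a b h f] by (intro rho_coords Uop_sqi Wi f)
    moreover have "Uop a b (lg a b (g ** h)) (Wi f) = (\<lambda>u. c * Uop a b (lg a b g) (Uop a b (lg a b h) (Wi f)) u)"
      using c(2) by auto
    ultimately show ?thesis unfolding rho_def[of a b "g ** h"] by (simp add: coords_scale)
  qed
  then show ?thesis using c(1) that by blast
qed

lemma rho_lincomb:
  assumes "f \<in> l2" "g \<in> l2"
  shows "rho a b x (\<lambda>n. c * f n + g n) = (\<lambda>n. c * rho a b x f n + rho a b x g n)"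
proof -
  have "(\<lambda>n. c * f n + g n) = coords (\<lambda>u. c * Wi f u + Wi g u)"
    using assms by (simp add: coords_lincomb Wi)
  then have "rho a b x (\<lambda>n. c * f n + g n) = coords (Uop a b (lg a b x) (\<lambda>u. c * Wi f u + Wi g u))"
    using assms by (simp add: rho_coords sqi_lincomb Wi)
  also have "Uop a b (lg a b x) (\<lambda>u. c * Wi f u + Wi g u) = (\<lambda>u. c * Uop a b (lg a b x) (Wi f) u + Uop a b (lg a b x) (Wi g) u)"
    by (simp add: Uop_def fun_eq_iff algebra_simps)
  finally show ?thesis using assms by (simp add: rho_def coords_lincomb Uop_sqi Wi)
qed

lemma rho_inner: assumes "f \<in> l2" "g \<in> l2" shows "l2_inner (rho a b x f) (rho a b x g) = l2_inner f g"
proof -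
  have "l2_inner (rho a b x f) (rho a b x g) = ip LM (Wi f) (Wi g)"
    using assms by (simp add: rho_def coords_inner Uop_sqi Wi Uop_ip)
  also have "\<dots> = l2_inner f g" using coords_inner[of "Wi f" "Wi g"] assms by (simp add: Wi)
  finally show ?thesis .
qed

lemma rho_1: "\<exists>c. cmod c = 1 \<and> (\<forall>f\<in>l2. rho a b (mat 1) f = (\<lambda>n. c * f n))"
proof -
  have "mat 1 \<in> GZ a b" using E_0 by (metis GZ_E rangeI)
  then have e: "E a b (lg a b (mat 1)) = mat 1" by (rule E_lg)
  have "Uop a b (lg a b (mat 1)) (Wi f) = (\<lambda>u. cis (2 * pi * Th a b (lg a b (mat 1)) 0) * Wi f u)" for f
    using Uop_0[OF e] by auto
  then have "rho a b (mat 1) f = (\<lambda>n. cis (2 * pi * Th a b (lg a b (mat 1)) 0) * f n)" if "f \<in> l2" for f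
    using that by (simp add: rho_def coords_scale Wi)
  then show ?thesis using norm_cis by blast
qed

lemma GZ_inverse: assumes "g \<in> GZ a b" obtains h where "h \<in> GZ a b" "g ** h = mat 1" "h ** g = mat 1"
proof -
  obtain x where "g = E a b x" using assms by (auto simp: GZ_E)
  then show ?thesis using that[of "E a b (- x)"] by (simp add: GZ_E E_minus_left E_minus_right)
qed

lemma rho_unitary: assumes g: "g \<in> GZ a b" shows "unitary_l2 (rho a b g)"
  unfolding unitary_l2_def
proof (intro conjI ballI allI)
  show "bij_betw (rho a b g) l2 l2"
    unfolding bij_betw_def
  proof
    obtain h where h: "h \<in> GZ a b" "g ** h = mat 1" "h ** g = mat 1" using GZ_inverse[OF g] .
    obtain c where c: "cmod c = 1" "\<And>f. f \<in> l2 \<Longrightarrow> rho a b (mat 1) f = (\<lambda>n. c * rho a b g (rho a b h f) n)"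
      using rho_mult[OF g h(1)] h(2) by metis
    obtain d where d: "cmod d = 1" "\<And>f. f \<in> l2 \<Longrightarrow> rho a b (mat 1) f = (\<lambda>n. d * rho a b h (rho a b g f) n)"
      using rho_mult[OF h(1) g] h(3) by metis
    have nz: "c \<noteq> 0" "d \<noteq> 0" using c(1) d(1) by auto
    show "inj_on (rho a b g) l2"
    proof (rule inj_onI)
      fix f f' assume f: "f \<in> l2" "f' \<in> l2" "rho a b g f = rho a b g f'"
      then have e: "rho a b (mat 1) f = rho a b (mat 1) f'" by (simp add: d(2))
      obtain k where "cmod k = 1" "\<forall>f\<in>l2. rho a b (mat 1) f = (\<lambda>n. k * f n)" using rho_1 by blast
      then show "f = f'" using e f by (auto simp: fun_eq_iff)
    qed
    show "rho a b g ` l2 = l2"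
    proof
      show "rho a b g ` l2 \<subseteq> l2" using rho_l2 by blast
      show "l2 \<subseteq> rho a b g ` l2"
      proof
        fix f assume f: "f \<in> l2"
        obtain e where e: "cmod e = 1" "rho a b (mat 1) f = (\<lambda>n. e * f n)" using rho_1 f by blast
        have "e \<noteq> 0" using e(1) by auto
        define k where "k = rho a b h f"
        have k: "k \<in> l2" unfolding k_def by (rule rho_l2[OF f])
        have z: "(\<lambda>_. 0) \<in> l2" by (simp add: l2_eq_sqi)
        have r0: "rho a b g (\<lambda>_. 0) = (\<lambda>_. 0)" using rho_lincomb[OF z z, of a b g "-1"] by (simp add: fun_eq_iff)
        \<comment> \<open>The inverse element gives the preimage up to two scalars: c from the
          product rule and e from the operator of the identity.\<close>
        have "rho a b g (\<lambda>n. (c / e) * k n + 0) = (\<lambda>n. (c / e) * rho a b g k n + rho a b g (\<lambda>_. 0) n)"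
          by (rule rho_lincomb[OF k z])
        also have "\<dots> = f" using c(2)[OF f] e(2) \<open>e \<noteq> 0\<close> by (auto simp: r0 k_def fun_eq_iff field_simps)
        finally have "f = rho a b g (\<lambda>n. (c / e) * k n + 0)" by simp
        moreover have "(\<lambda>n. (c / e) * k n + 0) \<in> l2" using k z unfolding l2_eq_sqi by (rule sqi_lincomb)
        ultimately show "f \<in> rho a b g ` l2" by blast
      qed
    qed
  qed
qed (simp_all add: rho_lincomb rho_inner)

lemma lg_cont: "continuous_on UNIV (lg a b)"
  unfolding lg_def[abs_def] by (intro continuous_solve vm.continuous_on continuous_intros)

lemma ip_Uop_measurable:
  assumes F: "F \<in> borel_measurable borel" and H: "H \<in> borel_measurable borel"
  shows "(\<lambda>x. ip LM (Uop a b x F) H) \<in> borel_measurable borel"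
proof -
  note [measurable] = F H
  have [measurable]: "(\<lambda>p. cis (2 * pi * Th a b (fst p) (snd p))) \<in> borel_measurable (borel \<Otimes>\<^sub>M borel)"
    unfolding borel_prod by (intro borel_measurable_continuous_onI continuous_intros Th_cont)
  have A [measurable]: "(\<lambda>p. act (E a b (fst p)) (snd p)) \<in> borel_measurable (borel \<Otimes>\<^sub>M borel)"
    unfolding borel_prod by (intro borel_measurable_continuous_onI continuous_intros act_cont)
  have "(\<lambda>p. Uop a b (fst p) F (snd p) * cnj (H (snd p))) \<in> borel_measurable (borel \<Otimes>\<^sub>M borel)"
    unfolding Uop_def by measurable
  then have "(\<lambda>(x, u). Uop a b x F u * cnj (H u)) \<in> borel_measurable (borel \<Otimes>\<^sub>M LM)"
    by (simp add: case_prod_beta' cong: measurable_cong_sets sets_pair_measure_cong)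
  from lborel.borel_measurable_lebesgue_integral[OF this] show ?thesis by (simp add: ip_def)
qed

lemma rho_inner_eq: "f \<in> l2 \<Longrightarrow> h \<in> l2 \<Longrightarrow> l2_inner (rho a b g f) h = ip LM (Uop a b (lg a b g) (Wi f)) (Wi h)"
  using coords_inner[of "Uop a b (lg a b g) (Wi f)" "Wi h"] by (simp add: rho_def Uop_sqi Wi)

lemma rho_proj_unitary_rep: "proj_unitary_rep (GZ a b) (rho a b)"
  unfolding proj_unitary_rep_def
proof (intro conjI ballI)
  show "unitary_l2 (rho a b x)" if "x \<in> GZ a b" for x using rho_unitary[OF that] .
  have "\<exists>c. cmod c = 1 \<and> (\<forall>f\<in>l2. rho a b (x ** y) f = (\<lambda>n. c * rho a b x (rho a b y f) n))"
    if "x \<in> GZ a b" "y \<in> GZ a b" for x y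
    using rho_mult[OF that] by metis
  then show "\<exists>c. \<forall>x\<in>GZ a b. \<forall>y\<in>GZ a b. cmod (c x y) = 1 \<and> (\<forall>f\<in>l2. rho a b (x ** y) f = (\<lambda>n. c x y * rho a b x (rho a b y f) n))"
    by (intro exI[of _ "\<lambda>x y. SOME c. cmod c = 1 \<and> (\<forall>f\<in>l2. rho a b (x ** y) f = (\<lambda>n. c * rho a b x (rho a b y f) n))"] ballI)
      (rule someI_ex)
  fix f h assume f: "f \<in> l2" and h: "h \<in> l2"
  have "(\<lambda>g. ip LM (Uop a b (lg a b g) (Wi f)) (Wi h)) \<in> borel_measurable borel"
    using measurable_compose[OF borel_measurable_continuous_onI[OF lg_cont] ip_Uop_measurable] Wi(1)[OF f] Wi(1)[OF h]
    by (simp add: sqi_def)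
  then show "(\<lambda>x. l2_inner (rho a b x f) h) \<in> borel_measurable (restrict_space borel (GZ a b))"
    using f h by (simp add: rho_inner_eq measurable_restrict_space1)
qed

section \<open>Irreducibility\<close>

definition yvec :: "real^5 \<Rightarrow> real^11" where
  "yvec v = (\<chi> j. if idx j \<le> 5 then v $ i5 (idx j) else 0)"

text \<open>The order is reversed as in \<open>rowpu\<close>, so that m becomes the frequency paired
  with u.\<close>

definition mvec :: "real^5 \<Rightarrow> real^11" where
  "mvec m = (\<chi> j. if 6 \<le> idx j \<and> idx j \<le> 10 then m $ i5 (11 - idx j) else 0)"

lemma mvec_nth: "mvec m $ ix (d5 i) = 0" "mvec m $ ix (11 - d5 i) = m $ i" "mvec m $ ix 11 = 0"
proof -
  have "6 \<le> 11 - d5 i" "11 - d5 i \<le> 10" using d5_bounds[of i] by arith+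
  then show "mvec m $ ix (d5 i) = 0" "mvec m $ ix (11 - d5 i) = m $ i" "mvec m $ ix 11 = 0"
    using d5_bounds[of i] by (simp_all add: mvec_def ix_d5)
qed

lemma supp_mvec: "supp_ge 6 (c *\<^sub>R mvec m)"
  by (simp add: supp_ge_def mvec_def)

lemma act_mvec: "act (E a b (c *\<^sub>R mvec m)) u = u"
  using act_cong[of "c *\<^sub>R mvec m" 0 a b] supp_mvec by simp

text \<open>The ideal does not move u, so phi is constant along its one-parameter groups and the
  integral is just the linear Hamiltonian m \<bullet> u. This is how the ideal comes to act by all
  characters.\<close>

lemma Th_mvec: "Th a b (mvec m) u = m \<bullet> u"
proof -
  have "phi a b (mvec m) (rowu u v* E a b (s *\<^sub>R mvec m)) = m \<bullet> u" for s
  proof -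
    have "phi a b (mvec m) (rowu u v* E a b (s *\<^sub>R mvec m)) = phi a b (mvec m) (rowu u)"
      using act_mvec[of a b s m u] by (intro phi_upart) (simp_all add: act_def row_E_11)
    also have "\<dots> = m \<bullet> u"
    proof -
      have "Fn a b (11 - d5 i) (rowu u) = u $ i" for i
        using d5_bounds[of i] by (simp add: Fn_top rowpu_nth)
      then show ?thesis by (simp add: phi_def sum_split mvec_nth ix_d5 inner_vec_def)
    qed
    finally show ?thesis .
  qed
  then show ?thesis by (simp add: Th_def theta_def)
qed

lemma Uop_mvec: "Uop a b (mvec m) F u = chr m u * F u"
  using act_mvec[of a b 1 m u] by (simp add: Uop_def Th_mvec chr_def)

text \<open>Transitivity on rows gives a suitable parameter; by \<open>act_cong\<close> its first
  five coordinates do the same.\<close>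

lemma act_onto: "\<exists>v. act (E a b (yvec v)) u = w"
proof -
  define x where "x = solve a b (rowu u) (rowu w)"
  define v where "v = (\<chi> i. x $ ix (d5 i))"
  have "act (E a b x) u = w"
    unfolding act_def x_def by (simp add: row_solve rowpu_nth)
  moreover have "supp_ge 6 (x - yvec v)"
    unfolding supp_ge_def
  proof safe
    fix i assume "idx i < 6"
    then have "ix (d5 (i5 (idx i))) = i" using idx_ge_1[of i] by (simp add: d5_i5)
    then show "(x - yvec v) $ i = 0" using \<open>idx i < 6\<close> by (simp add: v_def yvec_def)
  qed
  ultimately show ?thesis using act_cong by metis
qed

lemma linear_yvec: "linear yvec"
  by (rule linearI) (simp_all add: yvec_def vec_eq_iff)

lemma act_differentiable: "(\<lambda>v. act (E a b (yvec v)) u) differentiable (at v)"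
proof -
  have "(\<lambda>v. E a b (yvec v)) differentiable (at v)"
    using differentiable_chain_at[OF linear_imp_differentiable[OF linear_yvec] differentiable_E] by (simp add: o_def)
  then obtain D where "((\<lambda>v. E a b (yvec v)) has_derivative D) (at v)" by (auto simp: differentiable_def)
  from vm.FDERIV[OF has_derivative_const[of "rowu u"] this]
  have "(\<lambda>v. rowu u v* E a b (yvec v)) differentiable (at v)" unfolding differentiable_def by blast
  moreover have "linear upart" by (rule linearI) (simp_all add: upart_def vec_eq_iff)
  ultimately show ?thesis
    unfolding act_def using differentiable_chain_at[OF _ linear_imp_differentiable, of "\<lambda>v. rowu u v* E a b (yvec v)" v upart]
    by (simp add: o_def)
qed

lemma continuous_yvec: "continuous_on S yvec"
  using linear_yvec by (simp add: linear_continuous_on linear_conv_bounded_linear)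

lemma rho_irreducible: "irreducible_rep (GZ a b) (rho a b)"
  unfolding irreducible_rep_def
proof (intro allI impI, elim conjE)
  fix V assume V: "closed_l2_subspace V" and inv: "\<forall>x\<in>GZ a b. rho a b x ` V \<subseteq> V"
  show "V = {\<lambda>_. 0} \<or> V = l2"
  proof (rule ccontr)
    assume "\<not> ?thesis"
    then have ne: "V \<noteq> {\<lambda>_. 0}" "V \<noteq> l2" by auto
    have sub: "V \<subseteq> l2" "(\<lambda>_. 0) \<in> V" using V by (auto simp: closed_l2_subspace_def)
    obtain f where f: "f \<in> V" "f \<noteq> (\<lambda>_. 0)" using ne(1) sub(2) by blast
    obtain g where g: "g \<in> l2" "g \<noteq> (\<lambda>_. 0)" "\<And>v. v \<in> V \<Longrightarrow> l2_inner v g = 0"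
      using closed_l2_subspace_orthogonal[OF V ne(2)] by blast
    have fl: "f \<in> l2" using f sub by auto
    define F where "F = Wi f"
    define H where "H = Wi g"
    have F: "F \<in> sqi LM" "coords F = f" and H: "H \<in> sqi LM" "coords H = g"
      unfolding F_def H_def using Wi fl g(1) by auto
    have [measurable]: "F \<in> borel_measurable borel" "H \<in> borel_measurable borel" using F(1) H(1) by (simp_all add: sqi_def)
    have nz: "\<not> (AE u in LM. K u = 0)" if "K \<in> sqi LM" "coords K \<noteq> (\<lambda>_. 0)" for K
    proof
      assume "AE u in LM. K u = 0"
      then have "coords K = coords (\<lambda>_. 0)" using that(1) by (subst coords_eq_iff) auto
      also have "\<dots> = (\<lambda>_. 0)" by (simp add: coords_def ip_def fun_eq_iff)
      finally show False using that(2) by simp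
    qed
    have orth: "ip LM (Uop a b z F) H = 0" if "E a b z ** E a b 0 = g'" "g' \<in> GZ a b" "z = lg a b g'" for z g'
      using g(3)[of "rho a b g' f"] inv that f(1) rho_inner_eq[OF fl g(1), of a b g'] unfolding F_def H_def by auto
    \<comment> \<open>The invariant subspace is tested on the group elements exp(mvec m) exp(y),
      whose operators multiply the operator of y by the character m, up to a constant phase. All
      Fourier coefficients of one fixed product therefore vanish.\<close>
    have prod0: "AE u in LM. F (act (E a b y) u) * H u = 0" for y
    proof -
      have "ip LM (\<lambda>u. chr m u * Uop a b y F u) H = 0" for m
      proof -
        have gz: "E a b (mvec m) ** E a b y \<in> GZ a b" by (intro GZ_mult) (auto simp: GZ_E)
        define z where "z = lg a b (E a b (mvec m) ** E a b y)"
        have z: "E a b (mvec m) ** E a b y = E a b z" unfolding z_def by (rule E_lg[OF gz, symmetric])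
        obtain c where c: "cmod c = 1" "\<And>F u. Uop a b z F u = c * Uop a b (mvec m) (Uop a b y F) u"
          using Uop_mult[OF z] by blast
        have "0 = ip LM (Uop a b z F) H"
          by (rule orth[symmetric, OF _ gz z_def]) (simp add: z)
        also have "Uop a b z F = (\<lambda>u. c * (chr m u * Uop a b y F u))" using c(2) by (simp add: fun_eq_iff Uop_mvec)
        finally show ?thesis using c(1) by (auto simp: ip_scale)
      qed
      then have four: "(\<integral>u. Uop a b y F u * cnj (H u) * chr m u \<partial>LM) = 0" for m
        by (simp add: ip_def mult_ac)
      have "integrable LM (\<lambda>u. Uop a b y F u * cnj (H u))"
        by (intro sqi_prod_integrable Uop_sqi F H)
      from fourier_unique[OF this four] have "AE u in LM. Uop a b y F u * cnj (H u) = 0" .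
      then show ?thesis
      proof eventually_elim
        case (elim u)
        have "cis (2 * pi * Th a b y u) \<noteq> 0" by simp
        then show ?case using elim by (auto simp: Uop_def)
      qed
    qed
    \<comment> \<open>The exceptional null set in u depends on the group element. Fubini exchanges
      the quantifiers, so that one point u with H u \<noteq> 0 serves almost all v.\<close>
    have "AE u in LM. AE v in LM. F (act (E a b (yvec v)) u) * H u = 0"
    proof (subst lborel_pair.AE_commute)
      have A [measurable]: "(\<lambda>p. act (E a b (yvec (snd p))) (fst p)) \<in> borel_measurable (borel \<Otimes>\<^sub>M borel)"
        unfolding borel_prod
        by (intro borel_measurable_continuous_onI act_cont continuous_intros continuous_on_compose2[OF continuous_yvec[of UNIV]]) auto
      have [measurable]: "(\<lambda>p. F (act (E a b (yvec (snd p))) (fst p)) * H (fst p)) \<in> borel_measurable (borel \<Otimes>\<^sub>M borel)"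
        by measurable
      have "{p \<in> space (borel \<Otimes>\<^sub>M borel). F (act (E a b (yvec (snd p))) (fst p)) * H (fst p) = 0} \<in> sets (borel \<Otimes>\<^sub>M borel)"
        by measurable
      then show "{x \<in> space (LM \<Otimes>\<^sub>M LM). F (act (E a b (yvec (snd x))) (fst x)) * H (fst x) = 0} \<in> sets (LM \<Otimes>\<^sub>M LM)"
        by (simp add: space_pair_measure cong: sets_pair_measure_cong)
      show "AE v in LM. AE u in LM. F (act (E a b (yvec v)) u) * H u = 0"
        using prod0 by simp
    qed
    moreover have "\<not> (AE u in LM. H u = 0)" using nz[OF H(1)] H(2) g(2) by simp
    ultimately have "\<exists>u. H u \<noteq> 0 \<and> (AE v in LM. F (act (E a b (yvec v)) u) * H u = 0)"
    proof -
      assume 1: "AE u in LM. AE v in LM. F (act (E a b (yvec v)) u) * H u = 0" and 2: "\<not> (AE u in LM. H u = 0)"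
      show ?thesis
      proof (rule ccontr)
        assume "\<not> ?thesis"
        then have "AE u in LM. H u = 0" using 1 by (auto elim!: eventually_mono)
        then show False using 2 by simp
      qed
    qed
    then obtain u where u: "H u \<noteq> 0" "AE v in LM. F (act (E a b (yvec v)) u) * H u = 0" by blast
    \<comment> \<open>The orbit map of the chosen point. It is onto, and as a differentiable map
      between spaces of equal dimension it sends null sets to null sets; so the set where F is
      non-zero is null because its preimage is.\<close>
    define \<Psi> where "\<Psi> v = act (E a b (yvec v)) u" for v
    have \<Psi>m [measurable]: "\<Psi> \<in> borel_measurable borel"
      unfolding \<Psi>_def by (intro borel_measurable_continuous_onI act_cont continuous_intros continuous_yvec)
    define N where "N = {w. F w \<noteq> 0}"
    have Nb: "N \<in> sets borel" unfolding N_def by measurable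
    have "AE v in LM. \<Psi> v \<notin> N" using u(2) by eventually_elim (use u(1) in \<open>simp add: N_def \<Psi>_def\<close>)
    moreover have "{v. \<Psi> v \<in> N} \<in> sets borel" using measurable_sets[OF \<Psi>m Nb] by (simp add: vimage_def)
    ultimately have "{v. \<Psi> v \<in> N} \<in> null_sets LM"
      by (subst AE_iff_null_sets) auto
    then have neg: "negligible {v. \<Psi> v \<in> N}"
      using negligible_iff_null_sets null_sets_completionI by blast
    have "negligible (\<Psi> ` {v. \<Psi> v \<in> N})"
    proof (rule negligible_differentiable_image_negligible[OF _ neg])
      show "\<Psi> differentiable_on {v. \<Psi> v \<in> N}"
        unfolding \<Psi>_def[abs_def] by (intro differentiable_at_imp_differentiable_on act_differentiable)
    qed simp
    moreover have "N \<subseteq> \<Psi> ` {v. \<Psi> v \<in> N}"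
    proof
      fix w assume w: "w \<in> N"
      obtain v where "\<Psi> v = w" using act_onto[of a b u w] unfolding \<Psi>_def by blast
      then show "w \<in> \<Psi> ` {v. \<Psi> v \<in> N}" using w by blast
    qed
    ultimately have "negligible N" using negligible_subset by blast
    then have "N \<in> null_sets LM" using Nb by (simp add: negligible_iff_null_sets null_sets_completion_iff)
    then have "AE w in LM. w \<notin> N" by (rule AE_not_in)
    then have "AE w in LM. F w = 0" by eventually_elim (simp add: N_def)
    then show False using nz[OF F(1)] F(2) f(2) by simp
  qed
qed

section \<open>Haar measure and square integrability\<close>

lemma E_minus_cong: assumes "E a b x = E a b y" shows "E a b (- x) = E a b (- y)"
proof -
  have "E a b (- x) = E a b (- x) ** E a b y ** E a b (- y)" by (simp add: E_cancel)
  also have "\<dots> = E a b (- y)" by (simp add: E_minus_left flip: assms)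
  finally show ?thesis .
qed

text \<open>The element whose inverse has last row \<open>rowpu p u\<close>. Passing to the inverse
  turns left translations of the group into the right action on rows.\<close>

definition gam :: "real \<Rightarrow> real \<Rightarrow> (real^5) \<times> (real^5) \<Rightarrow> real^11^11" where
  "gam a b z = E a b (- solve a b lrow (rowpu (fst z) (snd z)))"

definition grow :: "real \<Rightarrow> real \<Rightarrow> real^11^11 \<Rightarrow> real^11" where
  "grow a b g = lrow v* E a b (- lg a b g)"

definition par :: "real \<Rightarrow> real \<Rightarrow> real^11^11 \<Rightarrow> (real^5) \<times> (real^5)" where
  "par a b g = (ppart (grow a b g), upart (grow a b g))"

definition shift :: "real \<Rightarrow> real \<Rightarrow> real^11 \<Rightarrow> (real^5) \<times> (real^5) \<Rightarrow> (real^5) \<times> (real^5)" where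
  "shift a b x z = (ppart (rowpu (fst z) (snd z) v* E a b x), act (E a b x) (snd z))"

lemma gam_GZ: "gam a b z \<in> GZ a b"
  by (simp add: gam_def GZ_E)

lemma gam_cont: "continuous_on S f \<Longrightarrow> continuous_on S (\<lambda>x. gam a b (f x))"
  unfolding gam_def by (intro continuous_E_comp continuous_intros continuous_solve rowpu_linear_cont)

lemma par_cont: "continuous_on UNIV (par a b)"
  unfolding par_def grow_def
  by (intro continuous_intros ppart_cont upart_cont vm.continuous_on continuous_E_comp lg_cont)

lemma lrow_solve: "\<xi> $ ix 11 = 1 \<Longrightarrow> lrow v* E a b (solve a b lrow \<xi>) = \<xi>"
  by (rule row_solve) (simp_all add: lrow_11)

lemma par_gam: "par a b (gam a b z) = z"
proof -
  define s where "s = solve a b lrow (rowpu (fst z) (snd z))"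
  have "E a b (lg a b (gam a b z)) = E a b (- s)"
    using E_lg[OF gam_GZ, of a b z] by (simp add: gam_def s_def)
  from E_minus_cong[OF this] have "grow a b (gam a b z) = lrow v* E a b s" by (simp add: grow_def)
  also have "\<dots> = rowpu (fst z) (snd z)" unfolding s_def by (rule lrow_solve) (simp add: rowpu_nth)
  finally show ?thesis by (simp add: par_def)
qed

lemma gam_par: assumes "g \<in> GZ a b" shows "gam a b (par a b g) = g"
proof -
  have 11: "grow a b g $ ix 11 = 1" by (simp add: grow_def row_E_11 lrow_11)
  have "E a b (solve a b lrow (grow a b g)) = E a b (- lg a b g)"
    by (rule E_eqI) (simp add: lrow_solve[OF 11], simp add: grow_def)
  from E_minus_cong[OF this] show ?thesis
    using E_lg[OF assms] 11 by (simp add: gam_def par_def rowpu_parts)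
qed

text \<open>Left translation by exp(-x) multiplies the last row of the inverse by exp(x) from the
  right, which is \<open>shift\<close> in the coordinates p and u.\<close>

lemma gam_shift: "E a b (- x) ** gam a b z = gam a b (shift a b x z)"
proof -
  define s where "s = solve a b lrow (rowpu (fst z) (snd z))"
  define t where "t = solve a b lrow (rowpu (fst z) (snd z) v* E a b x)"
  obtain w where w: "E a b s ** E a b x = E a b w" using E_mult by blast
  have "lrow v* E a b w = rowpu (fst z) (snd z) v* E a b x"
    unfolding w[symmetric] s_def vector_matrix_mul_assoc[symmetric] by (subst lrow_solve) (simp_all add: rowpu_nth)
  then have "E a b w = E a b t"
    unfolding t_def by (intro E_eqI) (simp add: lrow_solve row_E_11 rowpu_nth)
  from E_minus_cong[OF this] have "E a b (- t) = E a b (- w)" by simp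
  also have "\<dots> = E a b (- x) ** E a b (- s)"
  proof -
    have "E a b (- w) = E a b (- w) ** (E a b s ** E a b x) ** E a b (- x) ** E a b (- s)"
      by (simp add: matrix_mul_assoc E_cancel)
    also have "\<dots> = E a b (- x) ** E a b (- s)" unfolding w by (simp add: E_minus_left)
    finally show ?thesis .
  qed
  finally have "E a b (- x) ** E a b (- s) = E a b (- t)" by simp
  moreover have "rowpu (fst (shift a b x z)) (snd (shift a b x z)) = rowpu (fst z) (snd z) v* E a b x"
  proof -
    have "snd (shift a b x z) = upart (rowpu (fst z) (snd z) v* E a b x)"
      unfolding shift_def snd_conv by (subst upart_act[OF low_E]) (simp_all add: rowpu_nth)
    then show ?thesis by (simp add: shift_def rowpu_parts row_E_11 rowpu_nth)
  qed
  ultimately show ?thesis by (simp add: gam_def s_def t_def)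
qed

abbreviation PM :: "((real^5) \<times> (real^5)) measure" where "PM \<equiv> LM \<Otimes>\<^sub>M LM"

lemma PM_eq: "PM = lborel" by (rule lborel_prod)

lemma shift_cont: "continuous_on S (shift a b x)"
  unfolding shift_def
  by (intro continuous_intros ppart_cont vm.continuous_on rowpu_linear_cont act_cont)

lemma PM_integral: "f \<in> borel_measurable borel \<Longrightarrow> (\<integral>\<^sup>+z. f z \<partial>PM) = (\<integral>\<^sup>+u. \<integral>\<^sup>+p. f (p, u) \<partial>LM \<partial>LM)"
  by (rule lborel_pair.nn_integral_snd[symmetric]) (simp add: PM_eq)

text \<open>Over a fixed u the map is affine in p with unit triangular linear part, and on the base
  it is \<open>act\<close>, which preserves Lebesgue measure; Fubini combines the two.\<close>

lemma shift_preserves: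
  assumes B: "B \<in> sets borel" shows "emeasure PM (shift a b x -` B) = emeasure PM B"
proof -
  have sm: "shift a b x \<in> borel_measurable borel" by (intro borel_measurable_continuous_onI shift_cont)
  have pre: "shift a b x -` B \<in> sets borel" using measurable_sets[OF sm B] by simp
  let ?f = "indicator B :: (real^5) \<times> (real^5) \<Rightarrow> ennreal"
  have fm [measurable]: "?f \<in> borel_measurable (borel \<Otimes>\<^sub>M borel)" unfolding borel_prod using B by simp
  have "emeasure PM (shift a b x -` B) = (\<integral>\<^sup>+z. indicator (shift a b x -` B) z \<partial>PM)"
    unfolding PM_eq using pre by (intro nn_integral_indicator[symmetric]) simp
  also have "\<dots> = (\<integral>\<^sup>+u. \<integral>\<^sup>+p. indicator (shift a b x -` B) (p, u) \<partial>LM \<partial>LM)"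
    using pre by (intro PM_integral) simp
  also have "\<dots> = (\<integral>\<^sup>+u. \<integral>\<^sup>+p. ?f (p, act (E a b x) u) \<partial>LM \<partial>LM)"
  proof (rule nn_integral_cong)
    fix u
    let ?M = "\<chi> i j. E a b x $ ix (d5 j) $ ix (d5 i)"
    have "(\<integral>\<^sup>+p. ?f (p, act (E a b x) u) \<partial>LM) =
      ennreal \<bar>det ?M\<bar> * (\<integral>\<^sup>+p. ?f (?M *v p + ppart (rowpu 0 u v* E a b x), act (E a b x) u) \<partial>LM)"
      by (rule nn_integral_affine_matrix) (simp_all add: det_ppart[OF low_E])
    then show "(\<integral>\<^sup>+p. indicator (shift a b x -` B) (p, u) \<partial>LM) = (\<integral>\<^sup>+p. ?f (p, act (E a b x) u) \<partial>LM)"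
      by (simp add: det_ppart[OF low_E] ppart_affine[symmetric] shift_def indicator_def)
  qed
  also have "\<dots> = (\<integral>\<^sup>+u. \<integral>\<^sup>+p. ?f (p, u) \<partial>LM \<partial>distr LM borel (act (E a b x)))"
    by (subst nn_integral_distr) (simp_all)
  also have "\<dots> = emeasure PM B"
    unfolding distr_act using B by (subst PM_integral[symmetric]) (simp_all add: PM_eq)
  finally show ?thesis .
qed

definition haar :: "real \<Rightarrow> real \<Rightarrow> (real^11^11) measure" where
  "haar a b = distr PM (restrict_space borel (GZ a b)) (gam a b)"

lemma gam_measurable: "gam a b \<in> measurable PM (restrict_space borel (GZ a b))"
  using gam_cont[of UNIV "\<lambda>x. x" a b]
  by (intro measurable_restrict_space2) (auto simp: gam_GZ PM_eq intro!: borel_measurable_continuous_onI)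

lemma sets_GZ: "A \<in> sets (restrict_space borel (GZ a b)) \<Longrightarrow> A \<subseteq> GZ a b \<and> (\<exists>B\<in>sets borel. A = B \<inter> GZ a b)"
  by (auto simp: sets_restrict_space)

lemma haar_measure_haar: "haar_measure (GZ a b) (haar a b)"
  unfolding haar_measure_def
proof (intro conjI allI impI ballI, goal_cases)
  case 1 show ?case by (simp add: haar_def space_restrict_space)
next
  case 2 show ?case by (simp add: haar_def)
next
  case 3
  have G: "GZ a b \<in> sets (restrict_space borel (GZ a b))"
    by (metis sets.top space_restrict_space space_borel Int_UNIV_right)
  have "emeasure (haar a b) (GZ a b) = emeasure PM (gam a b -` GZ a b \<inter> space PM)"
    unfolding haar_def by (rule emeasure_distr[OF gam_measurable G])
  also have "gam a b -` GZ a b \<inter> space PM = UNIV \<times> UNIV" using gam_GZ by (auto simp: space_pair_measure)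
  also have "emeasure PM (UNIV \<times> UNIV) = \<infinity>"
    by (subst lborel.emeasure_pair_measure_Times) (simp_all add: emeasure_lborel_UNIV)
  finally show ?case by simp
next
  case (4 K)
  then have K: "compact K" "K \<subseteq> GZ a b" by auto
  have Ks: "K \<in> sets (restrict_space borel (GZ a b))"
    using K by (auto simp: sets_restrict_space intro!: image_eqI[of _ _ K] borel_closed compact_imp_closed)
  have "emeasure (haar a b) K = emeasure PM (gam a b -` K \<inter> space PM)"
    unfolding haar_def by (rule emeasure_distr[OF gam_measurable Ks])
  \<comment> \<open>Since \<open>par\<close> inverts \<open>gam\<close> on the group and is
    continuous, the preimage of a compact set is bounded and hence of finite Lebesgue
    measure.\<close>
  also have "gam a b -` K \<inter> space PM = par a b ` K"
  proof (intro set_eqI iffI)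
    fix z assume "z \<in> gam a b -` K \<inter> space PM"
    then show "z \<in> par a b ` K" by (intro image_eqI[of _ _ "gam a b z"]) (auto simp: par_gam)
  next
    fix z assume "z \<in> par a b ` K"
    then show "z \<in> gam a b -` K \<inter> space PM" using gam_par K(2) by (auto simp: space_pair_measure subset_iff)
  qed
  also have "emeasure PM (par a b ` K) < \<infinity>"
  proof -
    have "bounded (par a b ` K)"
      by (intro compact_imp_bounded compact_continuous_image[OF continuous_on_subset[OF par_cont]] K) simp
    then show ?thesis unfolding PM_eq by (rule emeasure_bounded_finite)
  qed
  finally show ?case .
next
  case (5 g A)
  then have A: "A \<in> sets (restrict_space borel (GZ a b))" and g: "g \<in> GZ a b" by (simp_all add: haar_def)
  obtain x where x: "g = E a b x" using g by (auto simp: GZ_E)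
  obtain B where B: "B \<in> sets borel" "A = B \<inter> GZ a b" using sets_GZ[OF A] by blast
  \<comment> \<open>Written as a preimage under the inverse translation, the translate is visibly
    measurable.\<close>
  have img: "(\<lambda>y. g ** y) ` A = ((\<lambda>h. E a b (- x) ** h) -` B) \<inter> GZ a b"
  proof (intro set_eqI iffI)
    fix h assume "h \<in> (\<lambda>y. g ** y) ` A"
    then obtain y where y: "y \<in> A" "h = g ** y" by blast
    then show "h \<in> ((\<lambda>h. E a b (- x) ** h) -` B) \<inter> GZ a b"
      using B(2) GZ_mult[OF g] by (auto simp: x E_cancel_left)
  next
    fix h assume h: "h \<in> ((\<lambda>h. E a b (- x) ** h) -` B) \<inter> GZ a b"
    have "E a b (- x) ** h \<in> GZ a b" using h by (intro GZ_mult) (auto simp: GZ_E)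
    then show "h \<in> (\<lambda>y. g ** y) ` A" using h B(2) by (intro image_eqI[of _ _ "E a b (- x) ** h"]) (auto simp: x E_cancel_left)
  qed
  have "continuous_on UNIV (\<lambda>h::real^11^11. E a b (- x) ** h)" by (intro mm.continuous_on continuous_intros)
  then have "((\<lambda>h. E a b (- x) ** h) -` B) \<in> sets borel"
    using measurable_sets[OF borel_measurable_continuous_onI B(1)] by simp
  then show "(\<lambda>y. g ** y) ` A \<in> sets (haar a b)"
    unfolding img haar_def by (auto simp: sets_restrict_space)
  then have gA: "(\<lambda>y. g ** y) ` A \<in> sets (restrict_space borel (GZ a b))" by (simp add: haar_def)
  have "emeasure (haar a b) ((\<lambda>y. g ** y) ` A) = emeasure PM (gam a b -` ((\<lambda>y. g ** y) ` A) \<inter> space PM)"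
    unfolding haar_def by (rule emeasure_distr[OF gam_measurable gA])
  also have "gam a b -` ((\<lambda>y. g ** y) ` A) \<inter> space PM = shift a b x -` (gam a b -` A)"
    unfolding img unfolding B(2) by (auto simp: space_pair_measure gam_shift gam_GZ)
  also have "emeasure PM (shift a b x -` (gam a b -` A)) = emeasure PM (gam a b -` A)"
  proof (rule shift_preserves)
    have "gam a b -` A \<inter> space PM \<in> sets PM" by (rule measurable_sets[OF gam_measurable A])
    then show "gam a b -` A \<in> sets borel" unfolding PM_eq by simp
  qed
  also have "\<dots> = emeasure (haar a b) A"
    unfolding haar_def using emeasure_distr[OF gam_measurable A] by (simp add: space_pair_measure)
  finally show "emeasure (haar a b) ((\<lambda>y. g ** y) ` A) = emeasure (haar a b) A" .
qed

section \<open>The matrix coefficient of the indicator of a cube\<close>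

definition Lm :: "real \<Rightarrow> real \<Rightarrow> real^5 \<Rightarrow> real^5^5" where
  "Lm a b u = (\<chi> i j. \<Sum>k\<in>UNIV. rowu u $ k * bc a b (d5 i) (11 - d5 j) (idx k))"

text \<open>Weights make the matrix triangular with the pivots of \<open>bc_top\<close> on the
  diagonal. The determinant is thus independent of u, and the substitution below costs only a
  constant factor.\<close>

lemma det_Lm: "det (Lm a b u) = (\<Prod>i\<in>UNIV. bc a b (d5 i) (11 - d5 i) 11)"
proof (subst det_upperdiagonal)
  have z: "bc a b (d5 i) (11 - d5 j) (idx k) = 0" if "j < i \<or> (j = i \<and> k \<noteq> ix 11)" for i j k
  proof -
    have "idx k < d5 i + (11 - d5 j)"
      using that idx_less_11[of k] idx_le_11[of k] d5_bounds[of j] d5_less_iff[of j i] by auto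
    then show ?thesis using bc_weight[of a b "d5 i" "11 - d5 j" "idx k"] by auto
  qed
  show "Lm a b u $ i $ j = 0" if "j < i" for i j
    using z that by (simp add: Lm_def)
  have "Lm a b u $ i $ i = (\<Sum>k\<in>UNIV. if k = ix 11 then bc a b (d5 i) (11 - d5 i) 11 else 0)" for i
    unfolding Lm_def vec_lambda_beta by (intro sum.cong refl) (use z[of i i] in \<open>auto simp: rowpu_nth\<close>)
  then show "(\<Prod>i\<in>UNIV. Lm a b u $ i $ i) = (\<Prod>i\<in>UNIV. bc a b (d5 i) (11 - d5 i) 11)" by simp
qed

lemma det_Lm_nz: "det (Lm a b u) \<noteq> 0"
proof -
  have "bc a b (d5 i) (11 - d5 i) 11 \<noteq> 0" for i
    using d5_bounds[of i] by (intro bc_top) auto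
  then show ?thesis by (simp add: det_Lm)
qed

lemma shift_mvec: "shift a b (- mvec m) (0, u) = (Lm a b u *v m, u)"
proof -
  have s: "supp_ge 6 (- mvec m)" using supp_mvec[of "-1" m] by simp
  \<comment> \<open>First order is exact here: the second power has degree 12, and no index
    difference is that large. So the ideal translates p over a fixed u, linearly in m.\<close>
  have E1: "E a b (- mvec m) $ k $ j = ad_mat a b (- mvec m) $ k $ j + (if k = j then 1 else 0)" for k j
  proof (cases "k = j")
    case True
    then show ?thesis using ad_lower[of a b "- mvec m" k k] by (auto simp: E_diag)
  next
    case False
    then show ?thesis using E_first_order[OF s, of k j a b] idx_le_11[of k] by simp
  qed
  have "ppart (rowu u v* E a b (- mvec m)) $ i = (Lm a b u *v m) $ i" for i
  proof -
    have a: "ad_mat a b (- mvec m) $ k $ ix (d5 i) = (\<Sum>j\<in>UNIV. m $ j * bc a b (d5 i) (11 - d5 j) (idx k))" for k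
      using bc_skew[of a b "d5 i"] by (simp add: ad_nth sum_split mvec_nth ix_d5)
    have "ppart (rowu u v* E a b (- mvec m)) $ i = (\<Sum>k\<in>UNIV. rowu u $ k * E a b (- mvec m) $ k $ ix (d5 i))"
      by (simp add: ppart_def vector_matrix_mult_def mult.commute)
    also have "\<dots> = (\<Sum>k\<in>UNIV. rowu u $ k * ad_mat a b (- mvec m) $ k $ ix (d5 i)) + rowu u $ ix (d5 i)"
    proof -
      have "x * (if c then 1 else 0) = (if c then x else 0)" for x :: real and c by simp
      then show ?thesis by (simp add: E1 distrib_left sum.distrib)
    qed
    also have "\<dots> = (\<Sum>k\<in>UNIV. \<Sum>j\<in>UNIV. rowu u $ k * (m $ j * bc a b (d5 i) (11 - d5 j) (idx k)))"
      by (simp add: a rowpu_nth sum_distrib_left)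
    also have "\<dots> = (\<Sum>j\<in>UNIV. \<Sum>k\<in>UNIV. rowu u $ k * (m $ j * bc a b (d5 i) (11 - d5 j) (idx k)))"
      by (rule sum.swap)
    also have "\<dots> = (Lm a b u *v m) $ i"
      by (simp add: Lm_def matrix_vector_mult_def sum_distrib_left sum_distrib_right mult_ac)
    finally show ?thesis .
  qed
  moreover have "act (E a b (- mvec m)) u = u" using act_mvec[of a b "-1" m u] by simp
  ultimately show ?thesis by (simp add: shift_def vec_eq_iff)
qed

lemma gam_mvec: "E a b (mvec m) ** gam a b (0, u) = gam a b (Lm a b u *v m, u)"
  using gam_shift[of a b "- mvec m" "(0, u)"] by (simp add: shift_mvec)

definition H0 :: "real^5 \<Rightarrow> complex" where "H0 = indicator (cube 0)"

lemma H0_bas: "H0 = bas (\<lambda>_. 0, \<lambda>_. 0)"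
  by (simp add: H0_def bas_def fun_eq_iff pt_0)

lemma H0_sqi: "H0 \<in> sqi LM" and H0_nsq: "nsq LM H0 = 1"
proof -
  show "H0 \<in> sqi LM" unfolding H0_bas by (rule bas_orthonormal(1))
  have "complex_of_real (nsq LM H0) = 1" unfolding ip_self[symmetric] H0_bas by (simp add: bas_orthonormal(2))
  then show "nsq LM H0 = 1" by (metis of_real_eq_1_iff)
qed

text \<open>The transformations of the quotient act freely: a fixed point makes the first five
  coordinates of the parameter vanish by \<open>row_unique\<close>, and these alone determine the
  transformation.\<close>

lemma act_fixed:
  assumes "act (E a b s) w = w" shows "act (E a b s) v = v"
proof -
  have "supp_ge (Suc 5) (s - 0)"
  proof (rule row_unique[of "rowu w" 5 a b])
    fix m :: nat assume m: "1 \<le> m" "m \<le> 5"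
    then have d: "d5 (i5 m) = m" by (simp add: d5_i5)
    have "act (E a b s) w $ i5 m = w $ i5 m" using assms by simp
    then show "(rowu w v* E a b s) $ ix (11 - m) = (rowu w v* E a b 0) $ ix (11 - m)"
      using rowpu_nth(3)[of 0 w "i5 m"] by (simp add: act_def upart_def d)
  qed (simp_all add: rowpu_nth)
  then show ?thesis using act_cong[of s 0 a b] by simp
qed

text \<open>By \<open>act_fixed\<close> a transformation is determined by one point w and its image
  w'. If w and w' lie in the cube, then u is the image of 0 under the transformation taking w' back
  to w; so the possible u are contained in a continuous image of a compact set of pairs.\<close>

definition reach :: "real \<Rightarrow> real \<Rightarrow> (real^5) set" where
  "reach a b = (\<lambda>p. act (E a b (solve a b (rowu (snd p)) (rowu (fst p)))) 0) ` (closure (cube 0) \<times> closure (cube 0))"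

lemma reach_compact: "compact (reach a b)"
  unfolding reach_def
proof (rule compact_continuous_image)
  have "bounded (cube (0 :: real^5))"
  proof (rule bounded_subset[OF bounded_cbox])
    show "cube (0 :: real^5) \<subseteq> cbox 0 (\<Sum>b\<in>Basis. b)"
      by (auto simp: cube_def mem_box inner_sum_left inner_Basis if_distrib less_imp_le cong: if_cong)
  qed
  then show "compact (closure (cube (0 :: real^5)) \<times> closure (cube (0 :: real^5)))"
    by (intro compact_Times) (simp_all add: compact_closure)
qed (intro act_cont continuous_solve rowpu_linear_cont continuous_intros)

lemma reachI:
  assumes "w \<in> cube 0" "act (gam a b (0, u)) w \<in> cube 0" shows "u \<in> reach a b"
proof -
  define s where "s = - solve a b lrow (rowu u)"
  have gs: "gam a b (0, u) = E a b s" by (simp add: gam_def s_def)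
  define w' where "w' = act (E a b s) w"
  define y where "y = solve a b (rowu w') (rowu w)"
  have "act (E a b y) w' = w" unfolding act_def y_def by (simp add: row_solve rowpu_nth)
  obtain t where t: "E a b s ** E a b y = E a b t" using E_mult by blast
  have "act (E a b t) w = w" unfolding t[symmetric] act_mult by (simp add: w'_def[symmetric] \<open>act (E a b y) w' = w\<close>)
  then have "act (E a b t) v = v" for v by (rule act_fixed)
  then have "act (E a b y) (act (E a b s) v) = v" for v by (simp add: t[symmetric] act_mult[symmetric])
  from this[of "act (E a b (- s)) 0"] have "act (E a b y) 0 = act (E a b (- s)) 0" by (simp add: act_minus)
  also have "\<dots> = u"
  proof -
    have "rowu 0 v* E a b (- s) = rowu u" unfolding lrow_eq[symmetric] s_def minus_minus by (rule lrow_solve) (simp add: rowpu_nth)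
    then show ?thesis by (simp add: act_def)
  qed
  finally have "act (E a b y) 0 = u" .
  moreover have "(w, w') \<in> closure (cube 0) \<times> closure (cube 0)"
    using assms closure_subset by (auto simp: w'_def gs[symmetric])
  ultimately show ?thesis unfolding reach_def y_def by (intro image_eqI[of _ _ "(w, w')"]) auto
qed

lemma fourier_measurable:
  assumes [measurable]: "h \<in> borel_measurable borel"
  shows "(\<lambda>s. \<integral>u. h u * cnj (chr s u) \<partial>LM) \<in> borel_measurable borel"
proof -
  have [measurable]: "(\<lambda>p. chr (fst p) (snd p)) \<in> borel_measurable ((borel :: (real^5) measure) \<Otimes>\<^sub>M (borel :: (real^5) measure))"
    unfolding borel_prod chr_def by (intro borel_measurable_continuous_onI continuous_intros)
  have "(\<lambda>p. h (snd p) * cnj (chr (fst p) (snd p))) \<in> borel_measurable ((borel :: (real^5) measure) \<Otimes>\<^sub>M (borel :: (real^5) measure))"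
    by measurable
  then have "(\<lambda>(s, u). h u * cnj (chr s u)) \<in> borel_measurable (borel \<Otimes>\<^sub>M LM)"
    by (simp add: case_prod_beta' cong: measurable_cong_sets sets_pair_measure_cong)
  from lborel.borel_measurable_lebesgue_integral[OF this] show ?thesis by simp
qed

lemma rho_square_integrable: "square_integrable_rep (GZ a b) (rho a b)"
proof -
  define \<eta> where "\<eta> = coords H0"
  have \<eta>: "\<eta> \<in> l2" unfolding \<eta>_def by (rule coords_l2[OF H0_sqi])
  have \<eta>0: "\<eta> \<noteq> (\<lambda>_. 0)"
  proof
    assume "\<eta> = (\<lambda>_. 0)"
    then have "l2_inner \<eta> \<eta> = 0" by (simp add: l2_inner_def)
    moreover have "l2_inner \<eta> \<eta> = of_real (nsq LM H0)"
      unfolding \<eta>_def coords_inner[OF H0_sqi H0_sqi] by (rule ip_self)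
    ultimately show False by (simp add: H0_nsq)
  qed
  let ?W = "\<lambda>g. ennreal ((cmod (l2_inner \<eta> (rho a b g \<eta>)))\<^sup>2)"
  have Weq: "?W g = ennreal ((cmod (ip LM H0 (Uop a b (lg a b g) H0)))\<^sup>2)" for g
    unfolding \<eta>_def rho_coords[OF H0_sqi] by (simp add: coords_inner H0_sqi Uop_sqi)
  have Wm: "?W \<in> borel_measurable (restrict_space borel (GZ a b))"
  proof -
    have "(\<lambda>g. l2_inner (rho a b g \<eta>) \<eta>) \<in> borel_measurable (restrict_space borel (GZ a b))"
      using rho_proj_unitary_rep[of a b] \<eta> by (simp add: proj_unitary_rep_def)
    moreover have "cmod (l2_inner \<eta> (rho a b g \<eta>)) = cmod (l2_inner (rho a b g \<eta>) \<eta>)" for g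
    proof -
      have "l2_inner \<eta> (rho a b g \<eta>) = cnj (l2_inner (rho a b g \<eta>) \<eta>)"
        using l2_inner_eq_ip[OF \<eta> rho_l2[OF \<eta>]] l2_inner_eq_ip[OF rho_l2[OF \<eta>] \<eta>] by (metis ip_cnj)
      then show ?thesis by simp
    qed
    ultimately show ?thesis by (simp only:) measurable
  qed
  \<comment> \<open>The integrand of the matrix coefficient at the point p = 0 over u. Moving p only
    multiplies it by a character in v and a constant phase.\<close>
  define h where "h u v = H0 v * cnj (Uop a b (lg a b (gam a b (0, u))) H0 v)" for u v
  have H0m [measurable]: "H0 \<in> borel_measurable borel" using H0_sqi by (simp add: sqi_def)
  have hm: "h u \<in> borel_measurable borel" for u
  proof -
    have [measurable]: "Uop a b (lg a b (gam a b (0, u))) H0 \<in> borel_measurable borel" by (rule Uop_measurable[OF H0m])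
    show ?thesis unfolding h_def[abs_def] by measurable
  qed
  have h_le: "(cmod (h u v))\<^sup>2 \<le> (cmod (H0 v))\<^sup>2" for u v
    by (simp add: h_def norm_mult Uop_def H0_def indicator_def)
  have hs: "h u \<in> sqi LM" for u
    unfolding sqi_def using hm h_le
    by (auto intro!: Bochner_Integration.integrable_bound[OF sqi_integrable[OF H0_sqi]])
  \<comment> \<open>A non-zero value of \<open>h u\<close> exhibits a point of the cube that is
    moved into the cube, so u lies in \<open>reach\<close>; this is the compact support in
    u.\<close>
  have h_nsq: "nsq LM (h u) \<le> indicator (reach a b) u" for u
  proof (cases "u \<in> reach a b")
    case True
    have "nsq LM (h u) \<le> nsq LM H0" unfolding nsq_def
      by (intro integral_mono sqi_integrable hs H0_sqi h_le)
    then show ?thesis using True by (simp add: H0_nsq)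
  next
    case False
    have "h u v = 0" for v
    proof (rule ccontr)
      assume "h u v \<noteq> 0"
      then have "v \<in> cube 0" "act (gam a b (0, u)) v \<in> cube 0"
        by (auto simp: h_def H0_def Uop_def E_lg[OF gam_GZ] indicator_def split: if_splits)
      then show False using reachI False by blast
    qed
    then show ?thesis by (simp add: nsq_def)
  qed
  define \<delta> where "\<delta> = \<bar>\<Prod>i\<in>UNIV. bc a b (d5 i) (11 - d5 i) 11\<bar>"
  \<comment> \<open>At p = \<open>Lm a b u *v m\<close> the group element is exp(mvec m) times the
    one at p = 0, so the coefficient is, up to phase, the Fourier transform of \<open>h u\<close> at
    m.\<close>
  have W_gam: "?W (gam a b (Lm a b u *v m, u)) = ennreal ((cmod (\<integral>v. h u v * cnj (chr m v) \<partial>LM))\<^sup>2)" for u m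
  proof -
    have "E a b (mvec m) ** E a b (lg a b (gam a b (0, u))) = E a b (lg a b (gam a b (Lm a b u *v m, u)))"
      by (simp add: E_lg[OF gam_GZ] gam_mvec)
    then obtain c where c: "cmod c = 1"
      "\<And>F v. Uop a b (lg a b (gam a b (Lm a b u *v m, u))) F v = c * Uop a b (mvec m) (Uop a b (lg a b (gam a b (0, u))) F) v"
      using Uop_mult by blast
    have "ip LM H0 (Uop a b (lg a b (gam a b (Lm a b u *v m, u))) H0) =
        ip LM H0 (\<lambda>v. c * (chr m v * Uop a b (lg a b (gam a b (0, u))) H0 v))"
      by (rule arg_cong[of _ _ "ip LM H0"], rule ext) (simp add: c(2) Uop_mvec)
    also have "\<dots> = cnj c * (\<integral>v. h u v * cnj (chr m v) \<partial>LM)"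
      by (simp only: ip_scale_right) (simp add: ip_def h_def mult_ac)
    finally show ?thesis using c(1) unfolding Weq by (simp add: norm_mult)
  qed
  have Wgm: "(\<lambda>z. ?W (gam a b z)) \<in> borel_measurable borel"
    using measurable_compose[OF gam_measurable Wm] by (simp add: PM_eq)
  have "(\<integral>\<^sup>+g. ?W g \<partial>haar a b) = (\<integral>\<^sup>+z. ?W (gam a b z) \<partial>PM)"
    unfolding haar_def using Wm by (intro nn_integral_distr gam_measurable) simp
  also have "\<dots> = (\<integral>\<^sup>+u. \<integral>\<^sup>+p. ?W (gam a b (p, u)) \<partial>LM \<partial>LM)"
    by (rule PM_integral[OF Wgm])
  also have "\<dots> \<le> (\<integral>\<^sup>+u. ennreal \<delta> * indicator (reach a b) u \<partial>LM)"
  proof (rule nn_integral_mono)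
    fix u
    have m: "(\<lambda>p. ?W (gam a b (p, u))) \<in> borel_measurable borel"
    proof -
      have "(\<lambda>p::real^5. (p, u)) \<in> borel_measurable borel"
        by (intro borel_measurable_continuous_onI continuous_intros)
      from measurable_compose[OF this Wgm] show ?thesis .
    qed
    \<comment> \<open>The substitution p = \<open>Lm a b u *v m\<close> turns the integral over the
      fibre into the squared norm of a Fourier transform, with the same Jacobian for every
      u.\<close>
    have "(\<integral>\<^sup>+p. ?W (gam a b (p, u)) \<partial>LM) = ennreal \<bar>det (Lm a b u)\<bar> * (\<integral>\<^sup>+m. ?W (gam a b (Lm a b u *v m + 0, u)) \<partial>LM)"
      by (rule nn_integral_affine_matrix[OF det_Lm_nz m])
    also have "\<dots> = ennreal \<delta> * (\<integral>\<^sup>+m. ennreal ((cmod (\<integral>v. h u v * cnj (chr m v) \<partial>LM))\<^sup>2) \<partial>LM)"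
      by (simp only: add_0_right W_gam det_Lm \<delta>_def)
    also have "\<dots> \<le> ennreal \<delta> * ennreal (nsq LM (h u))"
      by (intro mult_left_mono fourier_L2_bound hs fourier_measurable hm) (auto simp: h_def H0_def)
    also have "\<dots> \<le> ennreal \<delta> * ennreal (indicator (reach a b) u)"
      by (intro mult_left_mono ennreal_leI h_nsq) auto
    finally show "(\<integral>\<^sup>+p. ?W (gam a b (p, u)) \<partial>LM) \<le> ennreal \<delta> * indicator (reach a b) u"
      by (simp add: ennreal_indicator)
  qed
  also have "\<dots> = ennreal \<delta> * emeasure LM (reach a b)"
    using reach_compact[of a b] by (intro nn_integral_cmult_indicator) (simp add: borel_closed compact_imp_closed)
  also have "\<dots> < \<infinity>"
    using emeasure_bounded_finite[OF compact_imp_bounded[OF reach_compact[of a b]]] by (simp add: ennreal_mult_less_top)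
  finally have fin: "(\<integral>\<^sup>+g. ?W g \<partial>haar a b) < \<infinity>" .
  show ?thesis
    unfolding square_integrable_rep_def using \<eta> \<eta>0 haar_measure_haar fin by blast
qed

section \<open>Dilations\<close>

lemma lin_exp_eigen_sum:
  fixes B :: "'v::real_normed_vector \<Rightarrow> 'v"
  assumes "linear B" and eig: "\<And>v. v \<in> T \<Longrightarrow> B v = c v *\<^sub>R v"
  shows "lin_exp B (\<Sum>v\<in>T. r v *\<^sub>R v) = (\<Sum>v\<in>T. (r v * exp (c v)) *\<^sub>R v)"
proof -
  have pow: "(B ^^ n) (\<Sum>v\<in>T. r v *\<^sub>R v) = (\<Sum>v\<in>T. (r v * c v ^ n) *\<^sub>R v)" for n
  proof (induction n)
    case (Suc n)
    have "B (\<Sum>v\<in>T. (r v * c v ^ n) *\<^sub>R v) = (\<Sum>v\<in>T. (r v * c v ^ Suc n) *\<^sub>R v)"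
      unfolding linear_sum[OF assms(1)] linear_cmul[OF assms(1)]
      by (intro sum.cong refl) (simp add: eig mult_ac)
    then show ?case using Suc by simp
  qed simp
  have "(\<lambda>n. ((r v * c v ^ n) / fact n) *\<^sub>R v) sums ((r v * exp (c v)) *\<^sub>R v)" for v
  proof -
    have "(\<lambda>n. r v * (c v ^ n /\<^sub>R fact n)) sums (r v * exp (c v))"
      by (intro sums_mult exp_converges)
    then show ?thesis by (intro sums_scaleR_left) (simp add: field_simps)
  qed
  then have "(\<lambda>n. \<Sum>v\<in>T. ((r v * c v ^ n) / fact n) *\<^sub>R v) sums (\<Sum>v\<in>T. (r v * exp (c v)) *\<^sub>R v)"
    by (intro sums_sum)
  then show ?thesis
    unfolding lin_exp_def pow by (simp add: scaleR_sum_right sums_unique[symmetric])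
qed

lemma mbr_add_left: "mbr (X + X') Y = mbr X Y + mbr X' Y"
  and mbr_add_right: "mbr X (Y + Y') = mbr X Y + mbr X Y'"
  and mbr_scaleR_left: "mbr (c *\<^sub>R X) Y = c *\<^sub>R mbr X Y"
  and mbr_scaleR_right: "mbr X (c *\<^sub>R Y) = c *\<^sub>R mbr X Y"
  by (simp_all add: mbr_def mm.add_left mm.add_right mm.scaleR_left mm.scaleR_right scaleR_diff_right)

text \<open>The eigenvalues of a dilation generator are additive on brackets of eigenvectors, because
  \<open>exp\<close> is injective.\<close>

lemma dilation_derivation:
  fixes A :: "real^'n^'n \<Rightarrow> real^'n^'n"
  assumes lin: "linear A" and S: "independent S" and eig: "\<And>v. v \<in> S \<Longrightarrow> A v = c v *\<^sub>R v"
    and closed: "\<And>X Y. X \<in> span S \<Longrightarrow> Y \<in> span S \<Longrightarrow> mbr X Y \<in> span S"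
    and hom: "\<And>X Y. X \<in> span S \<Longrightarrow> Y \<in> span S \<Longrightarrow> lin_exp A (mbr X Y) = mbr (lin_exp A X) (lin_exp A Y)"
    and XY: "X \<in> span S" "Y \<in> span S"
  shows "A (mbr X Y) = mbr (A X) Y + mbr X (A Y)"
proof -
  have fin: "finite S" using S by (rule finiteI_independent)
  define D where "D X Y = A (mbr X Y) - mbr (A X) Y - mbr X (A Y)" for X Y
  note simps = D_def mbr_add_left mbr_add_right mbr_scaleR_left mbr_scaleR_right
    linear_add[OF lin] linear_cmul[OF lin] algebra_simps
  have "linear (\<lambda>X. D X Y)" for Y by (rule linearI) (simp_all add: simps)
  moreover have "linear (D X)" for X by (rule linearI) (simp_all add: simps)
  moreover have "D s s' = 0" if s: "s \<in> S" "s' \<in> S" for s s'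
  proof -
    have sp: "s \<in> span S" "s' \<in> span S" using s by (simp_all add: span_base)
    from closed[OF sp] obtain r where r: "mbr s s' = (\<Sum>v\<in>S. r v *\<^sub>R v)"
      unfolding span_finite[OF fin] by blast
    have es: "lin_exp A v = exp (c v) *\<^sub>R v" if "v \<in> S" for v
      using lin_exp_eigen_sum[of A "{v}" c "\<lambda>_. 1"] lin eig that by simp
    have "(\<Sum>v\<in>S. (r v * exp (c v)) *\<^sub>R v) = exp (c s + c s') *\<^sub>R (\<Sum>v\<in>S. r v *\<^sub>R v)"
      using hom[OF sp] lin_exp_eigen_sum[OF lin eig, where r = r, of S]
      by (simp add: es s mbr_scaleR_left mbr_scaleR_right exp_add mult_ac flip: r)
    then have 0: "(\<Sum>v\<in>S. (r v * exp (c v) - exp (c s + c s') * r v) *\<^sub>R v) = 0"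
      by (simp add: scaleR_diff_left sum_subtractf scaleR_sum_right)
    have rv: "r v * c v = (c s + c s') * r v" if "v \<in> S" for v
    proof -
      have "r v * exp (c v) - exp (c s + c s') * r v = 0"
        using independentD[OF S fin order_refl 0 that] .
      then have "r v = 0 \<or> exp (c v) = exp (c s + c s')" by (simp add: mult.commute)
      then show ?thesis by (auto simp only: exp_inj_iff mult_zero_left mult_zero_right mult.commute)
    qed
    have "A (mbr s s') = (\<Sum>v\<in>S. (r v * c v) *\<^sub>R v)"
      unfolding r linear_sum[OF lin] linear_cmul[OF lin] by (intro sum.cong refl) (simp add: eig)
    also have "\<dots> = (c s + c s') *\<^sub>R mbr s s'"
      unfolding r scaleR_sum_right by (intro sum.cong refl) (simp add: rv)
    finally show ?thesis
      by (simp add: D_def eig s mbr_scaleR_left mbr_scaleR_right scaleR_add_left)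
  qed
  ultimately have "D X s = 0" if "s \<in> S" for s
    using linear_eq_0_on_span[of "\<lambda>X. D X s" S X] XY that by blast
  then have "D X Y = 0"
    using linear_eq_0_on_span[of "D X" S Y] XY \<open>linear (D X)\<close> by blast
  then show ?thesis by (simp add: D_def algebra_simps)
qed

text \<open>Entry 11 - k of the last row isolates coordinate k once the smaller ones are known to
  vanish. The kernel of \<open>ad_mat\<close> is thus contained in the line of e_11.\<close>

lemma ad_eq_0: assumes "ad_mat a b z = 0" "1 \<le> k" "k \<le> 10" shows "z $ ix k = 0"
  using assms(2,3)
proof (induction k rule: less_induct)
  case (less k)
  have "0 = (\<Sum>i=1..11. z $ ix i * bc a b i (11 - k) 11)"
    using assms(1) less.prems ad_nth[of a b z "ix 11" "ix (11 - k)"] by (simp add: sum_ix)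
  also have "\<dots> = (\<Sum>i=1..11. if i = k then z $ ix k * bc a b k (11 - k) 11 else 0)"
  proof (intro sum.cong refl)
    fix i :: nat assume i: "i \<in> {1..11}"
    consider "i < k" | "i = k" | "k < i" by linarith
    then show "z $ ix i * bc a b i (11 - k) 11 = (if i = k then z $ ix k * bc a b k (11 - k) 11 else 0)"
    proof cases
      case 1
      then show ?thesis using less.IH[of i] i less.prems by simp
    next
      case 3
      then show ?thesis using bc_weight[of a b i "11 - k" 11] less.prems by auto
    qed simp
  qed
  also have "\<dots> = z $ ix k * bc a b k (11 - k) 11" using less.prems by simp
  finally show ?case using bc_top[of k a b] less.prems by simp
qed

lemma ad_eqD: "ad_mat a b x = ad_mat a b y \<Longrightarrow> 1 \<le> k \<Longrightarrow> k \<le> 10 \<Longrightarrow> x $ ix k = y $ ix k"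
  using ad_eq_0[of a b "x - y" k] by (simp add: ad_diff)

lemma mbr_ad: "mbr (ad_mat a b x) (ad_mat a b y) = ad_mat a b (ad_mat a b x *v y)"
  by (simp add: mbr_def ad_commutator)

abbreviation bv :: "nat \<Rightarrow> real^11" where "bv k \<equiv> axis (ix k) 1"

lemma ad_bv_right: "1 \<le> j \<Longrightarrow> j \<le> 11 \<Longrightarrow> 1 \<le> k \<Longrightarrow> k \<le> 11 \<Longrightarrow>
    (ad_mat a b x *v bv j) $ ix k = (\<Sum>i=1..11. x $ ix i * bc a b i j k)"
  by (simp add: matrix_vector_mult_basis column_def ad_nth sum_ix)

lemma ad_bv_left: "1 \<le> j \<Longrightarrow> j \<le> 11 \<Longrightarrow> 1 \<le> k \<Longrightarrow> k \<le> 11 \<Longrightarrow>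
    (ad_mat a b (bv j) *v x) $ ix k = (\<Sum>i=1..11. x $ ix i * bc a b j i k)"
  by (subst ad_skew) (simp add: ad_bv_right bc_skew[of a b j] sum_negf)

lemmas bc_table = bc_def brl_def lc_Cons

text \<open>D j k stands for the e_k-component of the image of e_j under a derivation, modulo e_11.
  The recursion coming from e_(j+1) = [e_1, e_j] reduces every row to those of e_1 and e_2; the
  other two brackets then constrain these.\<close>

lemma derivation_table:
  assumes rec: "\<And>j k. 2 \<le> j \<Longrightarrow> j \<le> 9 \<Longrightarrow> 1 \<le> k \<Longrightarrow> k \<le> 10 \<Longrightarrow>
      D (Suc j) k = (\<Sum>i=1..11. D 1 i * bc a b i j k) + (\<Sum>i=1..11. D j i * bc a b 1 i k)"
    and r23: "\<And>k. 1 \<le> k \<Longrightarrow> k \<le> 10 \<Longrightarrow>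
      D 5 k + a * D 6 k = (\<Sum>i=1..11. D 2 i * bc a b i 3 k) + (\<Sum>i=1..11. D 3 i * bc a b 2 i k)"
    and r34: "\<And>k. 1 \<le> k \<Longrightarrow> k \<le> 10 \<Longrightarrow>
      2 * D 7 k + b * D 8 k = (\<Sum>i=1..11. D 3 i * bc a b i 4 k) + (\<Sum>i=1..11. D 4 i * bc a b 3 i k)"
    and nz: "(a, b) \<noteq> (0, 0)"
  shows "\<And>k. 1 \<le> k \<Longrightarrow> k \<le> 10 \<Longrightarrow> D 10 k = 0"
proof -
  \<comment> \<open>Of the second sum one term survives, since e_k is a bracket [e_1, e_i] only for
    i = k - 1 \<ge> 2; components 1 and 2 receive nothing from it.\<close>
  have low: "D (Suc j) k = (if k \<le> 2 then 0 else D j (k - 1)) + (\<Sum>i=1..11. D 1 i * bc a b i j k)"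
    if "2 \<le> j" "j \<le> 9" "1 \<le> k" "k \<le> 10" for j k
  proof -
    have "bc a b 1 i k = (if i = k - 1 \<and> 2 \<le> i then 1 else 0)" if "i \<in> {1..11}" for i
      using that \<open>k \<le> 10\<close> by (auto simp: bc_def brl_def lc_Cons)
    then have "(\<Sum>i=1..11. D j i * bc a b 1 i k) = (\<Sum>i=1..11. if i = k - 1 then (if k \<le> 2 then 0 else D j (k - 1)) else 0)"
      by (intro sum.cong refl) auto
    then show ?thesis using rec[OF that] that by (cases "k \<le> 2") auto
  qed
  have D_wt: "D (Suc j) k = 0" if "2 \<le> j" "j \<le> 9" "1 \<le> k" "k \<le> j" for j k
    using that
  proof (induction j arbitrary: k rule: nat_induct_at_least[of 2])
    case base
    have "(\<Sum>i=1..11. D 1 i * bc a b i 2 k) = 0"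
      using base bc_weight[of a b _ 2 k] by (intro sum.neutral) fastforce
    then show ?case using low[of 2 k] base by simp
  next
    case (Suc j)
    have "(\<Sum>i=1..11. D 1 i * bc a b i (Suc j) k) = 0"
      using Suc.prems bc_weight[of a b _ "Suc j" k] by (intro sum.neutral) fastforce
    then show ?case using low[of "Suc j" k] Suc by simp
  qed
  have z: "D 3 1 = 0" "D 3 2 = 0" "D 4 1 = 0" "D 4 2 = 0" "D 4 3 = 0" "D 5 4 = 0" "D 6 4 = 0" "D 6 5 = 0"
    using D_wt[of 2] D_wt[of 3] D_wt[of 4] D_wt[of 5] by simp_all
  have D3_3: "D 3 3 = D 1 1 + D 2 2"
    using low[of 2 3] by (simp add: sum11[simplified] bc_table )
  have D3_4: "D 3 4 = D 2 3"
    using low[of 2 4] by (simp add: sum11[simplified] bc_table )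
  have D3_5: "D 3 5 = (-1)*D 1 3 + D 2 4"
    using low[of 2 5] by (simp add: sum11[simplified] bc_table )
  have D3_6: "D 3 6 = (-1)*a*D 1 3 + (-1)*D 1 4 + D 2 5"
    using low[of 2 6] by (simp add: sum11[simplified] bc_table )
  have D4_4: "D 4 4 = (2)*D 1 1 + D 2 2"
    using low[of 3 4] by (simp add: sum11[simplified] bc_table D3_3)
  have D4_5: "D 4 5 = D 1 2 + D 2 3"
    using low[of 3 5] by (simp add: sum11[simplified] bc_table D3_4)
  have D4_6: "D 4 6 = a*D 1 2 + (-1)*D 1 3 + D 2 4"
    using low[of 3 6] by (simp add: sum11[simplified] bc_table D3_5)
  have D5_5: "D 5 5 = (3)*D 1 1 + D 2 2"
    using low[of 4 5] by (simp add: sum11[simplified] bc_table D4_4)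
  have D5_6: "D 5 6 = (2)*D 1 2 + D 2 3"
    using low[of 4 6] by (simp add: sum11[simplified] bc_table D4_5)
  have D5_7: "D 5 7 = (2)*a*D 1 2 + D 1 3 + D 2 4"
    using low[of 4 7] by (simp add: sum11[simplified] bc_table D4_6)
  have D6_6: "D 6 6 = (4)*D 1 1 + D 2 2"
    using low[of 5 6] by (simp add: sum11[simplified] bc_table D5_5)
  have D6_7: "D 6 7 = D 1 2 + D 2 3"
    using low[of 5 7] by (simp add: sum11[simplified] bc_table D5_6)
  have D6_8: "D 6 8 = (3)*a*D 1 2 + (-1)*b*D 1 2 + (3)*D 1 3 + D 2 4"
    using low[of 5 8] by (simp add: sum11[simplified] bc_table D5_7 algebra_simps)
  have D7_7: "D 7 7 = (5)*D 1 1 + D 2 2"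
    using low[of 6 7] by (simp add: sum11[simplified] bc_table D6_6)
  have D7_8: "D 7 8 = (-2)*D 1 2 + D 2 3"
    using low[of 6 8] by (simp add: sum11[simplified] bc_table D6_7)
  have D7_9: "D 7 9 = (4)*a*D 1 2 + (-3)*b*D 1 2 + (2)*D 1 3 + D 2 4"
    using low[of 6 9] by (simp add: sum11[simplified] bc_table D6_8 algebra_simps)
  have D8_8: "D 8 8 = (6)*D 1 1 + D 2 2"
    using low[of 7 8] by (simp add: sum11[simplified] bc_table D7_7)
  have D8_9: "D 8 9 = (-4)*D 1 2 + D 2 3"
    using low[of 7 9] by (simp add: sum11[simplified] bc_table D7_8 algebra_simps)
  have D9_9: "D 9 9 = (7)*D 1 1 + D 2 2"
    using low[of 8 9] by (simp add: sum11[simplified] bc_table D8_8)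
  have D10_10: "D 10 10 = (8)*D 1 1 + D 2 2"
    using low[of 9 10] by (simp add: sum11[simplified] bc_table D9_9)
  note ent = z D3_3 D3_4 D3_5 D3_6 D4_4 D4_5 D4_6 D5_5 D5_6 D5_7 D6_6 D6_7 D6_8 D7_7 D7_8 D7_9 D8_8 D8_9 D9_9 D10_10
  have y1: "D 2 1 = 0"
    using r23[of 4] by (simp add: sum11[simplified] bc_table ent)
  \<comment> \<open>With this the diagonal entry at e_j is j times \<open>D 1 1\<close>: up to scale
    only the weight grading is possible, which for \<alpha> = \<beta> = 0 is a derivation. The next
    four relations measure how \<alpha> and \<beta> obstruct it.\<close>
  have y2: "D 2 2 = 2 * D 1 1"
    using r23[of 5] by (simp add: sum11[simplified] bc_table ent y1)
  have e6: "a * D 1 1 = - 2 * D 1 2"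
    using r23[of 6] by (simp add: sum11[simplified] bc_table ent y1 y2 algebra_simps)
  have e7: "4 * D 2 4 = - 3 * (a * D 1 2)"
    using r23[of 7] by (simp add: sum11[simplified] bc_table ent y1 y2 algebra_simps)
  have e8: "b * D 1 1 = 6 * D 1 2"
    using r34[of 8] by (simp add: sum11[simplified] bc_table ent y2 algebra_simps)
  have e9: "6 * D 2 4 = 11 * (b * D 1 2) - 9 * (a * D 1 2)"
    using r34[of 9] by (simp add: sum11[simplified] bc_table ent y2 algebra_simps)
  have "D 1 1 = 0"
  proof (rule ccontr)
    assume x1: "D 1 1 \<noteq> 0"
    \<comment> \<open>The relations one weight above the diagonal leave the line b = - 3 * a open.
      It is closed two weights above, where the two brackets give different values of
      \<open>D 2 4\<close> unless a * \<open>D 1 2\<close> vanishes.\<close>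
    have "(b + 3 * a) * D 1 1 = 0" using e6 e8 by (simp add: algebra_simps)
    then have b: "b = - 3 * a" using x1 by simp
    have "a * D 1 2 = 0" using e7 e9 by (simp add: b algebra_simps)
    then have "a = 0 \<or> a * D 1 1 = 0" using e6 by auto
    then show False using x1 b nz by auto
  qed
  then show "D 10 k = 0" if "1 \<le> k" "k \<le> 10" for k
    using that D10_10 y2 D_wt[of 9 k] by (cases "k = 10") auto
qed

lemma bv_bracket: "1 \<le> i \<Longrightarrow> i \<le> 11 \<Longrightarrow> 1 \<le> j \<Longrightarrow> j \<le> 11 \<Longrightarrow>
    ad_mat a b (bv i) *v bv j = (\<Sum>k=1..11. bc a b i j k *\<^sub>R bv k)"
proof -
  assume ij: "1 \<le> i" "i \<le> 11" "1 \<le> j" "j \<le> 11"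
  have "(ad_mat a b (bv i) *v bv j) $ m = (\<Sum>k=1..11. bc a b i j k *\<^sub>R bv k) $ m" for m
  proof -
    have m: "1 \<le> idx m" "idx m \<le> 11" by (rule idx_ge_1, rule idx_le_11)
    have ax: "bv k $ ix l = (if l = k then 1 else 0)" if "k \<in> {1..11}" "l \<in> {1..11}" for k l
      using that by (auto simp: axis_def)
    have "(ad_mat a b (bv i) *v bv j) $ ix (idx m) = (\<Sum>k=1..11. if k = i then bc a b i j (idx m) else 0)"
      unfolding ad_bv_right[OF ij(3,4) m] using ij by (intro sum.cong refl) (simp add: ax)
    moreover have "(\<Sum>k=1..11. bc a b i j k *\<^sub>R bv k) $ ix (idx m) = (\<Sum>k=1..11. if k = idx m then bc a b i j (idx m) else 0)"
      unfolding sum_component using m by (intro sum.cong refl) (auto simp: ax simp del: ix_idx)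
    ultimately show ?thesis using ij m by simp
  qed
  then show ?thesis by (simp add: vec_eq_iff)
qed

lemma ad_center: assumes "\<And>k. 1 \<le> k \<Longrightarrow> k \<le> 10 \<Longrightarrow> v $ ix k = 0" shows "ad_mat a b v = 0"
proof -
  have "v $ i * bc a b (idx i) j k = 0" if "1 \<le> j" for i j k
    using assms[of "idx i"] idx_ge_1[of i] bc_weight[of a b "idx i" j k] that by fastforce
  then show ?thesis unfolding vec_eq_iff ad_nth zero_index by (intro allI sum.neutral ballI) (simp only: idx_ge_1)
qed

lemma no_dilations:
  assumes nz: "(a, b) \<noteq> (0, 0)" shows "\<not> admits_dilations (adalg a b)"
proof
  assume "admits_dilations (adalg a b)"
  then obtain A S where lin: "linear A" and Ah: "A ` adalg a b \<subseteq> adalg a b" and S: "independent S" "span S = span (adalg a b)"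
    and eig: "\<forall>v\<in>S. \<exists>c. A v = c *\<^sub>R v"
    and pos: "\<And>v c. v \<in> adalg a b \<Longrightarrow> v \<noteq> 0 \<Longrightarrow> A v = c *\<^sub>R v \<Longrightarrow> c > 0"
    and dil: "\<And>t. t > 0 \<Longrightarrow> (\<forall>X\<in>adalg a b. \<forall>Y\<in>adalg a b. lin_exp (\<lambda>v. ln t *\<^sub>R A v) (mbr X Y) =
        mbr (lin_exp (\<lambda>v. ln t *\<^sub>R A v) X) (lin_exp (\<lambda>v. ln t *\<^sub>R A v) Y))"
    unfolding admits_dilations_def Let_def by blast
  have "subspace (adalg a b)"
    unfolding adalg_def by (rule linear_subspace_image[OF linear_ad subspace_UNIV])
  then have span: "span S = adalg a b" using S(2) by (simp add: span_eq_iff)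
  obtain c where c: "\<And>v. v \<in> S \<Longrightarrow> A v = c v *\<^sub>R v" using eig by metis
  have der: "A (mbr X Y) = mbr (A X) Y + mbr X (A Y)" if "X \<in> adalg a b" "Y \<in> adalg a b" for X Y
  proof (rule dilation_derivation[OF lin S(1) c])
    show "mbr X Y \<in> span S" if "X \<in> span S" "Y \<in> span S" for X Y
      using that unfolding span adalg_def by (auto simp: mbr_ad)
    \<comment> \<open>At t = exp 1 the factor \<open>ln t\<close> is 1, so a single automorphism of
      the family is enough.\<close>
    show "lin_exp A (mbr X Y) = mbr (lin_exp A X) (lin_exp A Y)" if "X \<in> span S" "Y \<in> span S" for X Y
      using dil[of "exp 1"] that unfolding span by simp
  qed (use that span in auto)
  \<comment> \<open>A is lifted to coordinates. As \<open>ad_mat\<close> kills e_11, the lift is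
    determined, and linear, only modulo e_11; therefore all relations are stated for the components
    1 to 10.\<close>
  have "\<exists>y. A (ad_mat a b x) = ad_mat a b y" for x
    using Ah unfolding adalg_def by blast
  then obtain \<delta> where \<delta>: "\<And>x. A (ad_mat a b x) = ad_mat a b (\<delta> x)" by metis
  have leib: "\<delta> (ad_mat a b x *v y) $ ix k = (ad_mat a b (\<delta> x) *v y) $ ix k + (ad_mat a b x *v \<delta> y) $ ix k"
    if "1 \<le> k" "k \<le> 10" for x y k
  proof -
    have "ad_mat a b (\<delta> (ad_mat a b x *v y)) = ad_mat a b (ad_mat a b (\<delta> x) *v y + ad_mat a b x *v \<delta> y)"
      using der[of "ad_mat a b x" "ad_mat a b y"] by (simp add: adalg_def mbr_ad \<delta> ad_add)
    from ad_eqD[OF this that] show ?thesis by simp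
  qed
  have comb: "\<delta> (r *\<^sub>R x + s *\<^sub>R y) $ ix k = r * \<delta> x $ ix k + s * \<delta> y $ ix k"
    if "1 \<le> k" "k \<le> 10" for r x s y k
  proof -
    have "ad_mat a b (\<delta> (r *\<^sub>R x + s *\<^sub>R y)) = ad_mat a b (r *\<^sub>R \<delta> x + s *\<^sub>R \<delta> y)"
      unfolding \<delta>[symmetric] by (simp add: ad_add ad_scaleR linear_add[OF lin] linear_cmul[OF lin] flip: \<delta>)
    from ad_eqD[OF this that] show ?thesis by simp
  qed
  define D where "D j k = \<delta> (bv j) $ ix k" for j k
  have br: "\<delta> (ad_mat a b (bv i) *v bv j) $ ix k = (\<Sum>m=1..11. D i m * bc a b m j k) + (\<Sum>m=1..11. D j m * bc a b i m k)"
    if "1 \<le> i" "i \<le> 11" "1 \<le> j" "j \<le> 11" "1 \<le> k" "k \<le> 10" for i j k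
    using that by (simp add: leib ad_bv_right ad_bv_left D_def)
  have "D 10 k = 0" if "1 \<le> k" "k \<le> 10" for k
  proof (rule derivation_table[OF _ _ _ nz that])
    fix j k :: nat assume jk: "2 \<le> j" "j \<le> 9" "1 \<le> k" "k \<le> 10"
    have "ad_mat a b (bv 1) *v bv j = (\<Sum>k=1..11. bc a b 1 j k *\<^sub>R bv k)"
      using jk by (intro bv_bracket) auto
    also have "\<dots> = (\<Sum>k=1..11. if k = Suc j then bv (Suc j) else 0)"
      using jk by (intro sum.cong refl) (auto simp: bc_table)
    also have "\<dots> = bv (Suc j)" using jk by simp
    finally show "D (Suc j) k = (\<Sum>i=1..11. D 1 i * bc a b i j k) + (\<Sum>i=1..11. D j i * bc a b 1 i k)"
      using br[of 1 j k] jk by (simp add: D_def)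
  next
    fix k :: nat assume k: "1 \<le> k" "k \<le> 10"
    have "ad_mat a b (bv 2) *v bv 3 = 1 *\<^sub>R bv 5 + a *\<^sub>R bv 6"
      by (subst bv_bracket) (simp_all add: sum11[simplified] bc_table)
    then show "D 5 k + a * D 6 k = (\<Sum>i=1..11. D 2 i * bc a b i 3 k) + (\<Sum>i=1..11. D 3 i * bc a b 2 i k)"
      using br[of 2 3 k] comb[OF k, of 1 "bv 5" a "bv 6"] k by (simp add: D_def)
    have "ad_mat a b (bv 3) *v bv 4 = 2 *\<^sub>R bv 7 + b *\<^sub>R bv 8"
      by (subst bv_bracket) (simp_all add: sum11[simplified] bc_table)
    then show "2 * D 7 k + b * D 8 k = (\<Sum>i=1..11. D 3 i * bc a b i 4 k) + (\<Sum>i=1..11. D 4 i * bc a b 3 i k)"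
      using br[of 3 4 k] comb[OF k, of 2 "bv 7" b "bv 8"] k by (simp add: D_def)
  qed
  then have "A (ad_mat a b (bv 10)) = 0 *\<^sub>R ad_mat a b (bv 10)"
    unfolding \<delta> by (simp add: ad_center D_def)
  moreover have "ad_mat a b (bv 10) \<noteq> 0"
    using ad_eq_0[of a b "bv 10" 10] by auto
  ultimately show False using pos[of "ad_mat a b (bv 10)" 0] by (auto simp: adalg_def)
qed

theorem theorem4p5:
  fixes \<alpha> \<beta> :: real
  assumes "(\<alpha>, \<beta>) \<noteq> (0, 0)"
  shows "(\<exists>\<rho>. proj_unitary_rep (GZ \<alpha> \<beta>) \<rho> \<and> irreducible_rep (GZ \<alpha> \<beta>) \<rho> \<and>
              square_integrable_rep (GZ \<alpha> \<beta>) \<rho>)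
         \<and> \<not> admits_dilations (adalg \<alpha> \<beta>)"
  using rho_proj_unitary_rep rho_irreducible rho_square_integrable no_dilations[OF assms] by blast

end
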